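(* Let $R$ be a one dimensional reduced complete Gorenstein (commutative Noetherian) local ring. Then $$\mathrm{ca}(R)=\mathcal{C}(R),$$ where $\mathrm{ca}(R)$ is the cohomology annihilator ideal and $\mathcal C(R)$ is the conductor ideal of $R$.
   Context: The cohomology annihilator of a commutative Noetherian ring $R$ is $\mathrm{ca}(R)=\bigcup_{n\ge 0}\mathrm{ca}^n(R)$, where $\mathrm{ca}^n(R)=\bigcap_{M,N}\mathrm{ann}_R\mathrm{Ext}_R^n(M,N)$, the intersection running over all finitely generated $R$-modules $M,N$. The normalization $\overline{R}$ is the integral closure of $R$ in its total quotient ring, and the conductor is $\mathcal C(R)=\{r\in R : rq\in R \text{ for all } q\in\overline R\}=\mathrm{ann}_R(\overline R/R)$. Gorenstein means of finite injective dimension as a module over itself. *)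

theory Defs
  imports "HOL-Algebra.Algebra" "HOL-Library.Extended_Nat"
begin

section \<open>Commutative rings\<close>

definition local_ring :: "('a, 'm) ring_scheme \<Rightarrow> bool" where
  "local_ring R \<longleftrightarrow> cring R \<and> (\<exists>!\<mm>. maximalideal \<mm> R)"

definition max_ideal :: "('a, 'm) ring_scheme \<Rightarrow> 'a set" where
  "max_ideal R = (THE \<mm>. maximalideal \<mm> R)"

definition reduced_ring :: "('a, 'm) ring_scheme \<Rightarrow> bool" where
  "reduced_ring R \<longleftrightarrow>
     (\<forall>x \<in> carrier R. \<forall>n::nat. x [^]\<^bsub>R\<^esub> n = \<zero>\<^bsub>R\<^esub> \<longrightarrow> x = \<zero>\<^bsub>R\<^esub>)"

definition krull_dim :: "('a, 'm) ring_scheme \<Rightarrow> enat" where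
  "krull_dim R = Sup {enat n | n. \<exists>\<pp> :: nat \<Rightarrow> 'a set.
     (\<forall>i \<le> n. primeideal (\<pp> i) R) \<and> (\<forall>i < n. \<pp> i \<subset> \<pp> (Suc i))}"

text \<open>The power of an ideal is its power in the monoid of ideals, with zeroth power the whole
  ring. Completeness includes separatedness: limits of Cauchy sequences are unique.\<close>

definition adic_cauchy :: "('a, 'm) ring_scheme \<Rightarrow> 'a set \<Rightarrow> (nat \<Rightarrow> 'a) \<Rightarrow> bool" where
  "adic_cauchy R I s \<longleftrightarrow> (\<forall>k::nat. \<exists>N. \<forall>i \<ge> N. \<forall>j \<ge> N.
     s i \<ominus>\<^bsub>R\<^esub> s j \<in> I [^]\<^bsub>ideals_set R\<^esub> k)"

definition adic_limit :: "('a, 'm) ring_scheme \<Rightarrow> 'a set \<Rightarrow> (nat \<Rightarrow> 'a) \<Rightarrow> 'a \<Rightarrow> bool" where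
  "adic_limit R I s x \<longleftrightarrow> (\<forall>k::nat. \<exists>N. \<forall>i \<ge> N. s i \<ominus>\<^bsub>R\<^esub> x \<in> I [^]\<^bsub>ideals_set R\<^esub> k)"

definition adic_complete :: "('a, 'm) ring_scheme \<Rightarrow> 'a set \<Rightarrow> bool" where
  "adic_complete R I \<longleftrightarrow> (\<forall>s \<in> UNIV \<rightarrow> carrier R.
     adic_cauchy R I s \<longrightarrow> (\<exists>!x. x \<in> carrier R \<and> adic_limit R I s x))"

definition complete_local_ring :: "('a, 'm) ring_scheme \<Rightarrow> bool" where
  "complete_local_ring R \<longleftrightarrow> local_ring R \<and> adic_complete R (max_ideal R)"


section \<open>Total quotient ring, normalization and conductor\<close>

definition nonzerodivisors :: "('a, 'm) ring_scheme \<Rightarrow> 'a set" where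
  "nonzerodivisors R = {s \<in> carrier R. \<forall>a \<in> carrier R. a \<otimes>\<^bsub>R\<^esub> s = \<zero>\<^bsub>R\<^esub> \<longrightarrow> a = \<zero>\<^bsub>R\<^esub>}"

text \<open>The fraction a/s, as an equivalence class of pairs. Cross-multiplication is the right
  relation here because all denominators are nonzerodivisors. The operations are those on
  representatives; the unions are over equal sets.\<close>

definition fraction :: "('a, 'm) ring_scheme \<Rightarrow> 'a \<Rightarrow> 'a \<Rightarrow> ('a \<times> 'a) set" where
  "fraction R a s = {(b, t). b \<in> carrier R \<and> t \<in> nonzerodivisors R \<and> a \<otimes>\<^bsub>R\<^esub> t = b \<otimes>\<^bsub>R\<^esub> s}"

definition total_quotient_ring :: "('a, 'm) ring_scheme \<Rightarrow> ('a \<times> 'a) set ring" where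
  "total_quotient_ring R =
    \<lparr>carrier = {fraction R a s | a s. a \<in> carrier R \<and> s \<in> nonzerodivisors R},
     monoid.mult = (\<lambda>U V. \<Union>(a, s) \<in> U. \<Union>(b, t) \<in> V. fraction R (a \<otimes>\<^bsub>R\<^esub> b) (s \<otimes>\<^bsub>R\<^esub> t)),
     monoid.one = fraction R \<one>\<^bsub>R\<^esub> \<one>\<^bsub>R\<^esub>,
     ring.zero = fraction R \<zero>\<^bsub>R\<^esub> \<one>\<^bsub>R\<^esub>,
     ring.add = (\<lambda>U V. \<Union>(a, s) \<in> U. \<Union>(b, t) \<in> V.
              fraction R (a \<otimes>\<^bsub>R\<^esub> t \<oplus>\<^bsub>R\<^esub> b \<otimes>\<^bsub>R\<^esub> s) (s \<otimes>\<^bsub>R\<^esub> t))\<rparr>"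

definition tq_embed :: "('a, 'm) ring_scheme \<Rightarrow> 'a \<Rightarrow> ('a \<times> 'a) set" where
  "tq_embed R a = fraction R a \<one>\<^bsub>R\<^esub>"

text \<open>The elements annihilated by a monic polynomial with coefficients in R (of degree n, with
  lower coefficients c 0, ..., c (n - 1)).\<close>

definition normalization :: "('a, 'm) ring_scheme \<Rightarrow> ('a \<times> 'a) set set" where
  "normalization R = (let Q = total_quotient_ring R in
     {q \<in> carrier Q. \<exists>n::nat. \<exists>c \<in> {..<n} \<rightarrow> carrier R.
        q [^]\<^bsub>Q\<^esub> n \<oplus>\<^bsub>Q\<^esub> (\<Oplus>\<^bsub>Q\<^esub>i\<in>{..<n}. tq_embed R (c i) \<otimes>\<^bsub>Q\<^esub> q [^]\<^bsub>Q\<^esub> i) = \<zero>\<^bsub>Q\<^esub>})"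

definition conductor :: "('a, 'm) ring_scheme \<Rightarrow> 'a set" where
  "conductor R = {r \<in> carrier R. \<forall>q \<in> normalization R.
     tq_embed R r \<otimes>\<^bsub>total_quotient_ring R\<^esub> q \<in> tq_embed R ` carrier R}"


section \<open>Modules\<close>

text \<open>The multiplicative fields inherited from ring records play no role in a module and are left
  undefined in the constructions below. Homomorphisms are extensional functions.\<close>

definition mod_hom :: "('a, 'm) ring_scheme \<Rightarrow> ('a, 'b) module \<Rightarrow> ('a, 'c) module \<Rightarrow> ('b \<Rightarrow> 'c) set"
  where
  "mod_hom R M N = {f \<in> carrier M \<rightarrow>\<^sub>E carrier N.
     (\<forall>x \<in> carrier M. \<forall>y \<in> carrier M. f (x \<oplus>\<^bsub>M\<^esub> y) = f x \<oplus>\<^bsub>N\<^esub> f y) \<and>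
     (\<forall>r \<in> carrier R. \<forall>x \<in> carrier M. f (r \<odot>\<^bsub>M\<^esub> x) = r \<odot>\<^bsub>N\<^esub> f x)}"

definition hom_module ::
  "('a, 'm) ring_scheme \<Rightarrow> ('a, 'b) module \<Rightarrow> ('a, 'c) module \<Rightarrow> ('a, 'b \<Rightarrow> 'c) module" where
  "hom_module R M N =
    \<lparr>carrier = mod_hom R M N, monoid.mult = undefined, monoid.one = undefined,
     ring.zero = (\<lambda>x \<in> carrier M. \<zero>\<^bsub>N\<^esub>),
     ring.add = (\<lambda>f g. \<lambda>x \<in> carrier M. f x \<oplus>\<^bsub>N\<^esub> g x),
     smult = (\<lambda>r f. \<lambda>x \<in> carrier M. r \<odot>\<^bsub>N\<^esub> f x)\<rparr>"

definition quotient_module :: "('a, 'b) module \<Rightarrow> 'b set \<Rightarrow> ('a, 'b set) module" where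
  "quotient_module M H =
    \<lparr>carrier = a_rcosets\<^bsub>M\<^esub> H, monoid.mult = undefined, monoid.one = undefined,
     ring.zero = H,
     ring.add = set_add M,
     smult = (\<lambda>r U. \<Union>x \<in> U. H +>\<^bsub>M\<^esub> (r \<odot>\<^bsub>M\<^esub> x))\<rparr>"

definition ring_module :: "('a, 'm) ring_scheme \<Rightarrow> ('a, 'a) module" where
  "ring_module R =
    \<lparr>carrier = carrier R, monoid.mult = monoid.mult R, monoid.one = monoid.one R,
     ring.zero = ring.zero R, ring.add = ring.add R, smult = monoid.mult R\<rparr>"

definition free_module :: "('a, 'm) ring_scheme \<Rightarrow> nat \<Rightarrow> ('a, nat \<Rightarrow> 'a) module" where
  "free_module R b =
    \<lparr>carrier = {..<b} \<rightarrow>\<^sub>E carrier R, monoid.mult = undefined, monoid.one = undefined,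
     ring.zero = (\<lambda>i \<in> {..<b}. \<zero>\<^bsub>R\<^esub>),
     ring.add = (\<lambda>x y. \<lambda>i \<in> {..<b}. x i \<oplus>\<^bsub>R\<^esub> y i),
     smult = (\<lambda>r x. \<lambda>i \<in> {..<b}. r \<otimes>\<^bsub>R\<^esub> x i)\<rparr>"

definition fin_gen_module :: "('a, 'm) ring_scheme \<Rightarrow> ('a, 'b) module \<Rightarrow> bool" where
  "fin_gen_module R M \<longleftrightarrow> module R M \<and> (\<exists>n. \<exists>g \<in> {..<n::nat} \<rightarrow> carrier M.
     \<forall>x \<in> carrier M. \<exists>c \<in> {..<n} \<rightarrow> carrier R. x = (\<Oplus>\<^bsub>M\<^esub>i\<in>{..<n}. c i \<odot>\<^bsub>M\<^esub> g i))"

definition mod_ann :: "('a, 'm) ring_scheme \<Rightarrow> ('a, 'b) module \<Rightarrow> 'a set" where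
  "mod_ann R M = {r \<in> carrier R. \<forall>x \<in> carrier M. r \<odot>\<^bsub>M\<^esub> x = \<zero>\<^bsub>M\<^esub>}"

text \<open>A definition cannot quantify over modules on all types, so quantifiers over modules range
  over modules whose carrier lies in the type of sets of sequences of ring elements. Up to
  isomorphism these include all finitely generated modules (lemma \<open>fin_gen_module_transfer\<close>
  below), and indeed all modules of cardinality at most that of this type.\<close>

type_synonym 'a univ = "(nat \<Rightarrow> 'a) set"

lemma transport_module:
  fixes M :: "('a, 'b) module" and j :: "'b \<Rightarrow> 'c"
  assumes M: "module R M" and j: "inj_on j (carrier M)"
  shows "\<exists>N :: ('a, 'c) module. module R N \<and>
    (\<exists>f \<in> mod_hom R M N. bij_betw f (carrier M) (carrier N))"
proof -
  interpret M: module R M by (rule M)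
  define k where "k = the_inv_into (carrier M) j"
  have k [simp]: "k (j x) = x" if "x \<in> carrier M" for x
    using that j by (simp add: k_def the_inv_into_f_f)
  define N :: "('a, 'c) module" where "N =
    \<lparr>carrier = j ` carrier M, monoid.mult = undefined, monoid.one = undefined,
     ring.zero = j \<zero>\<^bsub>M\<^esub>,
     ring.add = (\<lambda>x y. j (k x \<oplus>\<^bsub>M\<^esub> k y)), smult = (\<lambda>r x. j (r \<odot>\<^bsub>M\<^esub> k x))\<rparr>"
  have "abelian_group N"
  proof (rule abelian_groupI)
    show "\<exists>y \<in> carrier N. y \<oplus>\<^bsub>N\<^esub> x = \<zero>\<^bsub>N\<^esub>" if x: "x \<in> carrier N" for x
    proof -
      obtain a where a: "a \<in> carrier M" "x = j a" using x by (auto simp: N_def)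
      show ?thesis using a by (intro bexI[of _ "j (\<ominus>\<^bsub>M\<^esub> a)"]) (auto simp: N_def M.M.l_neg)
    qed
  qed (auto simp: N_def M.M.a_ac)
  then have "module R N"
    by (intro moduleI M.R.cring_axioms)
      (auto simp: N_def M.smult_l_distr M.smult_r_distr M.smult_assoc1)
  moreover have "restrict j (carrier M) \<in> mod_hom R M N"
    by (auto simp: mod_hom_def N_def)
  moreover have "bij_betw (restrict j (carrier M)) (carrier M) (carrier N)"
    using j by (auto simp: bij_betw_def N_def inj_on_def)
  ultimately show ?thesis by blast
qed

lemma fin_gen_module_transfer:
  fixes R :: "('a, 'm) ring_scheme" and M :: "('a, 'b) module"
  assumes "fin_gen_module R M"
  shows "\<exists>N :: ('a, 'a univ) module. module R N \<and>
    (\<exists>f \<in> mod_hom R M N. bij_betw f (carrier M) (carrier N))"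
proof -
  from assms obtain n g where M: "module R M"
    and gen: "\<forall>x \<in> carrier M. \<exists>c \<in> {..<n::nat} \<rightarrow> carrier R. x = (\<Oplus>\<^bsub>M\<^esub>i\<in>{..<n}. c i \<odot>\<^bsub>M\<^esub> g i)"
    unfolding fin_gen_module_def by blast
  define j where "j x = {c \<in> {..<n} \<rightarrow> carrier R. x = (\<Oplus>\<^bsub>M\<^esub>i\<in>{..<n}. c i \<odot>\<^bsub>M\<^esub> g i)}" for x
  have "inj_on j (carrier M)"
  proof (rule inj_onI)
    fix x y assume "x \<in> carrier M" "y \<in> carrier M" "j x = j y"
    moreover then obtain c where "c \<in> j x" using gen by (auto simp: j_def)
    ultimately show "x = y" by (auto simp: j_def)
  qed
  from transport_module[OF M this] show ?thesis .
qed


section \<open>Ext and the cohomology annihilator\<close>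

text \<open>A resolution of M by free modules of finite ranks b i, with differentials d i from degree
  i + 1 to degree i and augmentation e. Over a Noetherian ring every finitely generated module
  has one.\<close>

definition free_resolution :: "('a, 'm) ring_scheme \<Rightarrow> ('a, 'b) module \<Rightarrow> (nat \<Rightarrow> nat) \<Rightarrow>
    (nat \<Rightarrow> (nat \<Rightarrow> 'a) \<Rightarrow> (nat \<Rightarrow> 'a)) \<Rightarrow> ((nat \<Rightarrow> 'a) \<Rightarrow> 'b) \<Rightarrow> bool" where
  "free_resolution R M b d e \<longleftrightarrow> (let F = (\<lambda>i. free_module R (b i)) in
     e \<in> mod_hom R (F 0) M \<and>
     e ` carrier (F 0) = carrier M \<and>
     (\<forall>i. d i \<in> mod_hom R (F (Suc i)) (F i)) \<and>
     d 0 ` carrier (F (Suc 0)) = a_kernel (F 0) M e \<and>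
     (\<forall>i. d (Suc i) ` carrier (F (Suc (Suc i))) = a_kernel (F (Suc i)) (F i) (d i)))"

definition chosen_resolution :: "('a, 'm) ring_scheme \<Rightarrow> ('a, 'b) module \<Rightarrow>
    (nat \<Rightarrow> nat) \<times> (nat \<Rightarrow> (nat \<Rightarrow> 'a) \<Rightarrow> (nat \<Rightarrow> 'a))" where
  "chosen_resolution R M = (SOME (b, d). \<exists>e. free_resolution R M b d e)"

definition cocycles :: "('a, 'm) ring_scheme \<Rightarrow> (nat \<Rightarrow> nat) \<Rightarrow>
    (nat \<Rightarrow> (nat \<Rightarrow> 'a) \<Rightarrow> (nat \<Rightarrow> 'a)) \<Rightarrow> ('a, 'c) module \<Rightarrow> nat \<Rightarrow> ((nat \<Rightarrow> 'a) \<Rightarrow> 'c) set" where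
  "cocycles R b d N n = {f \<in> mod_hom R (free_module R (b n)) N.
     \<forall>x \<in> carrier (free_module R (b (Suc n))). f (d n x) = \<zero>\<^bsub>N\<^esub>}"

fun coboundaries :: "('a, 'm) ring_scheme \<Rightarrow> (nat \<Rightarrow> nat) \<Rightarrow>
    (nat \<Rightarrow> (nat \<Rightarrow> 'a) \<Rightarrow> (nat \<Rightarrow> 'a)) \<Rightarrow> ('a, 'c) module \<Rightarrow> nat \<Rightarrow> ((nat \<Rightarrow> 'a) \<Rightarrow> 'c) set" where
  "coboundaries R b d N 0 = {\<zero>\<^bsub>hom_module R (free_module R (b 0)) N\<^esub>}"
| "coboundaries R b d N (Suc n) =
     (\<lambda>f. \<lambda>x \<in> carrier (free_module R (b (Suc n))). f (d n x)) ` mod_hom R (free_module R (b n)) N"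

text \<open>Ext is the cohomology of the complex of homomorphisms from the chosen resolution of M
  to N.\<close>

definition ext_module :: "('a, 'm) ring_scheme \<Rightarrow> nat \<Rightarrow> ('a, 'b) module \<Rightarrow> ('a, 'c) module \<Rightarrow>
    ('a, ((nat \<Rightarrow> 'a) \<Rightarrow> 'c) set) module" where
  "ext_module R n M N = (let (b, d) = chosen_resolution R M in
     quotient_module
       (hom_module R (free_module R (b n)) N \<lparr>carrier := cocycles R b d N n\<rparr>)
       (coboundaries R b d N n))"

definition coh_ann_n :: "('a, 'm) ring_scheme \<Rightarrow> nat \<Rightarrow> 'a set" where
  "coh_ann_n R n = {r \<in> carrier R. \<forall>(M :: ('a, 'a univ) module) (N :: ('a, 'a univ) module).
     fin_gen_module R M \<and> fin_gen_module R N \<longrightarrow> r \<in> mod_ann R (ext_module R n M N)}"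

definition coh_ann :: "('a, 'm) ring_scheme \<Rightarrow> 'a set" where
  "coh_ann R = (\<Union>n. coh_ann_n R n)"


section \<open>Injective dimension and Gorenstein rings\<close>

text \<open>Test modules with carrier in \<open>univ\<close> suffice: they include copies of R and its ideals, so by
  Baer's criterion the lifting property then holds for all modules.\<close>

definition injective_module :: "('a, 'm) ring_scheme \<Rightarrow> ('a, 'b) module \<Rightarrow> bool" where
  "injective_module R I \<longleftrightarrow> module R I \<and>
     (\<forall>(A :: ('a, 'a univ) module) (B :: ('a, 'a univ) module). \<forall>f \<in> mod_hom R A B. \<forall>g \<in> mod_hom R A I.
        module R A \<and> module R B \<and> inj_on f (carrier A) \<longrightarrow>
        (\<exists>h \<in> mod_hom R B I. \<forall>x \<in> carrier A. h (f x) = g x))"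

definition injective_resolution :: "('a, 'm) ring_scheme \<Rightarrow> ('a, 'b) module \<Rightarrow>
    (nat \<Rightarrow> ('a, 'c) module) \<Rightarrow> ('b \<Rightarrow> 'c) \<Rightarrow> (nat \<Rightarrow> 'c \<Rightarrow> 'c) \<Rightarrow> bool" where
  "injective_resolution R M I e d \<longleftrightarrow>
     (\<forall>i. injective_module R (I i)) \<and>
     e \<in> mod_hom R M (I 0) \<and>
     inj_on e (carrier M) \<and>
     (\<forall>i. d i \<in> mod_hom R (I i) (I (Suc i))) \<and>
     e ` carrier M = a_kernel (I 0) (I (Suc 0)) (d 0) \<and>
     (\<forall>i. d i ` carrier (I i) = a_kernel (I (Suc i)) (I (Suc (Suc i))) (d (Suc i)))"

text \<open>Over a Noetherian ring R, the injective hull of a module of cardinality at most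
  max(|R|, aleph-0) is again of at most that cardinality. So a finitely generated module of finite
  injective dimension has a finite injective resolution with carriers in \<open>univ\<close>.\<close>

definition finite_injective_dimension :: "('a, 'm) ring_scheme \<Rightarrow> ('a, 'b) module \<Rightarrow> bool" where
  "finite_injective_dimension R M \<longleftrightarrow>
     (\<exists>(I :: nat \<Rightarrow> ('a, 'a univ) module) e d n. injective_resolution R M I e d \<and>
        (\<forall>i > n. carrier (I i) = {\<zero>\<^bsub>I i\<^esub>}))"

definition gorenstein_ring :: "('a, 'm) ring_scheme \<Rightarrow> bool" where
  "gorenstein_ring R \<longleftrightarrow> finite_injective_dimension R (ring_module R)"

end

theory Submission
  imports Defs
begin

text \<open>Let \<open>S\<close> be the normalization of \<open>R\<close>, inside the total quotient ring \<open>Q\<close>.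

  Every element of \<open>Q\<close> is a root of a polynomial over \<open>R\<close> with a unit among its coefficients. Hence
  finitely generated \<open>S\<close>-submodules of \<open>Q\<close> are projective, and so are those of \<open>Q^n\<close>. If \<open>T\<close> is the
  submodule of \<open>R^n\<close> generated by \<open>m 1, ..., m k\<close>, this gives \<open>R\<close>-linear maps \<open>f i\<close> from \<open>T\<close> to \<open>S\<close> with
  \<open>x = f 1 x m 1 + ... + f k x m k\<close> for \<open>x \<in> T\<close>. For \<open>c\<close> in the conductor the maps \<open>c f i\<close> have values in
  \<open>R\<close>, so that multiplication by \<open>c\<close> on \<open>T\<close> factors through a free module. As first syzygies are
  such modules \<open>T\<close>, the conductor annihilates all \<open>Ext\<^sup>2\<close>.

  Conversely let \<open>r\<close> annihilate all \<open>Ext\<^sup>n\<close> and let \<open>q \<in> S\<close>. There is an ideal \<open>J\<close> containing a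
  nonzerodivisor with \<open>q J \<subseteq> J\<close>. Since \<open>R\<close> is Gorenstein of dimension one, the first cosyzygy of \<open>R\<close> is
  injective, and \<open>Ext\<close> into \<open>R\<close> vanishes on \<open>J\<close> and its syzygies. Therefore multiplication by \<open>r\<close> on
  \<open>J\<close> factors through a free module, and \<open>r\<close> is a sum of elements \<open>u s\<close> of \<open>Q\<close> with \<open>u J \<subseteq> R\<close> and
  \<open>s J \<subseteq> J\<close>. The set of these sums is stable under multiplication by \<open>q\<close>, so \<open>r q \<in> R\<close>.\<close>

section \<open>Noetherian rings of dimension one\<close>

text \<open>Projectivity over \<open>S\<close> is made explicit rather than drawn from a
  decomposition into Dedekind domains. Let \<open>t\<close> in \<open>Q\<close> have a nonunit
  denominator \<open>b\<close>. A Krull-Akizuki argument shows that some \<open>t^N\<close> is a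
  combination of lower powers modulo \<open>b R[t]\<close>. In the resulting relation
  \<open>t^N\<close> has a coefficient \<open>1 - b c\<close>, a unit since \<open>R\<close> is
  local. The partial Horner sums of that relation invert the fractional ideal generated by
  \<open>1\<close> and \<open>t\<close>; as \<open>Q\<close> is von Neumann regular, idempotents
  carry this over to arbitrary finite columns with zero divisors.

  The second Ext appears because the factorization concerns submodules of free modules, and the
  first syzygy is one.

  On the Gorenstein side, injectivity of the cosyzygies descends from the end of the finite
  injective resolution. Images of injectives are divisible by nonzerodivisors, and a prime
  containing a nonzerodivisor \<open>x\<close> is the maximal ideal and associated to
  \<open>R/xR\<close>. So Baer's criterion reduces to divisibility and to vanishing of Ext on ideals
  with at most two generators.\<close>

lemma (in abelian_group) minus_eq_zero_iff [simp]:
  assumes "x \<in> carrier G" "y \<in> carrier G" shows "x \<ominus> y = \<zero> \<longleftrightarrow> x = y"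
proof
  assume "x \<ominus> y = \<zero>"
  then have "x \<ominus> y \<oplus> y = \<zero> \<oplus> y" by simp
  then show "x = y" using assms by (simp add: a_minus_def a_assoc l_neg)
qed (use assms in \<open>simp add: a_minus_def r_neg\<close>)

locale noetherian_cring = noetherian_ring R + cring R for R (structure)

context noetherian_cring
begin

lemma exists_maximal_ideal_in_family:
  assumes "S \<noteq> {}" and "\<And>I. I \<in> S \<Longrightarrow> ideal I R"
  shows "\<exists>M\<in>S. \<forall>I\<in>S. M \<subseteq> I \<longrightarrow> I = M"
proof (rule subset_Zorn_nonempty[OF assms(1)])
  fix C assume C: "C \<noteq> {}" "subset.chain S C"
  then have "subset.chain {I. ideal I R} C"
    using assms(2) by (auto simp: subset.chain_def)
  then show "\<Union>C \<in> S"
    using ideal_chain_is_trivial[OF C(1)] C(2) by (auto simp: subset.chain_def)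
qed

lemma ascending_ideals_stabilise:
  assumes "\<And>n. ideal (I n) R" and "\<And>n. I n \<subseteq> I (Suc n)"
  shows "\<exists>N. \<forall>n\<ge>N. I n = I N"
proof -
  have "\<exists>M\<in>range I. \<forall>J\<in>range I. M \<subseteq> J \<longrightarrow> J = M"
    by (rule exists_maximal_ideal_in_family[of "range I"]) (use assms(1) in auto)
  then obtain M where "M \<in> range I" and max: "\<forall>J\<in>range I. M \<subseteq> J \<longrightarrow> J = M"
    by (rule bexE)
  then obtain N where N: "M = I N" by auto
  have "I n = I N" if "N \<le> n" for n
  proof -
    have "I N \<subseteq> I n" using assms(2) that by (rule lift_Suc_mono_le)
    then show ?thesis using max N by auto
  qed
  then show ?thesis by blast
qed

end

definition annihilator :: "('a, 'm) ring_scheme \<Rightarrow> 'a set \<Rightarrow> 'a set" where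
  "annihilator R S = {r \<in> carrier R. \<forall>s \<in> S. r \<otimes>\<^bsub>R\<^esub> s = \<zero>\<^bsub>R\<^esub>}"

context cring
begin

lemma ideal_criterion:
  assumes "I \<subseteq> carrier R" "\<zero> \<in> I"
    and "\<And>x y. x \<in> I \<Longrightarrow> y \<in> I \<Longrightarrow> x \<oplus> y \<in> I"
    and m: "\<And>r x. r \<in> carrier R \<Longrightarrow> x \<in> I \<Longrightarrow> r \<otimes> x \<in> I"
  shows "ideal I R"
proof (rule idealI)
  have "\<ominus> x \<in> I" if "x \<in> I" for x
    using m[of "\<ominus> \<one>" x] that assms(1) by (auto simp: l_minus)
  then show "subgroup I (add_monoid R)"
    using assms by (intro subgroup.intro) (auto simp: a_inv_def)
next
  fix x y assume "x \<in> I" "y \<in> carrier R"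
  then show "y \<otimes> x \<in> I" "x \<otimes> y \<in> I"
    using m assms(1) m_comm[of x y] by auto
qed (rule ring_axioms)

lemma ideal_mult_closed:
  assumes "ideal I R" "r \<in> carrier R" "x \<in> I" shows "r \<otimes> x \<in> I"
  using ideal.I_l_closed[OF assms(1,3,2)] .

lemma ideal_add_closed:
  assumes "ideal I R" "x \<in> I" "y \<in> I" shows "x \<oplus> y \<in> I"
  using additive_subgroup.a_closed[OF ideal.axioms(1)[OF assms(1)] assms(2,3)] .

lemma ideal_zero:
  assumes "ideal I R" shows "\<zero> \<in> I"
  using additive_subgroup.zero_closed[OF ideal.axioms(1)[OF assms]] .

lemma ideal_carrier:
  assumes "ideal I R" "x \<in> I" shows "x \<in> carrier R"
  using additive_subgroup.a_Hcarr[OF ideal.axioms(1)[OF assms(1)] assms(2)] .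

lemma ideal_minus_closed:
  assumes "ideal I R" "x \<in> I" "y \<in> I" shows "x \<ominus> y \<in> I"
  unfolding a_minus_def
  using ideal_add_closed[OF assms(1,2) additive_subgroup.a_inv_closed[OF ideal.axioms(1)[OF assms(1)] assms(3)]] .

lemma annihilator_ideal:
  assumes "S \<subseteq> carrier R" shows "ideal (annihilator R S) R"
  by (rule ideal_criterion) (use assms in \<open>auto simp: annihilator_def l_distr m_assoc subset_iff\<close>)

lemma minus_self [simp]: "x \<in> carrier R \<Longrightarrow> x \<ominus> x = \<zero>"
  by simp

lemma minus_arith:
  assumes [simp]: "x \<in> carrier R" "y \<in> carrier R" "z \<in> carrier R"
  shows "(x \<ominus> y) \<otimes> z = x \<otimes> z \<ominus> y \<otimes> z" "z \<otimes> (x \<ominus> y) = z \<otimes> x \<ominus> z \<otimes> y"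
    "x \<oplus> (y \<ominus> z) = (x \<oplus> y) \<ominus> z" "(x \<ominus> y) \<oplus> z = (x \<oplus> z) \<ominus> y"
    "x \<ominus> (y \<ominus> z) = (x \<oplus> z) \<ominus> y" "(x \<ominus> y) \<ominus> z = x \<ominus> (y \<oplus> z)"
    "x \<oplus> \<ominus> y = x \<ominus> y" "\<ominus> x \<oplus> y = y \<ominus> x" "\<ominus> (x \<ominus> y) = y \<ominus> x"
proof -
  show "x \<ominus> (y \<ominus> z) = (x \<oplus> z) \<ominus> y" "(x \<ominus> y) \<ominus> z = x \<ominus> (y \<oplus> z)" "\<ominus> (x \<ominus> y) = y \<ominus> x"
    by (simp_all add: a_minus_def minus_add a_ac)
qed (simp_all add: a_minus_def l_distr r_distr l_minus r_minus a_ac)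

lemma minus_eq_iff:
  assumes [simp]: "x \<in> carrier R" "y \<in> carrier R" "z \<in> carrier R"
  shows "x \<ominus> y = z \<longleftrightarrow> x = z \<oplus> y" and "z = x \<ominus> y \<longleftrightarrow> z \<oplus> y = x"
proof -
  show "x \<ominus> y = z \<longleftrightarrow> x = z \<oplus> y"
    using add.inv_solve_right'[of z x y] by (auto simp: a_minus_def a_inv_def[symmetric] a_assoc l_neg r_neg)
  then show "z = x \<ominus> y \<longleftrightarrow> z \<oplus> y = x" by metis
qed

text \<open>A normal form for commutative ring terms with subtraction: differences move outwards
  until a term is one difference of sums, and an equation between differences becomes one between
  sums.\<close>

lemmas ring_arith = minus_arith minus_eq_iff l_distr r_distr l_minus r_minus m_ac a_ac

lemma nonzerodivisor_closed: "s \<in> nonzerodivisors R \<Longrightarrow> s \<in> carrier R"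
  by (simp add: nonzerodivisors_def)

lemma nonzerodivisor_one: "\<one> \<in> nonzerodivisors R"
  by (simp add: nonzerodivisors_def)

lemma nonzerodivisorD:
  assumes "s \<in> nonzerodivisors R" "a \<in> carrier R" "a \<otimes> s = \<zero>" shows "a = \<zero>"
  using assms by (simp add: nonzerodivisors_def)

lemma nonzerodivisor_mult:
  assumes s: "s \<in> nonzerodivisors R" and t: "t \<in> nonzerodivisors R"
  shows "s \<otimes> t \<in> nonzerodivisors R"
proof -
  note c = nonzerodivisor_closed[OF s] nonzerodivisor_closed[OF t]
  have "a = \<zero>" if a: "a \<in> carrier R" "a \<otimes> (s \<otimes> t) = \<zero>" for a
  proof -
    have "(a \<otimes> s) \<otimes> t = \<zero>" using a c by (simp add: m_assoc)
    then have "a \<otimes> s = \<zero>" using nonzerodivisorD[OF t, of "a \<otimes> s"] a c by simp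
    then show ?thesis by (rule nonzerodivisorD[OF s a(1)])
  qed
  then show ?thesis using c by (simp add: nonzerodivisors_def)
qed

lemma nonzerodivisor_pow:
  "s \<in> nonzerodivisors R \<Longrightarrow> s [^] (n::nat) \<in> nonzerodivisors R"
  by (induction n) (auto intro: nonzerodivisor_mult nonzerodivisor_one)

lemma nonzerodivisor_cancel:
  assumes "s \<in> nonzerodivisors R" "a \<in> carrier R" "b \<in> carrier R" "s \<otimes> a = s \<otimes> b"
  shows "a = b"
proof -
  have s: "s \<in> carrier R" using assms(1) by (rule nonzerodivisor_closed)
  have "(a \<ominus> b) \<otimes> s = s \<otimes> a \<ominus> s \<otimes> b"
    using s assms(2,3) by (simp add: ring_arith)
  also have "\<dots> = \<zero>" using s assms(2-4) by (simp add: r_right_minus_eq)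
  finally have "a \<ominus> b = \<zero>" using assms(1-3) by (auto simp: nonzerodivisors_def)
  then show ?thesis using assms(2,3) by simp
qed

end

section \<open>Reduced rings: annihilators and regular elements\<close>

locale reduced_noetherian_cring = noetherian_cring R for R (structure) +
  assumes reduced: "reduced_ring R"
begin

lemma square_zero: "x \<in> carrier R \<Longrightarrow> x \<otimes> x = \<zero> \<Longrightarrow> x = \<zero>"
proof -
  assume "x \<in> carrier R" "x \<otimes> x = \<zero>"
  moreover from this have "x [^] (2::nat) = \<zero>" by (simp add: numeral_2_eq_2)
  ultimately show ?thesis using reduced unfolding reduced_ring_def by blast
qed

text \<open>Enlarging \<open>a\<close> by an element \<open>x\<close> of the ideal with \<open>x a = 0\<close> and \<open>x \<noteq> 0\<close> strictly
  shrinks its annihilator, because the ring is reduced.\<close>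

lemma ideal_element_with_same_annihilator:
  assumes J: "ideal J R"
  shows "\<exists>a\<in>J. \<forall>y\<in>carrier R. y \<otimes> a = \<zero> \<longrightarrow> (\<forall>j\<in>J. y \<otimes> j = \<zero>)"
proof -
  \<comment> \<open>A second annihilator reverses inclusions once more, so that an element with
    minimal annihilator is found by the maximality principle for ideals of a Noetherian
    ring.\<close>
  let ?AA = "\<lambda>a. annihilator R (annihilator R {a})"
  have ann_carrier: "annihilator R S \<subseteq> carrier R" for S by (auto simp: annihilator_def)
  have ne: "?AA ` J \<noteq> {}" using ideal_zero[OF J] by auto
  have id: "ideal I R" if "I \<in> ?AA ` J" for I
    using that annihilator_ideal ann_carrier by auto
  obtain M where "M \<in> ?AA ` J" and max: "\<forall>I \<in> ?AA ` J. M \<subseteq> I \<longrightarrow> I = M"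
    using exists_maximal_ideal_in_family[OF ne id] by (rule bexE)
  then obtain a where a: "a \<in> J" and M: "M = ?AA a" by auto
  have ac: "a \<in> carrier R" using ideal_carrier[OF J a] .
  have "y \<otimes> j = \<zero>" if y: "y \<in> carrier R" "y \<otimes> a = \<zero>" and j: "j \<in> J" for y j
  proof -
    have jc: "j \<in> carrier R" using ideal_carrier[OF J j] .
    define x where "x = y \<otimes> j"
    have x: "x \<in> J" "x \<in> carrier R" using ideal_mult_closed[OF J y(1) j] y jc by (auto simp: x_def)
    have "x \<otimes> a = y \<otimes> a \<otimes> j" unfolding x_def using y(1) ac jc by (simp add: m_ac)
    then have xa: "x \<otimes> a = \<zero>" using y jc by simp
    have "annihilator R {a \<oplus> x} \<subseteq> annihilator R {a}"
    proof
      fix z assume "z \<in> annihilator R {a \<oplus> x}"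
      then have z: "z \<in> carrier R" "z \<otimes> (a \<oplus> x) = \<zero>" by (auto simp: annihilator_def)
      have "(z \<otimes> a) \<otimes> (z \<otimes> a) = (z \<otimes> a) \<otimes> (z \<otimes> (a \<oplus> x)) \<ominus> (z \<otimes> z) \<otimes> (x \<otimes> a)"
        using z(1) ac x(2) by (simp add: ring_arith)
      also have "\<dots> = \<zero>" unfolding z(2) xa using z(1) ac by simp
      finally have "z \<otimes> a = \<zero>" using square_zero[of "z \<otimes> a"] z(1) ac by simp
      then show "z \<in> annihilator R {a}" using z(1) by (simp add: annihilator_def)
    qed
    then have "M \<subseteq> ?AA (a \<oplus> x)" unfolding M by (auto simp: annihilator_def)
    moreover have "a \<oplus> x \<in> J" using ideal_add_closed[OF J a x(1)] .
    ultimately have eq: "?AA (a \<oplus> x) = M" using max by blast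
    have "a \<oplus> x \<in> ?AA (a \<oplus> x)" using ac x(2) by (auto simp: annihilator_def m_comm)
    moreover have "x \<in> annihilator R {a}" using x(2) xa by (simp add: annihilator_def)
    ultimately have "(a \<oplus> x) \<otimes> x = \<zero>" unfolding eq M by (simp add: annihilator_def)
    moreover have "(a \<oplus> x) \<otimes> x = x \<otimes> x \<oplus> x \<otimes> a"
      using ac x(2) by (simp add: ring_arith)
    ultimately have "x \<otimes> x = \<zero>" using xa x(2) by simp
    then show "y \<otimes> j = \<zero>" using square_zero[OF x(2)] by (simp add: x_def)
  qed
  then show ?thesis using a by blast
qed

text \<open>Take \<open>b\<close> in the annihilator of \<open>a\<close> such that whatever kills
  \<open>b\<close> kills that whole annihilator. If \<open>y\<close> kills \<open>a + b\<close>,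
  then \<open>a b = 0\<close> and reducedness give \<open>y a = 0\<close>, hence
  \<open>y b = 0\<close>. So \<open>y\<close> lies in the annihilator of \<open>a\<close> and kills
  it, and \<open>y y = 0\<close>.\<close>

lemma regular_complement:
  assumes a: "a \<in> carrier R"
  obtains b where "b \<in> carrier R" "a \<otimes> b = \<zero>" "a \<oplus> b \<in> nonzerodivisors R"
proof -
  have J: "ideal (annihilator R {a}) R" using annihilator_ideal a by simp
  obtain b where b: "b \<in> annihilator R {a}"
    and bmin: "\<And>y j. y \<in> carrier R \<Longrightarrow> y \<otimes> b = \<zero> \<Longrightarrow> j \<in> annihilator R {a} \<Longrightarrow> y \<otimes> j = \<zero>"
    using ideal_element_with_same_annihilator[OF J] by blast
  have bc: "b \<in> carrier R" "b \<otimes> a = \<zero>" using b by (auto simp: annihilator_def)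
  have "y = \<zero>" if y: "y \<in> carrier R" "y \<otimes> (a \<oplus> b) = \<zero>" for y
  proof -
    have "(y \<otimes> a) \<otimes> (y \<otimes> a) = (y \<otimes> a) \<otimes> (y \<otimes> (a \<oplus> b)) \<ominus> (y \<otimes> y) \<otimes> (b \<otimes> a)"
      using y(1) a bc(1) by (simp add: ring_arith)
    also have "\<dots> = \<zero>" unfolding y(2) bc(2) using y(1) a by simp
    finally have ya: "y \<otimes> a = \<zero>" using square_zero[of "y \<otimes> a"] y(1) a by simp
    then have "y \<otimes> b = \<zero>" using y a bc(1) by (simp add: r_distr)
    then have "y \<otimes> y = \<zero>" using bmin[of y y] y ya by (simp add: annihilator_def)
    then show "y = \<zero>" by (rule square_zero[OF y(1)])
  qed
  then have "a \<oplus> b \<in> nonzerodivisors R" using a bc by (auto simp: nonzerodivisors_def)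
  moreover have "a \<otimes> b = \<zero>" using bc a m_comm by simp
  ultimately show thesis using that bc(1) by blast
qed

text \<open>Let \<open>a\<close> in \<open>P\<close> be killed only by what kills all of
  \<open>P\<close>. If \<open>a\<close> is a zero divisor, some \<open>z \<noteq> 0\<close> kills
  \<open>P\<close>; it is outside \<open>P\<close> because the ring is reduced, and primality puts
  everything killing \<open>z\<close> into \<open>P\<close>.\<close>

lemma prime_is_annihilator_or_regular:
  assumes P: "primeideal P R"
  shows "(\<exists>x \<in> P. x \<in> nonzerodivisors R) \<or> (\<exists>z \<in> carrier R. P = annihilator R {z})"
proof -
  have PI: "ideal P R" using P by (rule primeideal.axioms)
  obtain a where a: "a \<in> P"
    and amin: "\<And>y j. y \<in> carrier R \<Longrightarrow> y \<otimes> a = \<zero> \<Longrightarrow> j \<in> P \<Longrightarrow> y \<otimes> j = \<zero>"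
    using ideal_element_with_same_annihilator[OF PI] by blast
  have ac: "a \<in> carrier R" using ideal_carrier[OF PI a] .
  show ?thesis
  proof (cases "a \<in> nonzerodivisors R")
    case False
    then obtain z where z: "z \<in> carrier R" "z \<otimes> a = \<zero>" "z \<noteq> \<zero>"
      using ac by (auto simp: nonzerodivisors_def)
    have zP: "z \<notin> P" using amin[OF z(1,2), of z] z square_zero[OF z(1)] by auto
    have "y \<in> P" if "y \<in> carrier R" "y \<otimes> z = \<zero>" for y
      using primeideal.I_prime[OF P that(1) z(1)] ideal_zero[OF PI] that zP by auto
    moreover have "y \<otimes> z = \<zero>" if "y \<in> P" for y
      using amin[OF z(1,2) that] m_comm[OF z(1) ideal_carrier[OF PI that]] by simp
    ultimately have "P = annihilator R {z}"
      using ideal_carrier[OF PI] by (auto simp: annihilator_def)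
    then show ?thesis using z(1) by blast
  qed (use a in blast)
qed

end

section \<open>Ideal sums, primes and descending chains\<close>

context cring
begin

lemma ideal_add_principal:
  assumes I: "ideal I R" and x: "x \<in> carrier R"
  shows "ideal {w \<oplus> x \<otimes> r | w r. w \<in> I \<and> r \<in> carrier R} R" (is "ideal ?J R")
    and "I \<subseteq> {w \<oplus> x \<otimes> r | w r. w \<in> I \<and> r \<in> carrier R}"
    and "x \<in> {w \<oplus> x \<otimes> r | w r. w \<in> I \<and> r \<in> carrier R}"
proof -
  note Ic = ideal_carrier[OF I]
  show "ideal ?J R"
  proof (rule ideal_criterion)
    show "?J \<subseteq> carrier R" using Ic x by auto
    show "\<zero> \<in> ?J" using ideal_zero[OF I] x by (auto intro!: exI[of _ \<zero>])
  next
    fix u v assume "u \<in> ?J" "v \<in> ?J"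
    then obtain w r w' r' where u: "u = w \<oplus> x \<otimes> r" "w \<in> I" "r \<in> carrier R"
      and v: "v = w' \<oplus> x \<otimes> r'" "w' \<in> I" "r' \<in> carrier R" by auto
    have "u \<oplus> v = (w \<oplus> w') \<oplus> x \<otimes> (r \<oplus> r')"
      using u(1,3) v(1,3) Ic[OF u(2)] Ic[OF v(2)] x by (simp add: r_distr a_ac)
    then show "u \<oplus> v \<in> ?J" using ideal_add_closed[OF I u(2) v(2)] u(3) v(3) by auto
  next
    fix s u assume s: "s \<in> carrier R" and "u \<in> ?J"
    then obtain w r where u: "u = w \<oplus> x \<otimes> r" "w \<in> I" "r \<in> carrier R" by auto
    have "s \<otimes> u = (s \<otimes> w) \<oplus> x \<otimes> (s \<otimes> r)"
      using u(1,3) Ic[OF u(2)] x s by (simp add: r_distr m_ac)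
    then show "s \<otimes> u \<in> ?J" using ideal_mult_closed[OF I s u(2)] u(3) s by auto
  qed
  show "I \<subseteq> ?J"
  proof
    fix w assume w: "w \<in> I"
    then have "w = w \<oplus> x \<otimes> \<zero>" using Ic x by simp
    then show "w \<in> ?J" using w by auto
  qed
  have "x = \<zero> \<oplus> x \<otimes> \<one>" using x by simp
  then show "x \<in> ?J" using ideal_zero[OF I] by blast
qed

lemma ideal_quotient_ideal:
  assumes I: "ideal I R" and x: "x \<in> carrier R"
  shows "ideal {r \<in> carrier R. r \<otimes> x \<in> I} R"
proof (rule ideal_criterion)
  show "\<zero> \<in> {r \<in> carrier R. r \<otimes> x \<in> I}" using ideal_zero[OF I] x by simp
next
  fix u v assume "u \<in> {r \<in> carrier R. r \<otimes> x \<in> I}" "v \<in> {r \<in> carrier R. r \<otimes> x \<in> I}"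
  then show "u \<oplus> v \<in> {r \<in> carrier R. r \<otimes> x \<in> I}"
    using ideal_add_closed[OF I] x by (simp add: l_distr)
next
  fix u v assume "u \<in> carrier R" "v \<in> {r \<in> carrier R. r \<otimes> x \<in> I}"
  then show "u \<otimes> v \<in> {r \<in> carrier R. r \<otimes> x \<in> I}"
    using ideal_mult_closed[OF I] x by (simp add: m_assoc)
qed auto

end

context noetherian_cring
begin

text \<open>An ideal \<open>P\<close> maximal among those disjoint from \<open>S\<close> is prime:
  for \<open>x\<close> and \<open>y\<close> outside \<open>P\<close>, both \<open>P + x R\<close>
  and \<open>P + y R\<close> meet \<open>S\<close>, and if \<open>x y\<close> were in
  \<open>P\<close>, the product of two such elements would lie in \<open>P\<close> and in
  \<open>S\<close>.\<close>

lemma prime_avoiding_multiplicative_set: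
  assumes S: "S \<subseteq> carrier R" "\<one> \<in> S" "\<zero> \<notin> S" "\<And>s t. s \<in> S \<Longrightarrow> t \<in> S \<Longrightarrow> s \<otimes> t \<in> S"
  shows "\<exists>P. primeideal P R \<and> P \<inter> S = {}"
proof -
  let ?F = "{I. ideal I R \<and> I \<inter> S = {}}"
  have "{\<zero>} \<in> ?F" using S(3) zeroideal by auto
  then have "\<exists>P\<in>?F. \<forall>I\<in>?F. P \<subseteq> I \<longrightarrow> I = P"
    by (intro exists_maximal_ideal_in_family) auto
  then obtain P where "P \<in> ?F" and max: "\<forall>I\<in>?F. P \<subseteq> I \<longrightarrow> I = P"
    by (rule bexE)
  then have P: "ideal P R" "P \<inter> S = {}" by auto
  have "x \<in> P \<or> y \<in> P" if x: "x \<in> carrier R" and y: "y \<in> carrier R" and xy: "x \<otimes> y \<in> P" for x y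
  proof (rule ccontr)
    assume neg: "\<not> (x \<in> P \<or> y \<in> P)"
    have meets: "\<exists>w r. w \<in> P \<and> r \<in> carrier R \<and> w \<oplus> z \<otimes> r \<in> S" if z: "z \<in> carrier R" "z \<notin> P" for z
    proof -
      let ?J = "{w \<oplus> z \<otimes> r | w r. w \<in> P \<and> r \<in> carrier R}"
      have "?J \<notin> ?F" using max ideal_add_principal(2,3)[OF P(1) z(1)] z(2) by blast
      then have "?J \<inter> S \<noteq> {}" using ideal_add_principal(1)[OF P(1) z(1)] by simp
      then show ?thesis by blast
    qed
    obtain w r where wr: "w \<in> P" "r \<in> carrier R" "w \<oplus> x \<otimes> r \<in> S" using meets x neg by blast
    obtain w' r' where wr': "w' \<in> P" "r' \<in> carrier R" "w' \<oplus> y \<otimes> r' \<in> S" using meets y neg by blast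
    note c = ideal_carrier[OF P(1) wr(1)] ideal_carrier[OF P(1) wr'(1)] wr(2) wr'(2) x y
    have "(w \<oplus> x \<otimes> r) \<otimes> (w' \<oplus> y \<otimes> r') =
        (w' \<oplus> y \<otimes> r') \<otimes> w \<oplus> ((x \<otimes> r) \<otimes> w' \<oplus> (r \<otimes> r') \<otimes> (x \<otimes> y))"
      using c by (simp add: ring_arith)
    moreover have "\<dots> \<in> P"
      using c by (intro ideal_add_closed[OF P(1)] ideal_mult_closed[OF P(1)] wr(1) wr'(1) xy) auto
    ultimately show False using S(4)[OF wr(3) wr'(3)] P(2) by auto
  qed
  moreover have "carrier R \<noteq> P" using S(1,2) P(2) by auto
  ultimately have "primeideal P R"
    using P(1) by (intro primeidealI) (auto intro: cring_axioms)
  then show ?thesis using P(2) by blast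
qed

text \<open>The Artinian condition on \<open>R/J\<close>, phrased with ideals of \<open>R\<close> so
  that no quotient ring has to be formed.\<close>

definition dcc_above :: "'a set \<Rightarrow> bool" where
  "dcc_above J \<longleftrightarrow> (\<forall>I :: nat \<Rightarrow> 'a set. (\<forall>n. ideal (I n) R \<and> J \<subseteq> I n \<and> I (Suc n) \<subseteq> I n) \<longrightarrow>
     (\<exists>N. \<forall>n\<ge>N. I n = I N))"

text \<open>Modular law: a descending chain above \<open>J\<close> is determined by its sum with \<open>x R\<close> and by its
  quotient by \<open>x\<close>.\<close>

lemma dcc_above_extension:
  assumes J: "ideal J R" and x: "x \<in> carrier R"
    and d1: "dcc_above {w \<oplus> x \<otimes> r | w r. w \<in> J \<and> r \<in> carrier R}"
    and d2: "dcc_above {r \<in> carrier R. r \<otimes> x \<in> J}"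
  shows "dcc_above J"
  unfolding dcc_above_def
proof (intro allI impI)
  fix I :: "nat \<Rightarrow> 'a set" assume I: "\<forall>n. ideal (I n) R \<and> J \<subseteq> I n \<and> I (Suc n) \<subseteq> I n"
  then have idI: "ideal (I n) R" and JI: "J \<subseteq> I n" and decr: "I (Suc n) \<subseteq> I n" for n by auto
  let ?A = "\<lambda>n. {w \<oplus> x \<otimes> r | w r. w \<in> I n \<and> r \<in> carrier R}"
  let ?B = "\<lambda>n. {r \<in> carrier R. r \<otimes> x \<in> I n}"
  have "ideal (?A n) R \<and> {w \<oplus> x \<otimes> r | w r. w \<in> J \<and> r \<in> carrier R} \<subseteq> ?A n \<and> ?A (Suc n) \<subseteq> ?A n" for n
    using ideal_add_principal(1)[OF idI x] JI[of n] decr[of n] by blast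
  then obtain N1 where N1: "\<And>n. n \<ge> N1 \<Longrightarrow> ?A n = ?A N1"
    using d1[unfolded dcc_above_def, rule_format, of ?A] by blast
  have "ideal (?B n) R \<and> {r \<in> carrier R. r \<otimes> x \<in> J} \<subseteq> ?B n \<and> ?B (Suc n) \<subseteq> ?B n" for n
    using ideal_quotient_ideal[OF idI x] JI[of n] decr[of n] by blast
  then obtain N2 where N2: "\<And>n. n \<ge> N2 \<Longrightarrow> ?B n = ?B N2"
    using d2[unfolded dcc_above_def, rule_format, of ?B] by blast
  let ?N = "max N1 N2"
  have "I n = I ?N" if n: "n \<ge> ?N" for n
  proof
    show sub: "I n \<subseteq> I ?N" using decr n by (rule lift_Suc_antimono_le)
    show "I ?N \<subseteq> I n"
    proof
      fix z assume z: "z \<in> I ?N"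
      then have "z \<in> ?A ?N" using ideal_add_principal(2)[OF idI x] by blast
      then have "z \<in> ?A n" using N1[of n] N1[of ?N] n by auto
      then obtain w r where wr: "z = w \<oplus> x \<otimes> r" "w \<in> I n" "r \<in> carrier R" by auto
      have c: "w \<in> carrier R" "z \<in> carrier R" using ideal_carrier[OF idI] wr(2) z by auto
      have "r \<otimes> x = z \<ominus> w" unfolding wr(1) using c x wr(3) by (simp add: ring_arith)
      also have "\<dots> \<in> I ?N" using ideal_minus_closed[OF idI z] wr(2) sub by blast
      finally have "r \<in> ?B ?N" using wr(3) by simp
      then have "r \<in> ?B n" using N2[of n] N2[of ?N] n by auto
      then have "x \<otimes> r \<in> I n" using m_comm[OF x wr(3)] by simp
      then show "z \<in> I n" using ideal_add_closed[OF idI wr(2)] wr(1) by simp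
    qed
  qed
  then show "\<exists>N. \<forall>n\<ge>N. I n = I N" by blast
qed

text \<open>Noetherian induction: let \<open>P\<close> be maximal among the ideals containing
  \<open>b\<close> that violate the condition. If \<open>x y\<close> is in \<open>P\<close> with
  neither factor in \<open>P\<close>, then \<open>P + x R\<close> and \<open>(P : x)\<close> are
  strictly larger and satisfy the condition, so \<open>P\<close> does by
  \<open>dcc_above_extension\<close>. Hence \<open>P\<close> is prime, thus maximal, and chains
  above a maximal ideal have only two possible terms.\<close>

lemma dcc_above_if_primes_maximal:
  assumes J: "ideal J R" and b: "b \<in> J"
    and primes: "\<And>P. primeideal P R \<Longrightarrow> b \<in> P \<Longrightarrow> maximalideal P R"
  shows "dcc_above J"
proof (rule ccontr)
  assume "\<not> dcc_above J"
  let ?F = "{J. ideal J R \<and> b \<in> J \<and> \<not> dcc_above J}"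
  have "J \<in> ?F" using J b \<open>\<not> dcc_above J\<close> by simp
  then have "\<exists>P\<in>?F. \<forall>I\<in>?F. P \<subseteq> I \<longrightarrow> I = P"
    by (intro exists_maximal_ideal_in_family) auto
  then obtain P where "P \<in> ?F" and max: "\<forall>I\<in>?F. P \<subseteq> I \<longrightarrow> I = P"
    by (rule bexE)
  then have P: "ideal P R" "b \<in> P" "\<not> dcc_above P" by auto
  have larger: "dcc_above I" if "ideal I R" "P \<subseteq> I" "I \<noteq> P" for I
    using max that P(2) by blast
  have "dcc_above (carrier R)"
    unfolding dcc_above_def using ideal_carrier by blast
  then have "carrier R \<noteq> P" using P(3) by auto
  moreover have "x \<in> P \<or> y \<in> P" if x: "x \<in> carrier R" and y: "y \<in> carrier R" and xy: "x \<otimes> y \<in> P" for x y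
  proof (rule ccontr)
    assume neg: "\<not> (x \<in> P \<or> y \<in> P)"
    have "dcc_above {w \<oplus> x \<otimes> r | w r. w \<in> P \<and> r \<in> carrier R}"
      by (rule larger) (use ideal_add_principal[OF P(1) x] neg in blast)+
    moreover have "dcc_above {r \<in> carrier R. r \<otimes> x \<in> P}"
    proof (rule larger)
      show "ideal {r \<in> carrier R. r \<otimes> x \<in> P} R" by (rule ideal_quotient_ideal[OF P(1) x])
      show "P \<subseteq> {r \<in> carrier R. r \<otimes> x \<in> P}"
        using ideal.I_r_closed[OF P(1)] x ideal_carrier[OF P(1)] by blast
      have "y \<in> {r \<in> carrier R. r \<otimes> x \<in> P}" using m_comm[OF x y] xy y by simp
      then show "{r \<in> carrier R. r \<otimes> x \<in> P} \<noteq> P" using neg by blast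
    qed
    ultimately show False using dcc_above_extension[OF P(1) x] P(3) by blast
  qed
  ultimately have "primeideal P R"
    using P(1) by (intro primeidealI) (auto intro: cring_axioms)
  then have "maximalideal P R" using primes P(2) by blast
  then have PI: "I = P \<or> I = carrier R" if "ideal I R" "P \<subseteq> I" for I
    using maximalideal.I_maximal[OF _ that] ideal_carrier[OF that(1)] by blast
  have "dcc_above P"
    unfolding dcc_above_def
  proof (intro allI impI)
    fix I :: "nat \<Rightarrow> 'a set" assume I: "\<forall>n. ideal (I n) R \<and> P \<subseteq> I n \<and> I (Suc n) \<subseteq> I n"
    then have cases: "I n = P \<or> I n = carrier R" for n using PI by blast
    have "I (Suc n) \<subseteq> I n" for n using I by auto
    then have decr: "I n \<subseteq> I m" if "m \<le> n" for m n
      using that by (rule lift_Suc_antimono_le)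
    have sup: "P \<subseteq> I n" for n using I by auto
    show "\<exists>N. \<forall>n\<ge>N. I n = I N"
    proof (cases "\<exists>N. I N = P")
      case True
      then obtain N where "I N = P" by blast
      then have "I n = I N" if "n \<ge> N" for n using decr[OF that] sup[of n] by auto
      then show ?thesis by blast
    next
      case False
      then have "I n = carrier R" for n using cases by blast
      then show ?thesis by simp
    qed
  qed
  then show False using P(3) by blast
qed

end

section \<open>Local rings of dimension at most one\<close>

locale curve_ring = reduced_noetherian_cring R for R (structure) +
  assumes loc: "local_ring R" and dim: "krull_dim R \<le> 1"
begin

abbreviation M0 :: "'a set" where "M0 \<equiv> max_ideal R"

lemma M0_maximal: "maximalideal M0 R"
  using loc unfolding local_ring_def max_ideal_def by (metis theI')

lemma M0_unique: "maximalideal I R \<Longrightarrow> I = M0"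
  using loc M0_maximal unfolding local_ring_def by blast

lemma M0_ideal: "ideal M0 R"
  using M0_maximal by (rule maximalideal.axioms)

lemma one_notin_M0: "\<one> \<notin> M0"
  using maximalideal.I_notcarr[OF M0_maximal] ideal.one_imp_carrier[OF M0_ideal] by auto

lemma proper_ideal_subset_M0:
  assumes I: "ideal I R" and "\<one> \<notin> I" shows "I \<subseteq> M0"
proof -
  let ?F = "{J. ideal J R \<and> I \<subseteq> J \<and> \<one> \<notin> J}"
  have "I \<in> ?F" using assms by simp
  then have "\<exists>P\<in>?F. \<forall>I\<in>?F. P \<subseteq> I \<longrightarrow> I = P"
    by (intro exists_maximal_ideal_in_family) auto
  then obtain P where "P \<in> ?F" and max: "\<forall>I\<in>?F. P \<subseteq> I \<longrightarrow> I = P"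
    by (rule bexE)
  then have P: "ideal P R" "I \<subseteq> P" "\<one> \<notin> P" by auto
  have "maximalideal P R"
  proof (rule maximalidealI[OF P(1)])
    show "carrier R \<noteq> P" using P(3) one_closed by blast
    fix J assume J: "ideal J R" "P \<subseteq> J" "J \<subseteq> carrier R"
    then show "J = P \<or> J = carrier R"
      using max P(2) ideal.one_imp_carrier[OF J(1)] by blast
  qed
  then show ?thesis using M0_unique P(2) by blast
qed

lemma nonunit_in_M0:
  assumes a: "a \<in> carrier R" "a \<notin> Units R" shows "a \<in> M0"
proof -
  have "\<one> \<notin> PIdl a"
  proof
    assume "\<one> \<in> PIdl a"
    then obtain r where r: "r \<in> carrier R" "\<one> = r \<otimes> a" by (auto simp: cgenideal_def)
    then have "a \<in> Units R" using a(1) m_comm[OF r(1) a(1)] by (auto simp: Units_def)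
    then show False using a(2) by blast
  qed
  then have "PIdl a \<subseteq> M0" using proper_ideal_subset_M0 cgenideal_ideal[OF a(1)] by blast
  then show ?thesis using cgenideal_self[OF a(1)] by blast
qed

lemma one_minus_nonunit_multiple:
  assumes "b \<in> carrier R" "b \<notin> Units R" "c \<in> carrier R"
  shows "\<one> \<ominus> b \<otimes> c \<in> Units R"
proof (rule ccontr)
  assume "\<one> \<ominus> b \<otimes> c \<notin> Units R"
  then have 1: "\<one> \<ominus> b \<otimes> c \<in> M0" using nonunit_in_M0 assms by simp
  have 2: "b \<otimes> c \<in> M0"
    using ideal.I_r_closed[OF M0_ideal nonunit_in_M0[OF assms(1,2)] assms(3)] .
  have "\<one> = (\<one> \<ominus> b \<otimes> c) \<oplus> b \<otimes> c" using assms by (simp add: ring_arith)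
  then show False using ideal_add_closed[OF M0_ideal 1 2] one_notin_M0 by simp
qed

text \<open>A regular \<open>b\<close> lies in no minimal prime: the products \<open>b^n s\<close>
  with \<open>s\<close> outside \<open>P\<close> form a multiplicative set without zero, and a prime
  \<open>P0\<close> avoiding it is contained in \<open>P\<close> and misses \<open>b\<close>. If
  \<open>P\<close> were not the maximal ideal, \<open>P0\<close>, \<open>P\<close>,
  \<open>M0\<close> would be a chain of length two.\<close>

lemma prime_with_regular_is_M0:
  assumes P: "primeideal P R" and b: "b \<in> P" "b \<in> nonzerodivisors R"
  shows "P = M0"
proof (rule ccontr)
  assume neq: "P \<noteq> M0"
  have PI: "ideal P R" using P by (rule primeideal.axioms)
  have "\<one> \<notin> P" using primeideal.I_notcarr[OF P] ideal.one_imp_carrier[OF PI] by auto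
  then have PM: "P \<subset> M0" using proper_ideal_subset_M0[OF PI] neq by blast
  note bc = nonzerodivisor_closed[OF b(2)]
  let ?S = "{b [^] (n::nat) \<otimes> s | n s. s \<in> carrier R - P}"
  have "\<exists>P0. primeideal P0 R \<and> P0 \<inter> ?S = {}"
  proof (rule prime_avoiding_multiplicative_set)
    show "?S \<subseteq> carrier R" using bc by auto
    have "\<one> = b [^] (0::nat) \<otimes> \<one>" by simp
    then show "\<one> \<in> ?S" using \<open>\<one> \<notin> P\<close> by blast
    show "\<zero> \<notin> ?S"
    proof
      assume "\<zero> \<in> ?S"
      then obtain n s where s: "s \<in> carrier R" "s \<notin> P" "\<zero> = b [^] (n::nat) \<otimes> s" by auto
      then have "s \<otimes> b [^] n = \<zero>" using m_comm[OF s(1), of "b [^] n"] bc by simp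
      then have "s = \<zero>" by (rule nonzerodivisorD[OF nonzerodivisor_pow[OF b(2)] s(1)])
      then show False using s(2) ideal_zero[OF PI] by simp
    qed
  next
    fix u v assume "u \<in> ?S" "v \<in> ?S"
    then obtain n s m t where u: "u = b [^] (n::nat) \<otimes> s" "s \<in> carrier R" "s \<notin> P"
      and v: "v = b [^] (m::nat) \<otimes> t" "t \<in> carrier R" "t \<notin> P" by auto
    have "s \<otimes> t \<notin> P" using primeideal.I_prime[OF P u(2) v(2)] u(3) v(3) by blast
    moreover have "u \<otimes> v = b [^] (n + m) \<otimes> (s \<otimes> t)"
      using u(1,2) v(1,2) bc by (simp add: nat_pow_mult[symmetric] m_ac)
    ultimately show "u \<otimes> v \<in> ?S" using u(2) v(2) by blast
  qed
  then obtain P0 where P0: "primeideal P0 R" "P0 \<inter> ?S = {}" by blast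
  have P0I: "ideal P0 R" using P0(1) by (rule primeideal.axioms)
  have "s \<in> ?S" if "s \<in> carrier R" "s \<notin> P" for s
  proof -
    have "s = b [^] (0::nat) \<otimes> s" using that by simp
    then show ?thesis using that by blast
  qed
  then have "P0 \<subseteq> P" using P0(2) ideal_carrier[OF P0I] by blast
  moreover have "b \<notin> P0"
  proof -
    have "b = b [^] (1::nat) \<otimes> \<one>" using bc by simp
    then have "b \<in> ?S" using \<open>\<one> \<notin> P\<close> by blast
    then show ?thesis using P0(2) by blast
  qed
  ultimately have P0P: "P0 \<subset> P" using b(1) by blast
  define p where "p i = (if i = 0 then P0 else if i = 1 then P else M0)" for i :: nat
  have "\<forall>i\<le>2. primeideal (p i) R"
    using P0(1) P maximalideal_prime[OF M0_maximal] by (simp add: p_def)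
  moreover have "\<forall>i<2. p i \<subset> p (Suc i)"
    using P0P PM by (simp add: p_def less_2_cases_iff)
  ultimately have "enat 2 \<in> {enat n | n. \<exists>p :: nat \<Rightarrow> 'a set.
      (\<forall>i\<le>n. primeideal (p i) R) \<and> (\<forall>i<n. p i \<subset> p (Suc i))}" by blast
  then have "enat 2 \<le> krull_dim R" unfolding krull_dim_def by (rule Sup_upper)
  then have "enat 2 \<le> 1" using dim by (rule order_trans)
  then show False by (simp add: one_enat_def)
qed

lemma dcc_above_regular:
  assumes "ideal J R" "b \<in> J" "b \<in> nonzerodivisors R"
  shows "dcc_above J"
  using dcc_above_if_primes_maximal[OF assms(1,2)] prime_with_regular_is_M0[OF _ _ assms(3)]
    M0_maximal by blast

end

section \<open>Total quotient rings\<close>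

context cring
begin

lemma fraction_mem:
  "(b, t) \<in> fraction R a s \<longleftrightarrow> b \<in> carrier R \<and> t \<in> nonzerodivisors R \<and> a \<otimes> t = b \<otimes> s"
  by (simp add: fraction_def)

lemma fraction_eqI:
  assumes a: "a \<in> carrier R" "s \<in> nonzerodivisors R"
    and b: "b \<in> carrier R" "t \<in> nonzerodivisors R" and eq: "a \<otimes> t = b \<otimes> s"
  shows "fraction R a s = fraction R b t"
proof -
  note c = nonzerodivisor_closed[OF a(2)] nonzerodivisor_closed[OF b(2)] a(1) b(1)
  have "a \<otimes> v = u \<otimes> s \<longleftrightarrow> b \<otimes> v = u \<otimes> t" if uv: "u \<in> carrier R" "v \<in> nonzerodivisors R" for u v
  proof
    note v = nonzerodivisor_closed[OF uv(2)]
    assume 1: "a \<otimes> v = u \<otimes> s"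
    have "s \<otimes> (b \<otimes> v) = (b \<otimes> s) \<otimes> v" using c v by (simp add: m_ac)
    also have "\<dots> = (a \<otimes> v) \<otimes> t" using c v by (simp add: eq[symmetric] m_ac)
    also have "\<dots> = s \<otimes> (u \<otimes> t)" using c uv(1) by (simp add: 1 m_ac)
    finally show "b \<otimes> v = u \<otimes> t" by (rule nonzerodivisor_cancel[OF a(2), rotated 2]) (use c v uv in auto)
  next
    note v = nonzerodivisor_closed[OF uv(2)]
    assume 1: "b \<otimes> v = u \<otimes> t"
    have "t \<otimes> (a \<otimes> v) = (a \<otimes> t) \<otimes> v" using c v by (simp add: m_ac)
    also have "\<dots> = (b \<otimes> v) \<otimes> s" using c v by (simp add: eq m_ac)
    also have "\<dots> = t \<otimes> (u \<otimes> s)" using c uv(1) by (simp add: 1 m_ac)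
    finally show "a \<otimes> v = u \<otimes> s" by (rule nonzerodivisor_cancel[OF b(2), rotated 2]) (use c v uv in auto)
  qed
  then show ?thesis by (auto simp: fraction_def)
qed

lemma fraction_self: "a \<in> carrier R \<Longrightarrow> s \<in> nonzerodivisors R \<Longrightarrow> (a, s) \<in> fraction R a s"
  by (simp add: fraction_mem)

lemma fraction_eq_iff:
  assumes a: "a \<in> carrier R" "s \<in> nonzerodivisors R"
    and b: "b \<in> carrier R" "t \<in> nonzerodivisors R"
  shows "fraction R a s = fraction R b t \<longleftrightarrow> a \<otimes> t = b \<otimes> s"
  using fraction_eqI[OF a b] fraction_self[OF b] fraction_mem[of b t a s] by auto

text \<open>The operations of \<open>total_quotient_ring\<close> are unions over all
  representatives. As the classes are nonempty, a value that does not depend on the representatives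
  survives the union.\<close>

lemma fraction_union:
  assumes a: "a \<in> carrier R" "s \<in> nonzerodivisors R"
    and b: "b \<in> carrier R" "t \<in> nonzerodivisors R"
    and "\<And>a' s' b' t'. (a', s') \<in> fraction R a s \<Longrightarrow> (b', t') \<in> fraction R b t \<Longrightarrow> F a' s' b' t' = C"
  shows "(\<Union>(a', s') \<in> fraction R a s. \<Union>(b', t') \<in> fraction R b t. F a' s' b' t') = C"
proof -
  have ne: "fraction R a s \<noteq> {}" "fraction R b t \<noteq> {}"
    using fraction_self[OF a] fraction_self[OF b] by auto
  have "(\<Union>(b', t') \<in> fraction R b t. F a' s' b' t') = C" if "(a', s') \<in> fraction R a s" for a' s'
    using assms(5)[OF that] by (intro SUP_eq_const[OF ne(2)]) (auto split: prod.splits)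
  then show ?thesis by (intro SUP_eq_const[OF ne(1)]) (simp only: split_paired_all prod.case)
qed

lemma tq_mult:
  assumes a: "a \<in> carrier R" "s \<in> nonzerodivisors R"
    and b: "b \<in> carrier R" "t \<in> nonzerodivisors R"
  shows "fraction R a s \<otimes>\<^bsub>total_quotient_ring R\<^esub> fraction R b t = fraction R (a \<otimes> b) (s \<otimes> t)"
proof -
  note c = a(1) b(1) nonzerodivisor_closed[OF a(2)] nonzerodivisor_closed[OF b(2)]
  have "fraction R (a' \<otimes> b') (s' \<otimes> t') = fraction R (a \<otimes> b) (s \<otimes> t)"
    if 1: "(a', s') \<in> fraction R a s" and 2: "(b', t') \<in> fraction R b t" for a' s' b' t'
  proof -
    note m = 1[unfolded fraction_mem] 2[unfolded fraction_mem]
    then have c': "a' \<in> carrier R" "b' \<in> carrier R" "s' \<in> carrier R" "t' \<in> carrier R"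
      and e: "a' \<otimes> s = a \<otimes> s'" "b' \<otimes> t = b \<otimes> t'" by (auto intro: nonzerodivisor_closed)
    have "(a' \<otimes> b') \<otimes> (s \<otimes> t) = (a' \<otimes> s) \<otimes> (b' \<otimes> t)" using c c' by (simp add: m_ac)
    also have "\<dots> = (a \<otimes> b) \<otimes> (s' \<otimes> t')" unfolding e using c c' by (simp add: m_ac)
    finally show ?thesis using m a b by (intro fraction_eqI nonzerodivisor_mult) auto
  qed
  then show ?thesis by (simp add: total_quotient_ring_def fraction_union[OF a b])
qed

lemma tq_add:
  assumes a: "a \<in> carrier R" "s \<in> nonzerodivisors R"
    and b: "b \<in> carrier R" "t \<in> nonzerodivisors R"
  shows "fraction R a s \<oplus>\<^bsub>total_quotient_ring R\<^esub> fraction R b t =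
    fraction R (a \<otimes> t \<oplus> b \<otimes> s) (s \<otimes> t)"
proof -
  note c = a(1) b(1) nonzerodivisor_closed[OF a(2)] nonzerodivisor_closed[OF b(2)]
  have "fraction R (a' \<otimes> t' \<oplus> b' \<otimes> s') (s' \<otimes> t') = fraction R (a \<otimes> t \<oplus> b \<otimes> s) (s \<otimes> t)"
    if 1: "(a', s') \<in> fraction R a s" and 2: "(b', t') \<in> fraction R b t" for a' s' b' t'
  proof -
    note m = 1[unfolded fraction_mem] 2[unfolded fraction_mem]
    then have c': "a' \<in> carrier R" "b' \<in> carrier R" "s' \<in> carrier R" "t' \<in> carrier R"
      and e: "a' \<otimes> s = a \<otimes> s'" "b' \<otimes> t = b \<otimes> t'" by (auto intro: nonzerodivisor_closed)
    have "(a' \<otimes> t' \<oplus> b' \<otimes> s') \<otimes> (s \<otimes> t) = (a' \<otimes> s) \<otimes> (t \<otimes> t') \<oplus> (b' \<otimes> t) \<otimes> (s \<otimes> s')"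
      using c c' by (simp add: l_distr r_distr m_ac)
    also have "\<dots> = (a \<otimes> t \<oplus> b \<otimes> s) \<otimes> (s' \<otimes> t')" unfolding e using c c' by (simp add: l_distr r_distr m_ac)
    finally show ?thesis using m a b c c' by (intro fraction_eqI nonzerodivisor_mult) auto
  qed
  then show ?thesis by (simp add: total_quotient_ring_def fraction_union[OF a b])
qed

lemma tq_carrier:
  "carrier (total_quotient_ring R) = {fraction R a s | a s. a \<in> carrier R \<and> s \<in> nonzerodivisors R}"
  "\<one>\<^bsub>total_quotient_ring R\<^esub> = fraction R \<one> \<one>"
  "\<zero>\<^bsub>total_quotient_ring R\<^esub> = fraction R \<zero> \<one>"
  by (simp_all add: total_quotient_ring_def)

lemma tq_closed:
  "a \<in> carrier R \<Longrightarrow> s \<in> nonzerodivisors R \<Longrightarrow> fraction R a s \<in> carrier (total_quotient_ring R)"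
  by (auto simp: tq_carrier)

lemma tq_cases:
  assumes "q \<in> carrier (total_quotient_ring R)"
  shows "\<exists>a s. a \<in> carrier R \<and> s \<in> nonzerodivisors R \<and> q = fraction R a s"
  using assms by (auto simp: tq_carrier)

lemma total_quotient_ring_cring: "cring (total_quotient_ring R)" (is "cring ?Q")
proof (rule cringI)
  note nzd = nonzerodivisor_mult nonzerodivisor_one nonzerodivisor_closed
  show "abelian_group ?Q"
  proof (rule abelian_groupI)
    fix x y assume "x \<in> carrier ?Q" "y \<in> carrier ?Q"
    then obtain a s b t where
      x: "a \<in> carrier R" "s \<in> nonzerodivisors R" "x = fraction R a s" and
      y: "b \<in> carrier R" "t \<in> nonzerodivisors R" "y = fraction R b t"
      using tq_cases by metis
    note c = x(1) y(1) nonzerodivisor_closed[OF x(2)] nonzerodivisor_closed[OF y(2)]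
    show "x \<oplus>\<^bsub>?Q\<^esub> y \<in> carrier ?Q"
      using x(2) y(2) c by (simp add: x(3) y(3) tq_add tq_closed nonzerodivisor_mult)
    show "x \<oplus>\<^bsub>?Q\<^esub> y = y \<oplus>\<^bsub>?Q\<^esub> x"
      using x(2) y(2) c by (simp add: x(3) y(3) tq_add a_comm m_comm)
  next
    show "\<zero>\<^bsub>?Q\<^esub> \<in> carrier ?Q" by (simp add: tq_carrier(3) tq_closed nonzerodivisor_one)
  next
    fix x y z assume "x \<in> carrier ?Q" "y \<in> carrier ?Q" "z \<in> carrier ?Q"
    then obtain a s b t d u where
      x: "a \<in> carrier R" "s \<in> nonzerodivisors R" "x = fraction R a s" and
      y: "b \<in> carrier R" "t \<in> nonzerodivisors R" "y = fraction R b t" and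
      z: "d \<in> carrier R" "u \<in> nonzerodivisors R" "z = fraction R d u"
      using tq_cases by metis
    note c = x(1) y(1) z(1) nonzerodivisor_closed[OF x(2)] nonzerodivisor_closed[OF y(2)]
      nonzerodivisor_closed[OF z(2)]
    show "(x \<oplus>\<^bsub>?Q\<^esub> y) \<oplus>\<^bsub>?Q\<^esub> z = x \<oplus>\<^bsub>?Q\<^esub> (y \<oplus>\<^bsub>?Q\<^esub> z)"
      using x(2) y(2) z(2) c
      by (simp add: x(3) y(3) z(3) tq_add nonzerodivisor_mult l_distr r_distr m_ac a_ac)
  next
    fix x assume "x \<in> carrier ?Q"
    then obtain a s where x: "a \<in> carrier R" "s \<in> nonzerodivisors R" "x = fraction R a s"
      using tq_cases by metis
    note c = x(1) nonzerodivisor_closed[OF x(2)]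
    show "\<zero>\<^bsub>?Q\<^esub> \<oplus>\<^bsub>?Q\<^esub> x = x"
      using x(2) c by (simp add: x(3) tq_carrier(3) tq_add nonzerodivisor_one)
    have "fraction R (\<ominus> a) s \<oplus>\<^bsub>?Q\<^esub> x = fraction R (\<ominus> a \<otimes> s \<oplus> a \<otimes> s) (s \<otimes> s)"
      using x(2) c by (simp add: x(3) tq_add)
    also have "\<ominus> a \<otimes> s \<oplus> a \<otimes> s = \<zero>" using c by (simp add: l_minus l_neg)
    also have "fraction R \<zero> (s \<otimes> s) = \<zero>\<^bsub>?Q\<^esub>"
      unfolding tq_carrier using x(2) c by (intro fraction_eqI nonzerodivisor_mult) (auto simp: nonzerodivisor_one)
    finally show "\<exists>y\<in>carrier ?Q. y \<oplus>\<^bsub>?Q\<^esub> x = \<zero>\<^bsub>?Q\<^esub>"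
      using tq_closed[of "\<ominus> a" s] x(2) c by blast
  qed
  show "Group.comm_monoid ?Q"
  proof (rule Group.comm_monoidI)
    fix x y assume "x \<in> carrier ?Q" "y \<in> carrier ?Q"
    then obtain a s b t where
      x: "a \<in> carrier R" "s \<in> nonzerodivisors R" "x = fraction R a s" and
      y: "b \<in> carrier R" "t \<in> nonzerodivisors R" "y = fraction R b t"
      using tq_cases by metis
    note c = x(1) y(1) nonzerodivisor_closed[OF x(2)] nonzerodivisor_closed[OF y(2)]
    show "x \<otimes>\<^bsub>?Q\<^esub> y \<in> carrier ?Q"
      using x(2) y(2) c by (simp add: x(3) y(3) tq_mult tq_closed nonzerodivisor_mult)
    show "x \<otimes>\<^bsub>?Q\<^esub> y = y \<otimes>\<^bsub>?Q\<^esub> x"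
      using x(2) y(2) c by (simp add: x(3) y(3) tq_mult m_comm)
  next
    show "\<one>\<^bsub>?Q\<^esub> \<in> carrier ?Q" by (simp add: tq_carrier(2) tq_closed nonzerodivisor_one)
  next
    fix x y z assume "x \<in> carrier ?Q" "y \<in> carrier ?Q" "z \<in> carrier ?Q"
    then obtain a s b t d u where
      x: "a \<in> carrier R" "s \<in> nonzerodivisors R" "x = fraction R a s" and
      y: "b \<in> carrier R" "t \<in> nonzerodivisors R" "y = fraction R b t" and
      z: "d \<in> carrier R" "u \<in> nonzerodivisors R" "z = fraction R d u"
      using tq_cases by metis
    note c = x(1) y(1) z(1) nonzerodivisor_closed[OF x(2)] nonzerodivisor_closed[OF y(2)]
      nonzerodivisor_closed[OF z(2)]
    show "(x \<otimes>\<^bsub>?Q\<^esub> y) \<otimes>\<^bsub>?Q\<^esub> z = x \<otimes>\<^bsub>?Q\<^esub> (y \<otimes>\<^bsub>?Q\<^esub> z)"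
      using x(2) y(2) z(2) c
      by (simp add: x(3) y(3) z(3) tq_mult nonzerodivisor_mult m_ac)
  next
    fix x assume "x \<in> carrier ?Q"
    then obtain a s where x: "a \<in> carrier R" "s \<in> nonzerodivisors R" "x = fraction R a s"
      using tq_cases by metis
    note c = x(1) nonzerodivisor_closed[OF x(2)]
    show "\<one>\<^bsub>?Q\<^esub> \<otimes>\<^bsub>?Q\<^esub> x = x"
      using x(2) c by (simp add: x(3) tq_carrier(2) tq_mult nonzerodivisor_one)
  qed
  fix x y z assume "x \<in> carrier ?Q" "y \<in> carrier ?Q" "z \<in> carrier ?Q"
  then obtain a s b t d u where
    x: "a \<in> carrier R" "s \<in> nonzerodivisors R" "x = fraction R a s" and
    y: "b \<in> carrier R" "t \<in> nonzerodivisors R" "y = fraction R b t" and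
    z: "d \<in> carrier R" "u \<in> nonzerodivisors R" "z = fraction R d u"
    using tq_cases by metis
  note c = x(1) y(1) z(1) nonzerodivisor_closed[OF x(2)] nonzerodivisor_closed[OF y(2)]
    nonzerodivisor_closed[OF z(2)]
  have "(x \<oplus>\<^bsub>?Q\<^esub> y) \<otimes>\<^bsub>?Q\<^esub> z = fraction R ((a \<otimes> t \<oplus> b \<otimes> s) \<otimes> d) ((s \<otimes> t) \<otimes> u)"
    using x(2) y(2) z(2) c by (simp add: x(3) y(3) z(3) tq_mult tq_add nonzerodivisor_mult)
  also have "\<dots> = fraction R ((a \<otimes> d) \<otimes> (t \<otimes> u) \<oplus> (b \<otimes> d) \<otimes> (s \<otimes> u)) ((s \<otimes> u) \<otimes> (t \<otimes> u))"
    using x(2) y(2) z(2) c by (intro fraction_eqI nonzerodivisor_mult) (auto simp: l_distr r_distr m_ac)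
  also have "\<dots> = x \<otimes>\<^bsub>?Q\<^esub> z \<oplus>\<^bsub>?Q\<^esub> y \<otimes>\<^bsub>?Q\<^esub> z"
    using x(2) y(2) z(2) c by (simp add: x(3) y(3) z(3) tq_mult tq_add nonzerodivisor_mult)
  finally show "(x \<oplus>\<^bsub>?Q\<^esub> y) \<otimes>\<^bsub>?Q\<^esub> z = x \<otimes>\<^bsub>?Q\<^esub> z \<oplus>\<^bsub>?Q\<^esub> y \<otimes>\<^bsub>?Q\<^esub> z" .
qed

end

text \<open>The total quotient ring through its characteristic properties, so that the later
  arguments never meet classes of pairs.\<close>

locale total_quotient = Q?: cring Q + R: cring R
  for Q :: "('q, 'n) ring_scheme" (structure) and R :: "('a, 'm) ring_scheme" (structure) +
  fixes \<iota> :: "'a \<Rightarrow> 'q"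
  assumes \<iota>_hom: "\<iota> \<in> ring_hom R Q"
    and \<iota>_inj: "inj_on \<iota> (carrier R)"
    and \<iota>_unit: "\<And>s. s \<in> nonzerodivisors R \<Longrightarrow> \<iota> s \<in> Units Q"
    and fraction_form: "\<And>q. q \<in> carrier Q \<Longrightarrow>
      \<exists>a\<in>carrier R. \<exists>s\<in>nonzerodivisors R. q \<otimes> \<iota> s = \<iota> a"

lemma (in cring) total_quotient_ring_total_quotient:
  "total_quotient (total_quotient_ring R) R (tq_embed R)"
proof -
  let ?Q = "total_quotient_ring R"
  interpret Q: cring ?Q by (rule total_quotient_ring_cring)
  have inverse: "fraction R s \<one> \<otimes>\<^bsub>?Q\<^esub> fraction R \<one> s = \<one>\<^bsub>?Q\<^esub>" if s: "s \<in> nonzerodivisors R" for s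
  proof -
    note sc = nonzerodivisor_closed[OF s]
    have "fraction R s s = fraction R \<one> \<one>"
      using s sc by (intro fraction_eqI) (auto simp: nonzerodivisor_one)
    then show ?thesis using s sc by (simp add: tq_mult nonzerodivisor_one tq_carrier(2))
  qed
  show ?thesis
  proof (unfold_locales)
    show "tq_embed R \<in> ring_hom R ?Q"
      by (rule ring_hom_memI)
        (auto simp: tq_embed_def tq_closed nonzerodivisor_one tq_mult tq_add tq_carrier(2))
    show "inj_on (tq_embed R) (carrier R)"
      by (rule inj_onI) (simp add: tq_embed_def fraction_eq_iff nonzerodivisor_one)
    show "tq_embed R s \<in> Units ?Q" if s: "s \<in> nonzerodivisors R" for s
    proof -
      have "fraction R s \<one> \<in> carrier ?Q" "fraction R \<one> s \<in> carrier ?Q"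
        using s nonzerodivisor_closed[OF s] by (auto intro: tq_closed simp: nonzerodivisor_one)
      then show ?thesis
        using inverse[OF s] Q.m_comm by (force simp: Units_def tq_embed_def)
    qed
    show "\<exists>a\<in>carrier R. \<exists>s\<in>nonzerodivisors R. q \<otimes>\<^bsub>?Q\<^esub> tq_embed R s = tq_embed R a"
      if q: "q \<in> carrier ?Q" for q
    proof -
      obtain a s where a: "a \<in> carrier R" "s \<in> nonzerodivisors R" "q = fraction R a s"
        using tq_cases[OF q] by blast
      have "fraction R (a \<otimes> s) s = fraction R a \<one>"
        using a(1,2) nonzerodivisor_closed[OF a(2)]
        by (intro fraction_eqI) (auto simp: nonzerodivisor_one)
      then have "q \<otimes>\<^bsub>?Q\<^esub> tq_embed R s = tq_embed R a"
        using a nonzerodivisor_closed[OF a(2)]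
        by (simp add: tq_embed_def tq_mult nonzerodivisor_one)
      then show ?thesis using a(1,2) by blast
    qed
  qed
qed

section \<open>Integral elements\<close>

context total_quotient
begin

sublocale \<iota>: ring_hom_cring R Q \<iota>
  using \<iota>_hom by unfold_locales

abbreviation A :: "'q set" where "A \<equiv> \<iota> ` carrier R"

lemma \<iota>_eq_iff: "a \<in> carrier R \<Longrightarrow> b \<in> carrier R \<Longrightarrow> \<iota> a = \<iota> b \<longleftrightarrow> a = b"
  using \<iota>_inj by (auto simp: inj_on_def)

lemma unit_cancel:
  assumes "u \<in> Units Q" "x \<in> carrier Q" "y \<in> carrier Q" "u \<otimes> x = u \<otimes> y" shows "x = y"
  using Q.Units_l_cancel[OF assms(1-3)] assms(4) by simp

text \<open>The \<open>R\<close>-submodules of \<open>Q\<close>, where \<open>R\<close> acts through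
  \<open>\<iota>\<close>. Negation is multiplication by the image of \<open>-1\<close> and is
  recovered in \<open>asub_uminus\<close>.\<close>

definition asub :: "'q set \<Rightarrow> bool" where
  "asub T \<longleftrightarrow> T \<subseteq> carrier Q \<and> \<zero> \<in> T \<and> (\<forall>x\<in>T. \<forall>y\<in>T. x \<oplus> y \<in> T) \<and>
     (\<forall>r\<in>carrier R. \<forall>x\<in>T. \<iota> r \<otimes> x \<in> T)"

lemma asubD:
  assumes "asub T"
  shows "x \<in> T \<Longrightarrow> x \<in> carrier Q" "\<zero> \<in> T" "x \<in> T \<Longrightarrow> y \<in> T \<Longrightarrow> x \<oplus> y \<in> T"
    "r \<in> carrier R \<Longrightarrow> x \<in> T \<Longrightarrow> \<iota> r \<otimes> x \<in> T"
  using assms by (auto simp: asub_def)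

lemma asub_uminus:
  assumes "asub T" "x \<in> T" shows "\<ominus> x \<in> T"
proof -
  have "\<iota> (\<ominus>\<^bsub>R\<^esub> \<one>\<^bsub>R\<^esub>) \<otimes> x \<in> T" using assms by (intro asubD(4)) auto
  then show ?thesis using asubD(1)[OF assms] by (simp add: Q.l_minus)
qed

lemma asub_minus:
  assumes "asub T" "x \<in> T" "y \<in> T" shows "x \<ominus> y \<in> T"
  unfolding a_minus_def using asubD(3)[OF assms(1,2) asub_uminus[OF assms(1,3)]] .

lemma asub_A: "asub A"
  unfolding asub_def
proof (intro conjI ballI)
  show "\<zero> \<in> A" using \<iota>.hom_zero by (metis R.zero_closed imageI)
  show "x \<oplus> y \<in> A" if "x \<in> A" "y \<in> A" for x y
    using that by (auto simp flip: \<iota>.hom_add)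
  show "\<iota> r \<otimes> x \<in> A" if "r \<in> carrier R" "x \<in> A" for r x
    using that by (auto simp flip: \<iota>.hom_mult)
qed auto

lemma asub_preimage_ideal:
  assumes "asub T" shows "ideal {r \<in> carrier R. \<iota> r \<in> T} R"
  by (rule R.ideal_criterion) (use asubD[OF assms] in auto)

lemma asub_scale:
  assumes "asub T" "q \<in> carrier Q" shows "asub ((\<lambda>x. q \<otimes> x) ` T)"
proof -
  note D = asubD[OF assms(1)]
  show ?thesis
    unfolding asub_def
  proof (intro conjI ballI)
    show "(\<lambda>x. q \<otimes> x) ` T \<subseteq> carrier Q" using D(1) assms(2) by auto
    have "\<zero> = q \<otimes> \<zero>" using assms(2) by simp
    then show "\<zero> \<in> (\<lambda>x. q \<otimes> x) ` T" using D(2) by blast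
  next
    fix x y assume "x \<in> (\<lambda>x. q \<otimes> x) ` T" "y \<in> (\<lambda>x. q \<otimes> x) ` T"
    then obtain x' y' where "x = q \<otimes> x'" "y = q \<otimes> y'" "x' \<in> T" "y' \<in> T" by blast
    moreover from this have "x \<oplus> y = q \<otimes> (x' \<oplus> y')" using D(1) assms(2) by (simp add: Q.r_distr)
    ultimately show "x \<oplus> y \<in> (\<lambda>x. q \<otimes> x) ` T" using D(3) by blast
  next
    fix r x assume r: "r \<in> carrier R" and "x \<in> (\<lambda>x. q \<otimes> x) ` T"
    then obtain x' where "x = q \<otimes> x'" "x' \<in> T" by blast
    moreover from this have "\<iota> r \<otimes> x = q \<otimes> (\<iota> r \<otimes> x')"
      using D(1) assms(2) r by (simp add: Q.m_lcomm)
    ultimately show "\<iota> r \<otimes> x \<in> (\<lambda>x. q \<otimes> x) ` T" using D(4) r by blast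
  qed
qed

text \<open>\<open>hor t c n k\<close> is the value at \<open>t\<close> of the polynomial with the \<open>n\<close> coefficients
  \<open>c k, ..., c (k + n - 1)\<close>, in Horner form.\<close>

primrec hor :: "'q \<Rightarrow> (nat \<Rightarrow> 'a) \<Rightarrow> nat \<Rightarrow> nat \<Rightarrow> 'q" where
  "hor t c 0 k = \<zero>"
| "hor t c (Suc n) k = \<iota> (c k) \<oplus> t \<otimes> hor t c n (Suc k)"

lemma hor_closed [simp]:
  "t \<in> carrier Q \<Longrightarrow> \<forall>i. c i \<in> carrier R \<Longrightarrow> hor t c n k \<in> carrier Q"
  by (induction n arbitrary: k) auto

text \<open>The recursion splits off the constant coefficient; comparing \<open>pspan t n\<close>
  with \<open>pspan t (Suc n)\<close> requires the leading one.\<close>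

lemma hor_top:
  assumes t: "t \<in> carrier Q" and c: "\<forall>i. c i \<in> carrier R"
  shows "hor t c (Suc n) k = hor t c n k \<oplus> \<iota> (c (k + n)) \<otimes> t [^] n"
proof (induction n arbitrary: k)
  case 0
  then show ?case using assms by (simp add: Q.a_comm)
next
  case (Suc n)
  note h = hor_closed[OF t c, of n "Suc k"]
  have "hor t c (Suc (Suc n)) k = \<iota> (c k) \<oplus> t \<otimes> (hor t c n (Suc k) \<oplus> \<iota> (c (Suc k + n)) \<otimes> t [^] n)"
    using Suc[of "Suc k"] by (simp only: hor.simps(2)[of t c "Suc n" k])
  also have "\<dots> = hor t c (Suc n) k \<oplus> \<iota> (c (k + Suc n)) \<otimes> t [^] Suc n"
    using t c h by (simp add: Q.r_distr Q.m_ac Q.a_ac)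
  finally show ?case .
qed

lemma hor_cong:
  assumes "\<And>i. k \<le> i \<Longrightarrow> i < k + n \<Longrightarrow> c i = c' i"
  shows "hor t c n k = hor t c' n k"
  using assms by (induction n arbitrary: k) auto

lemma hor_extend:
  assumes t: "t \<in> carrier Q" and c: "\<forall>i. c i \<in> carrier R" and "m \<le> n"
  shows "hor t c m 0 = hor t (\<lambda>i. if i < m then c i else \<zero>\<^bsub>R\<^esub>) n 0"
  using \<open>m \<le> n\<close>
proof (induction n rule: dec_induct)
  case base
  show ?case by (rule hor_cong) simp
next
  case (step n)
  have "hor t (\<lambda>i. if i < m then c i else \<zero>\<^bsub>R\<^esub>) (Suc n) 0 = hor t (\<lambda>i. if i < m then c i else \<zero>\<^bsub>R\<^esub>) n 0"
    using step(1) t c by (subst hor_top) auto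
  then show ?case using step(3) by simp
qed

lemma hor_add:
  assumes t: "t \<in> carrier Q" and c: "\<forall>i. c i \<in> carrier R" "\<forall>i. c' i \<in> carrier R"
  shows "hor t c n k \<oplus> hor t c' n k = hor t (\<lambda>i. c i \<oplus>\<^bsub>R\<^esub> c' i) n k"
proof (induction n arbitrary: k)
  case (Suc n)
  note h = hor_closed[OF t c(1), of n "Suc k"] hor_closed[OF t c(2), of n "Suc k"]
  have "hor t c (Suc n) k \<oplus> hor t c' (Suc n) k =
      (\<iota> (c k) \<oplus> \<iota> (c' k)) \<oplus> t \<otimes> (hor t c n (Suc k) \<oplus> hor t c' n (Suc k))"
    using h t c by (simp add: Q.r_distr Q.a_ac)
  then show ?case using Suc[of "Suc k"] c by simp
qed auto

lemma hor_smult: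
  assumes t: "t \<in> carrier Q" and c: "\<forall>i. c i \<in> carrier R" and r: "r \<in> carrier R"
  shows "\<iota> r \<otimes> hor t c n k = hor t (\<lambda>i. r \<otimes>\<^bsub>R\<^esub> c i) n k"
proof (induction n arbitrary: k)
  case (Suc n)
  note h = hor_closed[OF t c, of n "Suc k"]
  have "\<iota> r \<otimes> hor t c (Suc n) k = \<iota> r \<otimes> \<iota> (c k) \<oplus> t \<otimes> (\<iota> r \<otimes> hor t c n (Suc k))"
    using h t c r by (simp add: Q.r_distr Q.m_ac)
  then show ?case using Suc[of "Suc k"] c r by simp
qed (use r in auto)

lemma hor_finsum:
  assumes t: "t \<in> carrier Q" and c: "\<forall>i. c i \<in> carrier R"
  shows "(\<Oplus>i\<in>{..<n}. \<iota> (c i) \<otimes> t [^] i) = hor t c n 0"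
proof (induction n)
  case (Suc n)
  have "(\<Oplus>i\<in>{..<Suc n}. \<iota> (c i) \<otimes> t [^] i) = \<iota> (c n) \<otimes> t [^] n \<oplus> (\<Oplus>i\<in>{..<n}. \<iota> (c i) \<otimes> t [^] i)"
    unfolding lessThan_Suc using t c by (intro Q.finsum_insert) auto
  also have "\<dots> = hor t c (Suc n) 0"
    unfolding Suc using hor_top[OF t c, of n 0] t c by (simp add: Q.a_comm)
  finally show ?case .
qed simp

text \<open>The \<open>R\<close>-span of the \<open>n\<close> powers
  \<open>1, t, ..., t^(n-1)\<close>. With this count, \<open>t^n\<close> in \<open>pspan t n\<close>
  says that \<open>t\<close> is a root of a monic polynomial of degree \<open>n\<close>.\<close>

definition pspan :: "'q \<Rightarrow> nat \<Rightarrow> 'q set" where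
  "pspan t n = {hor t c n 0 | c. \<forall>i. c i \<in> carrier R}"

lemma pspan_asub:
  assumes t: "t \<in> carrier Q" shows "asub (pspan t n)"
  unfolding asub_def
proof (intro conjI ballI)
  show "pspan t n \<subseteq> carrier Q" using t by (auto simp: pspan_def)
  have "hor t (\<lambda>i. \<zero>\<^bsub>R\<^esub>) n k = \<zero>" for k using t by (induction n arbitrary: k) auto
  then have "\<zero> = hor t (\<lambda>i. \<zero>\<^bsub>R\<^esub>) n 0" by simp
  then show "\<zero> \<in> pspan t n" unfolding pspan_def by blast
next
  fix x y assume "x \<in> pspan t n" "y \<in> pspan t n"
  then obtain c c' where c: "\<forall>i. c i \<in> carrier R" "\<forall>i. c' i \<in> carrier R"
    and xy: "x = hor t c n 0" "y = hor t c' n 0" by (auto simp: pspan_def)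
  have "x \<oplus> y = hor t (\<lambda>i. c i \<oplus>\<^bsub>R\<^esub> c' i) n 0" unfolding xy by (rule hor_add[OF t c])
  then show "x \<oplus> y \<in> pspan t n"
    unfolding pspan_def using c by (intro CollectI exI[of _ "\<lambda>i. c i \<oplus>\<^bsub>R\<^esub> c' i"]) auto
next
  fix r x assume r: "r \<in> carrier R" and "x \<in> pspan t n"
  then obtain c where c: "\<forall>i. c i \<in> carrier R" and x: "x = hor t c n 0" by (auto simp: pspan_def)
  have "\<iota> r \<otimes> x = hor t (\<lambda>i. r \<otimes>\<^bsub>R\<^esub> c i) n 0" unfolding x by (rule hor_smult[OF t c r])
  then show "\<iota> r \<otimes> x \<in> pspan t n"
    unfolding pspan_def using c r by (intro CollectI exI[of _ "\<lambda>i. r \<otimes>\<^bsub>R\<^esub> c i"]) auto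
qed

lemma pspan_mono:
  assumes t: "t \<in> carrier Q" and "m \<le> n" shows "pspan t m \<subseteq> pspan t n"
proof
  fix x assume "x \<in> pspan t m"
  then obtain c where c: "\<forall>i. c i \<in> carrier R" and x: "x = hor t c m 0" by (auto simp: pspan_def)
  let ?c = "\<lambda>i. if i < m then c i else \<zero>\<^bsub>R\<^esub>"
  have "x = hor t ?c n 0" unfolding x by (rule hor_extend[OF t c \<open>m \<le> n\<close>])
  then show "x \<in> pspan t n" unfolding pspan_def using c by (intro CollectI exI[of _ ?c]) auto
qed

lemma pspan_Suc:
  assumes t: "t \<in> carrier Q" and x: "x \<in> pspan t (Suc n)"
  shows "\<exists>y\<in>pspan t n. \<exists>r\<in>carrier R. x = y \<oplus> \<iota> r \<otimes> t [^] n"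
proof -
  obtain c where c: "\<forall>i. c i \<in> carrier R" and "x = hor t c (Suc n) 0"
    using x by (auto simp: pspan_def)
  then have "x = hor t c n 0 \<oplus> \<iota> (c n) \<otimes> t [^] n" using hor_top[OF t c, of n 0] by simp
  then show ?thesis using c unfolding pspan_def by blast
qed

lemma pspan_mult:
  assumes t: "t \<in> carrier Q" and x: "x \<in> pspan t n"
  shows "t \<otimes> x \<in> pspan t (Suc n)"
proof -
  obtain c where c: "\<forall>i. c i \<in> carrier R" and x: "x = hor t c n 0"
    using x by (auto simp: pspan_def)
  let ?c = "\<lambda>i. case i of 0 \<Rightarrow> \<zero>\<^bsub>R\<^esub> | Suc j \<Rightarrow> c j"
  have "hor t ?c m (Suc k) = hor t c m k" for m k
    by (induction m arbitrary: k) auto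
  then have "t \<otimes> x = hor t ?c (Suc n) 0" using t c x by simp
  then show ?thesis
    unfolding pspan_def using c by (intro CollectI exI[of _ ?c]) (auto split: nat.splits)
qed

lemma pspan_mult_pow:
  assumes t: "t \<in> carrier Q" and x: "x \<in> pspan t n"
  shows "x \<otimes> t [^] j \<in> pspan t (n + j)"
proof (induction j)
  case 0
  then show ?case using x asubD(1)[OF pspan_asub[OF t] x] by simp
next
  case (Suc j)
  have "x \<otimes> t [^] Suc j = t \<otimes> (x \<otimes> t [^] j)"
    using t asubD(1)[OF pspan_asub[OF t] x] by (simp add: Q.m_ac)
  then show ?case using pspan_mult[OF t Suc] by simp
qed

lemma pow_mem_pspan:
  assumes t: "t \<in> carrier Q" and "i < n" shows "t [^] i \<in> pspan t n"
proof -
  let ?c = "\<lambda>j::nat. \<one>\<^bsub>R\<^esub>"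
  have "\<one> = hor t ?c 1 0" using t by simp
  then have "\<one> \<in> pspan t 1" unfolding pspan_def by (intro CollectI exI[of _ ?c]) auto
  from pspan_mult_pow[OF t this, of i] have "t [^] i \<in> pspan t (1 + i)" using t by simp
  then show ?thesis using pspan_mono[OF t, of "1 + i" n] \<open>i < n\<close> by auto
qed

lemma pspan_least:
  assumes t: "t \<in> carrier Q" and T: "asub T" and "\<And>i. i < n \<Longrightarrow> t [^] i \<in> T"
  shows "pspan t n \<subseteq> T"
  using assms(3)
proof (induction n)
  case 0
  then show ?case using asubD(2)[OF T] by (auto simp: pspan_def)
next
  case (Suc n)
  show ?case
  proof
    fix x assume "x \<in> pspan t (Suc n)"
    then obtain y r where "y \<in> pspan t n" "r \<in> carrier R" "x = y \<oplus> \<iota> r \<otimes> t [^] n"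
      using pspan_Suc[OF t] by blast
    then show "x \<in> T" using Suc asubD(3,4)[OF T] by auto
  qed
qed

lemma asub_colon:
  assumes T: "asub T" and q: "q \<in> carrier Q"
  shows "asub {x \<in> carrier Q. q \<otimes> x \<in> T}"
  unfolding asub_def
proof (intro conjI ballI CollectI)
  fix x y assume "x \<in> {x \<in> carrier Q. q \<otimes> x \<in> T}" "y \<in> {x \<in> carrier Q. q \<otimes> x \<in> T}"
  then show "q \<otimes> (x \<oplus> y) \<in> T" using asubD(3)[OF T] q by (simp add: Q.r_distr)
next
  fix r x assume r: "r \<in> carrier R" and x: "x \<in> {x \<in> carrier Q. q \<otimes> x \<in> T}"
  have "q \<otimes> (\<iota> r \<otimes> x) = \<iota> r \<otimes> (q \<otimes> x)" using q r x by (simp add: Q.m_lcomm)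
  then show "q \<otimes> (\<iota> r \<otimes> x) \<in> T" using asubD(4)[OF T r] x by simp
qed (use asubD(2)[OF T] q in auto)

text \<open>With \<open>t = a / b\<close>, each generator satisfies
  \<open>b^n t^i = b^(n-i) a^i\<close> for \<open>i < n\<close>.\<close>

lemma pspan_bounded_pow:
  assumes t: "t \<in> carrier Q" and b: "b \<in> carrier R" and a: "a \<in> carrier R" and tb: "t \<otimes> \<iota> b = \<iota> a"
    and x: "x \<in> pspan t n"
  shows "\<iota> (b [^]\<^bsub>R\<^esub> n) \<otimes> x \<in> A"
proof -
  let ?T = "{x \<in> carrier Q. \<iota> (b [^]\<^bsub>R\<^esub> n) \<otimes> x \<in> A}"
  have "pspan t n \<subseteq> ?T"
  proof (rule pspan_least[OF t asub_colon[OF asub_A]])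
    fix i assume i: "i < n"
    have "\<iota> (b [^]\<^bsub>R\<^esub> n) \<otimes> t [^] i = \<iota> b [^] (n - i) \<otimes> (t \<otimes> \<iota> b) [^] i"
    proof -
      have "\<iota> (b [^]\<^bsub>R\<^esub> n) = \<iota> b [^] (n - i) \<otimes> \<iota> b [^] i"
        using i b by (simp add: Q.nat_pow_mult)
      then show ?thesis using t b by (simp add: Q.nat_pow_distrib Q.m_ac)
    qed
    also have "\<dots> = \<iota> (b [^]\<^bsub>R\<^esub> (n - i) \<otimes>\<^bsub>R\<^esub> a [^]\<^bsub>R\<^esub> i)" unfolding tb using a b by simp
    finally have "\<iota> (b [^]\<^bsub>R\<^esub> n) \<otimes> t [^] i \<in> A" using a b by (metis R.m_closed R.nat_pow_closed imageI)
    then show "t [^] i \<in> ?T" using t by simp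
  qed (use b in simp)
  then show ?thesis using x by blast
qed

lemma pspan_bounded:
  assumes t: "t \<in> carrier Q"
  shows "\<exists>d\<in>Units Q. \<forall>x\<in>pspan t n. d \<otimes> x \<in> A"
proof -
  obtain a s where a: "a \<in> carrier R" and s: "s \<in> nonzerodivisors R" and ts: "t \<otimes> \<iota> s = \<iota> a"
    using fraction_form[OF t] by blast
  have "\<iota> (s [^]\<^bsub>R\<^esub> n) \<otimes> x \<in> A" if "x \<in> pspan t n" for x
    by (rule pspan_bounded_pow[OF t R.nonzerodivisor_closed[OF s] a ts that])
  then show ?thesis using \<iota>_unit[OF R.nonzerodivisor_pow[OF s]] by blast
qed

text \<open>For a Noetherian ring this is the normalization. In this form it is visibly closed under
  sums and products: if \<open>p\<close> stabilises \<open>T\<close> and \<open>q\<close> stabilises \<open>T'\<close>, both stabilise the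
  colon \<open>(T' : T)\<close>.\<close>

definition Rbar :: "'q set" where
  "Rbar = {q \<in> carrier Q. \<exists>T u d. asub T \<and> u \<in> T \<and> u \<in> Units Q \<and> d \<in> Units Q \<and>
     (\<forall>x\<in>T. d \<otimes> x \<in> A) \<and> (\<forall>x\<in>T. q \<otimes> x \<in> T)}"

lemma Rbar_carrier: "q \<in> Rbar \<Longrightarrow> q \<in> carrier Q"
  by (simp add: Rbar_def)

lemma RbarI:
  assumes "q \<in> carrier Q" "asub T" "u \<in> T" "u \<in> Units Q" "d \<in> Units Q"
    "\<And>x. x \<in> T \<Longrightarrow> d \<otimes> x \<in> A" "\<And>x. x \<in> T \<Longrightarrow> q \<otimes> x \<in> T"
  shows "q \<in> Rbar"
  using assms unfolding Rbar_def by blast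

lemma Rbar_common:
  assumes p: "p \<in> Rbar" and q: "q \<in> Rbar"
  shows "\<exists>T u d. asub T \<and> u \<in> T \<and> u \<in> Units Q \<and> d \<in> Units Q \<and>
     (\<forall>x\<in>T. d \<otimes> x \<in> A) \<and> (\<forall>x\<in>T. p \<otimes> x \<in> T) \<and> (\<forall>x\<in>T. q \<otimes> x \<in> T)"
proof -
  have pc: "p \<in> carrier Q" and qc: "q \<in> carrier Q" using p q by (auto simp: Rbar_carrier)
  obtain T u d where T: "asub T" "u \<in> T" "u \<in> Units Q" "d \<in> Units Q"
    "\<And>x. x \<in> T \<Longrightarrow> d \<otimes> x \<in> A" "\<And>x. x \<in> T \<Longrightarrow> p \<otimes> x \<in> T" using p unfolding Rbar_def by blast
  obtain T' u' d' where T': "asub T'" "u' \<in> T'" "u' \<in> Units Q" "d' \<in> Units Q"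
    "\<And>x. x \<in> T' \<Longrightarrow> d' \<otimes> x \<in> A" "\<And>x. x \<in> T' \<Longrightarrow> q \<otimes> x \<in> T'" using q unfolding Rbar_def by blast
  \<comment> \<open>The colon \<open>(T' : T)\<close>. It contains the unit \<open>u' d\<close>,
    because \<open>d T\<close> lies in \<open>R\<close> and \<open>u'\<close> in \<open>T'\<close>;
    and \<open>d' u\<close> carries it into \<open>R\<close>, because \<open>C u\<close> lies in
    \<open>T'\<close>.\<close>
  define C where "C = {x \<in> carrier Q. \<forall>y\<in>T. x \<otimes> y \<in> T'}"
  note c = asubD(1)[OF T(1)] asubD(1)[OF T'(1)] Q.Units_closed
  have "asub C"
    unfolding asub_def C_def
  proof (intro conjI ballI CollectI)
    fix x y z assume x: "x \<in> {x \<in> carrier Q. \<forall>y\<in>T. x \<otimes> y \<in> T'}" and y: "y \<in> {x \<in> carrier Q. \<forall>y\<in>T. x \<otimes> y \<in> T'}"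
      and z: "z \<in> T"
    have "(x \<oplus> y) \<otimes> z = x \<otimes> z \<oplus> y \<otimes> z" using x y c(1)[OF z] by (simp add: Q.l_distr)
    then show "(x \<oplus> y) \<otimes> z \<in> T'" using asubD(3)[OF T'(1)] x y z by simp
  next
    fix r x z assume r: "r \<in> carrier R" and x: "x \<in> {x \<in> carrier Q. \<forall>y\<in>T. x \<otimes> y \<in> T'}" and z: "z \<in> T"
    have "\<iota> r \<otimes> x \<otimes> z = \<iota> r \<otimes> (x \<otimes> z)" using x r c(1)[OF z] by (simp add: Q.m_assoc)
    then show "\<iota> r \<otimes> x \<otimes> z \<in> T'" using asubD(4)[OF T'(1) r] x z by simp
  qed (use asubD(2)[OF T'(1)] c in auto)
  moreover have "u' \<otimes> d \<in> C"
    unfolding C_def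
  proof (intro CollectI conjI ballI)
    fix y assume y: "y \<in> T"
    then obtain a where a: "a \<in> carrier R" "d \<otimes> y = \<iota> a" using T(5) by blast
    have "u' \<otimes> d \<otimes> y = u' \<otimes> (d \<otimes> y)" using c(1)[OF y] T(4) T'(3) by (simp add: Q.m_assoc c(3))
    then have "u' \<otimes> d \<otimes> y = \<iota> a \<otimes> u'" using a T'(3) by (simp add: Q.m_comm c(3))
    then show "u' \<otimes> d \<otimes> y \<in> T'" using asubD(4)[OF T'(1) a(1) T'(2)] by simp
  qed (use T T' c in auto)
  moreover have "u' \<otimes> d \<in> Units Q" "d' \<otimes> u \<in> Units Q" using T T' by auto
  moreover have "d' \<otimes> u \<otimes> x \<in> A" if "x \<in> C" for x
  proof -
    have "d' \<otimes> u \<otimes> x = d' \<otimes> (x \<otimes> u)" using that T T' by (simp add: C_def c Q.m_ac)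
    then show ?thesis using T'(5)[of "x \<otimes> u"] that T(2) by (simp add: C_def)
  qed
  moreover have "p \<otimes> x \<in> C" if x: "x \<in> C" for x
  proof -
    have "p \<otimes> x \<otimes> y \<in> T'" if y: "y \<in> T" for y
    proof -
      have "p \<otimes> x \<otimes> y = x \<otimes> (p \<otimes> y)" using x y pc by (simp add: C_def c Q.m_ac)
      then show ?thesis using T(6)[OF y] x by (simp add: C_def)
    qed
    then show ?thesis using x pc by (simp add: C_def)
  qed
  moreover have "q \<otimes> x \<in> C" if x: "x \<in> C" for x
  proof -
    have "q \<otimes> x \<otimes> y \<in> T'" if y: "y \<in> T" for y
    proof -
      have "q \<otimes> x \<otimes> y = q \<otimes> (x \<otimes> y)" using x y qc by (simp add: C_def c Q.m_ac)
      then show ?thesis using T'(6)[of "x \<otimes> y"] x y by (simp add: C_def)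
    qed
    then show ?thesis using x qc by (simp add: C_def)
  qed
  ultimately show ?thesis
    by (intro exI[of _ C] exI[of _ "u' \<otimes> d"] exI[of _ "d' \<otimes> u"] conjI ballI)
qed

lemma Rbar_add: assumes "p \<in> Rbar" "q \<in> Rbar" shows "p \<oplus> q \<in> Rbar"
proof -
  obtain T u d where T: "asub T" "u \<in> T" "u \<in> Units Q" "d \<in> Units Q" "\<And>x. x \<in> T \<Longrightarrow> d \<otimes> x \<in> A"
    "\<And>x. x \<in> T \<Longrightarrow> p \<otimes> x \<in> T" "\<And>x. x \<in> T \<Longrightarrow> q \<otimes> x \<in> T" using Rbar_common[OF assms] by blast
  show ?thesis
  proof (rule RbarI[OF _ T(1-5)])
    show "(p \<oplus> q) \<otimes> x \<in> T" if "x \<in> T" for x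
      using asubD(1,3)[OF T(1)] T(6,7) that assms by (simp add: Q.l_distr Rbar_carrier)
  qed (use assms Rbar_carrier in auto)
qed

lemma Rbar_mult: assumes "p \<in> Rbar" "q \<in> Rbar" shows "p \<otimes> q \<in> Rbar"
proof -
  obtain T u d where T: "asub T" "u \<in> T" "u \<in> Units Q" "d \<in> Units Q" "\<And>x. x \<in> T \<Longrightarrow> d \<otimes> x \<in> A"
    "\<And>x. x \<in> T \<Longrightarrow> p \<otimes> x \<in> T" "\<And>x. x \<in> T \<Longrightarrow> q \<otimes> x \<in> T" using Rbar_common[OF assms] by blast
  show ?thesis
  proof (rule RbarI[OF _ T(1-5)])
    show "(p \<otimes> q) \<otimes> x \<in> T" if "x \<in> T" for x
      using asubD(1)[OF T(1)] T(6,7) that assms by (simp add: Q.m_assoc Rbar_carrier)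
  qed (use assms Rbar_carrier in auto)
qed

lemma A_subset_Rbar: "r \<in> carrier R \<Longrightarrow> \<iota> r \<in> Rbar"
proof (rule RbarI[OF _ asub_A, where u = \<one> and d = \<one>])
  have "\<one> = \<iota> \<one>\<^bsub>R\<^esub>" by simp
  then show "\<one> \<in> A" by blast
qed (use asubD(4)[OF asub_A] in auto)

lemma Rbar_zero: "\<zero> \<in> Rbar"
  using A_subset_Rbar[OF R.zero_closed] by simp

lemma Rbar_one: "\<one> \<in> Rbar"
  using A_subset_Rbar[OF R.one_closed] by simp

lemma Rbar_uminus: assumes "q \<in> Rbar" shows "\<ominus> q \<in> Rbar"
  using Rbar_mult[OF A_subset_Rbar[of "\<ominus>\<^bsub>R\<^esub> \<one>\<^bsub>R\<^esub>"] assms] Rbar_carrier[OF assms]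
  by (simp add: Q.l_minus)

lemma Rbar_minus: assumes "p \<in> Rbar" "q \<in> Rbar" shows "p \<ominus> q \<in> Rbar"
  unfolding a_minus_def using Rbar_add[OF assms(1) Rbar_uminus[OF assms(2)]] .

lemma Rbar_finsum:
  assumes "finite I" "\<And>i. i \<in> I \<Longrightarrow> f i \<in> Rbar" shows "(\<Oplus>i\<in>I. f i) \<in> Rbar"
  using assms
proof (induction I rule: finite_induct)
  case (insert i I)
  have "(\<Oplus>j\<in>insert i I. f j) = f i \<oplus> (\<Oplus>j\<in>I. f j)"
    using insert by (intro Q.finsum_insert) (auto simp: Rbar_carrier)
  then show ?case using insert Rbar_add by simp
qed (simp add: Rbar_zero)

text \<open>The witness is the span of \<open>1, ..., q^(n-1)\<close>: it contains the unit
  \<open>1\<close>, has a common denominator, and is stable under \<open>q\<close> because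
  \<open>q^n\<close> falls back into it.\<close>

lemma integral_in_Rbar:
  assumes q: "q \<in> carrier Q" and mon: "q [^] n \<in> pspan q n"
  shows "q \<in> Rbar"
proof (cases n)
  \<comment> \<open>Integrality admits degree zero. The span is then zero but contains
    \<open>q^0\<close>, so \<open>Q\<close> is the zero ring.\<close>
  case 0
  then have "\<one> = \<zero>" using mon by (auto simp: pspan_def)
  then have "q = \<zero>" using q Q.r_one Q.r_null by metis
  then show ?thesis using Rbar_zero by simp
next
  case (Suc m)
  obtain d where d: "d \<in> Units Q" "\<And>x. x \<in> pspan q n \<Longrightarrow> d \<otimes> x \<in> A"
    using pspan_bounded[OF q] by blast
  show ?thesis
  proof (rule RbarI[OF q pspan_asub[OF q] _ _ d])
    show "\<one> \<in> pspan q n" using pow_mem_pspan[OF q, of 0 n] Suc by simp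
    fix x assume "x \<in> pspan q n"
    then have "q \<otimes> x \<in> pspan q (Suc n)" by (rule pspan_mult[OF q])
    then obtain y r where "y \<in> pspan q n" "r \<in> carrier R" "q \<otimes> x = y \<oplus> \<iota> r \<otimes> q [^] n"
      using pspan_Suc[OF q] by blast
    then show "q \<otimes> x \<in> pspan q n"
      using asubD(3,4)[OF pspan_asub[OF q]] mon by simp
  qed auto
qed

text \<open>Multiplication by the unit \<open>w = d u\<close> embeds \<open>R[q]\<close> into
  \<open>R\<close>: the elements \<open>q^n u\<close> stay in \<open>T\<close>, and \<open>d\<close>
  carries \<open>T\<close> into \<open>R\<close>. The spans of powers of \<open>q\<close> thus
  become an ascending chain of ideals, and where it stabilises \<open>q^N\<close> is a combination
  of lower powers. This replaces the determinant trick.\<close>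

lemma Rbar_integral:
  assumes noeth: "noetherian_cring R" and q: "q \<in> Rbar"
  shows "\<exists>n. q [^] (n::nat) \<in> pspan q n"
proof -
  interpret N: noetherian_cring R by fact
  have qc: "q \<in> carrier Q" using q by (rule Rbar_carrier)
  obtain T u d where T: "asub T" "u \<in> T" "u \<in> Units Q" "d \<in> Units Q"
    "\<And>x. x \<in> T \<Longrightarrow> d \<otimes> x \<in> A" "\<And>x. x \<in> T \<Longrightarrow> q \<otimes> x \<in> T" using q unfolding Rbar_def by blast
  define w where "w = d \<otimes> u"
  have w: "w \<in> Units Q" using T by (simp add: w_def)
  define I where "I n = {r \<in> carrier R. \<iota> r \<in> (\<lambda>x. w \<otimes> x) ` pspan q n}" for n
  have "\<exists>N. \<forall>n\<ge>N. I n = I N"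
  proof (rule N.ascending_ideals_stabilise)
    show "ideal (I n) R" for n
      unfolding I_def using w by (intro asub_preimage_ideal asub_scale pspan_asub qc) auto
    show "I n \<subseteq> I (Suc n)" for n
      unfolding I_def using pspan_mono[OF qc, of n "Suc n"] by auto
  qed
  then obtain N where N: "I (Suc N) = I N" by (metis le_SucI order_refl)
  have "q [^] n \<otimes> u \<in> T" for n :: nat
  proof (induction n)
    case 0
    then show ?case using T(2) asubD(1)[OF T(1)] by simp
  next
    case (Suc n)
    have "q [^] Suc n \<otimes> u = q \<otimes> (q [^] n \<otimes> u)" using qc T(3) by (simp add: Q.m_ac Q.Units_closed)
    then show ?case using T(6)[OF Suc] by simp
  qed
  then have "d \<otimes> (q [^] N \<otimes> u) \<in> A" using T(5) by blast
  moreover have "d \<otimes> (q [^] N \<otimes> u) = w \<otimes> q [^] N"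
    unfolding w_def using T(3,4) qc by (simp add: Q.m_ac Q.Units_closed)
  ultimately obtain r where r: "r \<in> carrier R" "\<iota> r = w \<otimes> q [^] N" by auto
  then have "r \<in> I (Suc N)"
    unfolding I_def using pow_mem_pspan[OF qc, of N "Suc N"] by auto
  then have "r \<in> I N" using N by simp
  then obtain y where y: "y \<in> pspan q N" "w \<otimes> q [^] N = w \<otimes> y" unfolding I_def r(2)[symmetric] by auto
  then have "q [^] N = y"
    using unit_cancel[OF w _ _ y(2)] qc asubD(1)[OF pspan_asub[OF qc]] by simp
  then show ?thesis using y(1) by blast
qed

end

section \<open>Comparison with the definitions of normalization and conductor\<close>

lemma (in noetherian_cring) normalization_eq:
  "normalization R = total_quotient.Rbar (total_quotient_ring R) R (tq_embed R)"
proof -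
  let ?Q = "total_quotient_ring R"
  interpret T: total_quotient ?Q R "tq_embed R" by (rule total_quotient_ring_total_quotient)
  have key: "(\<exists>c \<in> {..<n} \<rightarrow> carrier R.
        q [^]\<^bsub>?Q\<^esub> n \<oplus>\<^bsub>?Q\<^esub> (\<Oplus>\<^bsub>?Q\<^esub>i\<in>{..<n}. tq_embed R (c i) \<otimes>\<^bsub>?Q\<^esub> q [^]\<^bsub>?Q\<^esub> i) = \<zero>\<^bsub>?Q\<^esub>)
      \<longleftrightarrow> q [^]\<^bsub>?Q\<^esub> n \<in> T.pspan q n" (is "?L \<longleftrightarrow> ?R") if q: "q \<in> carrier ?Q" for q and n :: nat
  proof
    assume ?L
    then obtain c where c: "c \<in> {..<n} \<rightarrow> carrier R" and
      eq: "q [^]\<^bsub>?Q\<^esub> n \<oplus>\<^bsub>?Q\<^esub> (\<Oplus>\<^bsub>?Q\<^esub>i\<in>{..<n}. tq_embed R (c i) \<otimes>\<^bsub>?Q\<^esub> q [^]\<^bsub>?Q\<^esub> i) = \<zero>\<^bsub>?Q\<^esub>" by blast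
    \<comment> \<open>\<open>pspan\<close> asks for coefficients in \<open>R\<close> at every index,
      whereas \<open>c\<close> is controlled only below \<open>n\<close>.\<close>
    let ?c = "\<lambda>i. if i < n then c i else \<zero>"
    have c': "\<forall>i. ?c i \<in> carrier R" using c by auto
    have "(\<Oplus>\<^bsub>?Q\<^esub>i\<in>{..<n}. tq_embed R (c i) \<otimes>\<^bsub>?Q\<^esub> q [^]\<^bsub>?Q\<^esub> i) =
        (\<Oplus>\<^bsub>?Q\<^esub>i\<in>{..<n}. tq_embed R (?c i) \<otimes>\<^bsub>?Q\<^esub> q [^]\<^bsub>?Q\<^esub> i)"
      using c q by (intro T.Q.finsum_cong') (auto simp: Pi_iff)
    also have "\<dots> = T.hor q ?c n 0" by (rule T.hor_finsum[OF q c'])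
    finally have "q [^]\<^bsub>?Q\<^esub> n \<oplus>\<^bsub>?Q\<^esub> T.hor q ?c n 0 = \<zero>\<^bsub>?Q\<^esub>" using eq by simp
    then have "q [^]\<^bsub>?Q\<^esub> n = \<ominus>\<^bsub>?Q\<^esub> T.hor q ?c n 0"
      using T.Q.minus_equality[of "q [^]\<^bsub>?Q\<^esub> n" "T.hor q ?c n 0"] q T.hor_closed[OF q c', of n 0] by simp
    moreover have "T.hor q ?c n 0 \<in> T.pspan q n" unfolding T.pspan_def using c' by blast
    ultimately show ?R using T.asub_uminus[OF T.pspan_asub[OF q]] by simp
  next
    assume ?R
    then have "\<ominus>\<^bsub>?Q\<^esub> (q [^]\<^bsub>?Q\<^esub> n) \<in> T.pspan q n" by (rule T.asub_uminus[OF T.pspan_asub[OF q]])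
    then obtain c where c: "\<forall>i. c i \<in> carrier R" and eq: "\<ominus>\<^bsub>?Q\<^esub> (q [^]\<^bsub>?Q\<^esub> n) = T.hor q c n 0"
      by (auto simp: T.pspan_def)
    have "q [^]\<^bsub>?Q\<^esub> n \<oplus>\<^bsub>?Q\<^esub> (\<Oplus>\<^bsub>?Q\<^esub>i\<in>{..<n}. tq_embed R (c i) \<otimes>\<^bsub>?Q\<^esub> q [^]\<^bsub>?Q\<^esub> i) = \<zero>\<^bsub>?Q\<^esub>"
      unfolding T.hor_finsum[OF q c] eq[symmetric] using q by (simp add: T.Q.r_neg)
    then show ?L using c by blast
  qed
  have "normalization R = {q \<in> carrier ?Q. \<exists>n::nat. q [^]\<^bsub>?Q\<^esub> n \<in> T.pspan q n}"
    unfolding normalization_def Let_def using key by blast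
  also have "\<dots> = T.Rbar"
    using T.Rbar_integral[OF noetherian_cring_axioms] T.integral_in_Rbar T.Rbar_carrier by blast
  finally show ?thesis .
qed

lemma (in noetherian_cring) conductor_eq:
  "conductor R = {r \<in> carrier R.
     \<forall>q \<in> total_quotient.Rbar (total_quotient_ring R) R (tq_embed R).
       tq_embed R r \<otimes>\<^bsub>total_quotient_ring R\<^esub> q \<in> tq_embed R ` carrier R}"
  unfolding conductor_def normalization_eq ..

section \<open>Invertibility of fractional ideals\<close>

context total_quotient
begin

lemma hor_shift: "hor t c n k = hor t (\<lambda>i. c (i + k)) n 0"
proof -
  have "hor t c n (j + k) = hor t (\<lambda>i. c (i + k)) n j" for j
    by (induction n arbitrary: j) (simp_all flip: add_Suc)
  from this[of 0] show ?thesis by simp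
qed

lemma hor_delta:
  assumes t: "t \<in> carrier Q"
  shows "hor t (\<lambda>i. if i = N then \<one>\<^bsub>R\<^esub> else \<zero>\<^bsub>R\<^esub>) n 0 = (if N < n then t [^] N else \<zero>)"
proof (induction n)
  case (Suc n)
  then show ?case using t by (subst hor_top) (auto simp: less_Suc_eq)
qed simp

lemma idempotent_in_Rbar:
  assumes e: "e \<in> carrier Q" "e \<otimes> e = e" shows "e \<in> Rbar"
proof (rule integral_in_Rbar[OF e(1)])
  have "e [^] (2::nat) = e [^] (1::nat)" using e by (simp add: numeral_2_eq_2)
  then show "e [^] (2::nat) \<in> pspan e 2" using pow_mem_pspan[OF e(1), of 1 2] by simp
qed

end

locale curve_quotient = total_quotient Q R \<iota> + R: curve_ring R
  for Q :: "('q, 'n) ring_scheme" (structure) and R :: "('a, 'm) ring_scheme" and \<iota>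
begin

text \<open>\<open>Q\<close> is von Neumann regular. Write \<open>x = a / s\<close>, and let
  \<open>w = a + b\<close> be regular with \<open>a b = 0\<close>. Then \<open>a w^2 = a^3\<close>,
  so \<open>a^2\<close> and \<open>w^2\<close> act alike on \<open>x\<close>, and
  \<open>x' = s a / w^2\<close> gives \<open>x x' x = a^2 x / w^2 = x\<close>.\<close>

lemma quasi_inverse:
  assumes x: "x \<in> carrier Q" shows "\<exists>x'\<in>carrier Q. x \<otimes> x' \<otimes> x = x"
proof -
  obtain a s where a: "a \<in> carrier R" and s: "s \<in> nonzerodivisors R" and xs: "x \<otimes> \<iota> s = \<iota> a"
    using fraction_form[OF x] by blast
  have sc: "s \<in> carrier R" using R.nonzerodivisor_closed[OF s] .
  obtain b where b: "b \<in> carrier R" "a \<otimes>\<^bsub>R\<^esub> b = \<zero>\<^bsub>R\<^esub>" "a \<oplus>\<^bsub>R\<^esub> b \<in> nonzerodivisors R"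
    using R.regular_complement[OF a] .
  define \<alpha> \<beta> w where "\<alpha> = \<iota> a" and "\<beta> = \<iota> b" and "w = \<iota> (a \<oplus>\<^bsub>R\<^esub> b)"
  have c: "\<alpha> \<in> carrier Q" "\<beta> \<in> carrier Q" using a b by (auto simp: \<alpha>_def \<beta>_def)
  have w: "w \<in> Units Q" "w = \<alpha> \<oplus> \<beta>" using \<iota>_unit[OF b(3)] a b by (auto simp: w_def \<alpha>_def \<beta>_def)
  have wc: "w \<in> carrier Q" using w(1) by auto
  have "\<alpha> \<otimes> \<beta> = \<iota> (a \<otimes>\<^bsub>R\<^esub> b)" using a b(1) by (simp add: \<alpha>_def \<beta>_def)
  then have \<alpha>\<beta>: "\<alpha> \<otimes> \<beta> = \<zero>" using b(2) by simp
  have "\<alpha> \<otimes> (w \<otimes> w) = \<alpha> \<otimes> \<alpha> \<otimes> \<alpha> \<oplus> (\<alpha> \<otimes> \<beta>) \<otimes> (\<alpha> \<oplus> \<alpha> \<oplus> \<beta>)"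
    unfolding w(2) using c by (simp add: ring_arith)
  then have aww: "\<alpha> \<otimes> (w \<otimes> w) = \<alpha> \<otimes> \<alpha> \<otimes> \<alpha>" unfolding \<alpha>\<beta> using c by simp
  have \<alpha>: "\<alpha> = x \<otimes> \<iota> s" using xs by (simp add: \<alpha>_def)
  have "\<iota> s \<otimes> (x \<otimes> (w \<otimes> w)) = \<alpha> \<otimes> (w \<otimes> w)" unfolding \<alpha> using x sc wc by (simp add: Q.m_ac)
  also have "\<dots> = \<alpha> \<otimes> \<alpha> \<otimes> (x \<otimes> \<iota> s)" unfolding aww using \<alpha> by simp
  also have "\<dots> = \<iota> s \<otimes> (\<alpha> \<otimes> \<alpha> \<otimes> x)" using x sc c by (simp add: Q.m_ac)
  finally have xww: "x \<otimes> (w \<otimes> w) = \<alpha> \<otimes> \<alpha> \<otimes> x"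
    by (rule unit_cancel[OF \<iota>_unit[OF s], rotated 2]) (use x wc c in auto)
  define v where "v = inv w"
  have v: "v \<in> carrier Q" "w \<otimes> v = \<one>" using w(1) by (auto simp: v_def)
  define x' where "x' = \<iota> s \<otimes> \<alpha> \<otimes> (v \<otimes> v)"
  have "x \<otimes> x' \<otimes> x = (x \<otimes> \<iota> s) \<otimes> \<alpha> \<otimes> x \<otimes> (v \<otimes> v)"
    unfolding x'_def using x sc c v(1) by (simp add: Q.m_ac)
  also have "\<dots> = x \<otimes> (w \<otimes> w) \<otimes> (v \<otimes> v)" unfolding xww \<alpha>[symmetric] ..
  also have "\<dots> = x \<otimes> ((w \<otimes> v) \<otimes> (w \<otimes> v))" using x wc v(1) by (simp add: Q.m_ac)
  also have "\<dots> = x" unfolding v(2) using x by simp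
  finally show ?thesis using x'_def sc c v(1) by auto
qed

text \<open>As multiplication by \<open>b^l\<close> is injective, this makes \<open>B/bB\<close> a quotient of the ideal of those
  \<open>r\<close> that lie in \<open>b^l B\<close>, as in the theorem of Krull and Akizuki.\<close>

lemma krull_akizuki:
  assumes B: "asub B" and b: "b \<in> nonzerodivisors R"
    and bd: "\<And>x. x \<in> B \<Longrightarrow> \<exists>n::nat. \<iota> (b [^]\<^bsub>R\<^esub> n) \<otimes> x \<in> A"
  shows "\<exists>l::nat. \<forall>x\<in>B. \<exists>y\<in>B. \<exists>r\<in>carrier R.
    \<iota> (b [^]\<^bsub>R\<^esub> l) \<otimes> x = \<iota> (b [^]\<^bsub>R\<^esub> Suc l) \<otimes> y \<oplus> \<iota> r"
proof -
  have bc: "b \<in> carrier R" using R.nonzerodivisor_closed[OF b] .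
  define \<beta> where "\<beta> n = \<iota> (b [^]\<^bsub>R\<^esub> n)" for n :: nat
  have \<beta>c [simp]: "\<beta> n \<in> carrier Q" for n using bc by (simp add: \<beta>_def)
  have \<beta>Suc: "\<beta> (Suc n) = \<iota> b \<otimes> \<beta> n" for n
    using bc by (simp add: \<beta>_def Q.m_comm)
  have \<beta>b: "x \<in> B \<Longrightarrow> \<iota> b \<otimes> x \<in> B" for x using asubD(4)[OF B bc] .
  note Bc = asubD(1)[OF B]
  define K where "K n = {r \<in> carrier R. \<iota> r \<in> (\<lambda>x. \<beta> n \<otimes> x) ` B}" for n
  have K: "ideal (K n) R" for n
    unfolding K_def using B by (intro asub_preimage_ideal asub_scale) auto
  have Kdec: "K (Suc n) \<subseteq> K n" for n
  proof
    fix r assume "r \<in> K (Suc n)"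
    then obtain x where x: "r \<in> carrier R" "\<iota> r = \<beta> (Suc n) \<otimes> x" "x \<in> B" by (auto simp: K_def)
    then have "\<iota> r = \<beta> n \<otimes> (\<iota> b \<otimes> x)" using bc Bc by (simp add: \<beta>Suc Q.m_ac)
    then show "r \<in> K n" using x \<beta>b by (auto simp: K_def)
  qed
  \<comment> \<open>The ideals \<open>K n\<close> of elements lying in \<open>b^n B\<close>
    decrease; adding \<open>b R\<close> places them above \<open>J = b R\<close>, where descending
    chains stabilise.\<close>
  define I where "I n = {w \<oplus>\<^bsub>R\<^esub> b \<otimes>\<^bsub>R\<^esub> r | w r. w \<in> K n \<and> r \<in> carrier R}" for n
  define J where "J = {w \<oplus>\<^bsub>R\<^esub> b \<otimes>\<^bsub>R\<^esub> r | w r. w \<in> {\<zero>\<^bsub>R\<^esub>} \<and> r \<in> carrier R}"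
  have J: "ideal J R" "b \<in> J"
    unfolding J_def by (rule R.ideal_add_principal[OF R.zeroideal bc])+
  have "ideal (I n) R \<and> J \<subseteq> I n \<and> I (Suc n) \<subseteq> I n" for n
  proof (intro conjI)
    show "ideal (I n) R" unfolding I_def by (rule R.ideal_add_principal[OF K bc])
    show "J \<subseteq> I n" unfolding J_def I_def using R.ideal_zero[OF K] by blast
    show "I (Suc n) \<subseteq> I n" unfolding I_def using Kdec by blast
  qed
  then obtain l where l: "\<And>n. n \<ge> l \<Longrightarrow> I n = I l"
    using R.dcc_above_regular[OF J b] unfolding R.dcc_above_def by blast
  define P where "P x n \<longleftrightarrow> (\<exists>y\<in>B. \<exists>r\<in>carrier R. \<beta> n \<otimes> x = \<beta> (Suc n) \<otimes> y \<oplus> \<iota> r)" for x n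
  \<comment> \<open>One factor \<open>b\<close> is cancelled. From
    \<open>b^(n+1) x = b^(n+2) y + r\<close> it follows that \<open>r\<close> is in
    \<open>K (Suc n)\<close>, hence in \<open>I (Suc n) = I (Suc (Suc n))\<close>. So
    \<open>r = b^(n+2) y' + b r'\<close>, and the whole equation is divisible by
    \<open>b\<close>.\<close>
  have step: "P x n" if x: "x \<in> B" and n: "n \<ge> l" and P: "P x (Suc n)" for x n
  proof -
    obtain y r where y: "y \<in> B" and r: "r \<in> carrier R"
      and eq: "\<beta> (Suc n) \<otimes> x = \<beta> (Suc (Suc n)) \<otimes> y \<oplus> \<iota> r"
      using P unfolding P_def by blast
    have yx: "x \<in> carrier Q" "y \<in> carrier Q" using Bc x y by auto
    define z where "z = x \<ominus> \<iota> b \<otimes> y"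
    have z: "z \<in> B" unfolding z_def by (rule asub_minus[OF B x \<beta>b[OF y]])
    have "\<beta> (Suc n) \<otimes> z = \<beta> (Suc n) \<otimes> x \<ominus> \<beta> (Suc (Suc n)) \<otimes> y"
      unfolding z_def using yx bc by (simp add: \<beta>Suc Q.r_distr Q.r_minus a_minus_def Q.m_ac)
    also have "\<dots> = \<iota> r"
    proof -
      have "(p \<oplus> q) \<ominus> p = q" if "p \<in> carrier Q" "q \<in> carrier Q" for p q
        using that by (simp add: ring_arith)
      then show ?thesis unfolding eq using yx r by simp
    qed
    finally have "r \<in> K (Suc n)" unfolding K_def using r z by force
    then have "r \<in> I (Suc n)" unfolding I_def using R.ideal_add_principal(2)[OF K bc] by blast
    then have "r \<in> I (Suc (Suc n))" using l[of "Suc n"] l[of "Suc (Suc n)"] n by simp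
    then obtain w r' where w: "w \<in> K (Suc (Suc n))" and r': "r' \<in> carrier R" and rw: "r = w \<oplus>\<^bsub>R\<^esub> b \<otimes>\<^bsub>R\<^esub> r'"
      unfolding I_def by blast
    obtain y' where y': "y' \<in> B" "\<iota> w = \<beta> (Suc (Suc n)) \<otimes> y'" and wc: "w \<in> carrier R"
      using w unfolding K_def by auto
    have y'c: "y' \<in> carrier Q" using Bc y'(1) .
    have "\<iota> b \<otimes> (\<beta> n \<otimes> x) = \<beta> (Suc n) \<otimes> x" using yx bc by (simp add: \<beta>Suc Q.m_assoc)
    also have "\<dots> = \<beta> (Suc (Suc n)) \<otimes> y \<oplus> (\<beta> (Suc (Suc n)) \<otimes> y' \<oplus> \<iota> b \<otimes> \<iota> r')"
      unfolding eq rw using wc bc r' y'(2) by simp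
    also have "\<dots> = \<iota> b \<otimes> (\<beta> (Suc n) \<otimes> (y \<oplus> y') \<oplus> \<iota> r')"
      using yx y'c bc r' by (simp add: \<beta>Suc[of "Suc n"] Q.r_distr Q.m_assoc Q.a_assoc)
    finally have "\<beta> n \<otimes> x = \<beta> (Suc n) \<otimes> (y \<oplus> y') \<oplus> \<iota> r'"
      by (rule unit_cancel[OF \<iota>_unit[OF b], rotated 2]) (use yx y'c r' in auto)
    then show ?thesis unfolding P_def using asubD(3)[OF B y y'(1)] r' by blast
  qed
  have "P x l" if x: "x \<in> B" for x
  proof -
    obtain n r where r: "r \<in> carrier R" "\<beta> n \<otimes> x = \<iota> r"
      using bd[OF x] by (auto simp: \<beta>_def)
    have "\<beta> (n + m) \<otimes> x \<in> A" for m
    proof (induction m)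
      case 0
      then show ?case using r by auto
    next
      case (Suc m)
      have "\<beta> (n + Suc m) \<otimes> x = \<iota> b \<otimes> (\<beta> (n + m) \<otimes> x)"
        using bc Bc[OF x] by (simp add: \<beta>Suc Q.m_assoc)
      then show ?case using asubD(4)[OF asub_A bc Suc] by simp
    qed
    from this[of l] obtain r' where r': "r' \<in> carrier R" "\<beta> (n + l) \<otimes> x = \<iota> r'" by auto
    \<comment> \<open>At an exponent that clears the denominator of \<open>x\<close> the
      representation holds with \<open>y = 0\<close>. The exponent is at least \<open>l\<close>, so
      the cancellation step can be repeated down to \<open>l\<close>.\<close>
    then have "\<beta> (n + l) \<otimes> x = \<beta> (Suc (n + l)) \<otimes> \<zero> \<oplus> \<iota> r'" by simp
    then have "P x (n + l)" unfolding P_def using asubD(2)[OF B] r'(1) by blast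
    moreover have "P x (m + l) \<Longrightarrow> P x l" for m
    proof (induction m)
      case (Suc m)
      have "P x (m + l)" by (rule step[OF x]) (use Suc.prems in simp_all)
      then show ?case by (rule Suc.IH)
    qed simp
    ultimately show ?thesis by blast
  qed
  then show ?thesis unfolding P_def \<beta>_def by blast
qed

lemma pspan_Union_asub:
  assumes t: "t \<in> carrier Q" shows "asub (\<Union>n. pspan t n)"
proof -
  have D: "asub (pspan t n)" for n by (rule pspan_asub[OF t])
  have up: "x \<in> pspan t (max m n)" "x \<in> pspan t (max n m)" if "x \<in> pspan t m" for x m n
    using that pspan_mono[OF t, of m "max m n"] pspan_mono[OF t, of m "max n m"] by auto
  show ?thesis
    unfolding asub_def
  proof (intro conjI ballI)
    show "(\<Union>n. pspan t n) \<subseteq> carrier Q" using asubD(1)[OF D] by blast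
    show "\<zero> \<in> (\<Union>n. pspan t n)" using asubD(2)[OF D] by blast
  next
    fix x y assume "x \<in> (\<Union>n. pspan t n)" "y \<in> (\<Union>n. pspan t n)"
    then obtain m n where "x \<in> pspan t m" "y \<in> pspan t n" by blast
    then have "x \<oplus> y \<in> pspan t (max m n)" using up asubD(3)[OF D] by blast
    then show "x \<oplus> y \<in> (\<Union>n. pspan t n)" by blast
  next
    fix r x assume "r \<in> carrier R" "x \<in> (\<Union>n. pspan t n)"
    then show "\<iota> r \<otimes> x \<in> (\<Union>n. pspan t n)" using asubD(4)[OF D] by blast
  qed
qed

text \<open>Let \<open>t = a / b\<close>. If \<open>b\<close> is a unit, \<open>t\<close> lies in
  \<open>R\<close>. Otherwise \<open>krull_akizuki\<close> for \<open>B = R[t]\<close> gives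
  \<open>b^l t^N = b^(l+1) y + r\<close>, so \<open>z = t^N - b y\<close> satisfies
  \<open>b^l z = r\<close>. The elements of \<open>R\<close> in \<open>b^l pspan t n\<close> form an
  ascending chain of ideals; if it is stable from \<open>N\<close> on, \<open>z\<close> is a
  combination of powers below \<open>N\<close>. Then \<open>t^N - z - b y = 0\<close> is a relation
  whose coefficient at \<open>t^N\<close> is \<open>1\<close> minus a multiple of the nonunit
  \<open>b\<close>.\<close>

lemma polynomial_relation:
  assumes t: "t \<in> carrier Q"
  shows "\<exists>D c k. (\<forall>i. c i \<in> carrier R) \<and> k \<le> D \<and> c k = \<one>\<^bsub>R\<^esub> \<and> hor t c (Suc D) 0 = \<zero>"
proof -
  obtain a b where a: "a \<in> carrier R" and b: "b \<in> nonzerodivisors R" and tb: "t \<otimes> \<iota> b = \<iota> a"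
    using fraction_form[OF t] by blast
  have bc: "b \<in> carrier R" using R.nonzerodivisor_closed[OF b] .
  show ?thesis
  proof (cases "b \<in> Units R")
    case True
    define r where "r = a \<otimes>\<^bsub>R\<^esub> inv\<^bsub>R\<^esub> b"
    have r: "r \<in> carrier R" using a True by (simp add: r_def)
    have "t = t \<otimes> \<iota> b \<otimes> \<iota> (inv\<^bsub>R\<^esub> b)"
      using t True bc by (simp add: Q.m_assoc flip: \<iota>.hom_mult)
    then have tr: "t = \<iota> r" unfolding tb using a True by (simp add: r_def)
    define c where "c i = (if i = 0 then \<ominus>\<^bsub>R\<^esub> r else \<one>\<^bsub>R\<^esub>)" for i :: nat
    have "hor t c (Suc 1) 0 = \<zero>" using r by (simp add: c_def tr Q.l_neg)
    moreover have "\<forall>i. c i \<in> carrier R" "c 1 = \<one>\<^bsub>R\<^esub>" using r by (auto simp: c_def)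
    ultimately show ?thesis by blast
  next
    case False
    define B where "B = (\<Union>n. pspan t n)"
    have B: "asub B" unfolding B_def by (rule pspan_Union_asub[OF t])
    have B_mem: "x \<in> B \<longleftrightarrow> (\<exists>n. x \<in> pspan t n)" for x by (simp add: B_def)
    have bd: "\<exists>n::nat. \<iota> (b [^]\<^bsub>R\<^esub> n) \<otimes> x \<in> A" if "x \<in> B" for x
      using that pspan_bounded_pow[OF t bc a tb] unfolding B_mem by blast
    obtain l :: nat where l: "\<forall>x\<in>B. \<exists>y\<in>B. \<exists>r\<in>carrier R.
        \<iota> (b [^]\<^bsub>R\<^esub> l) \<otimes> x = \<iota> (b [^]\<^bsub>R\<^esub> Suc l) \<otimes> y \<oplus> \<iota> r"
      using krull_akizuki[OF B b bd] by (rule exE)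
    define \<beta> where "\<beta> = \<iota> (b [^]\<^bsub>R\<^esub> l)"
    have \<beta>: "\<beta> \<in> Units Q" unfolding \<beta>_def by (rule \<iota>_unit[OF R.nonzerodivisor_pow[OF b]])
    have \<beta>c: "\<beta> \<in> carrier Q" using \<beta> by auto
    \<comment> \<open>The exponent \<open>l\<close> serves all of \<open>B\<close>, so this chain,
      and with it \<open>N\<close>, can be fixed before the representation of \<open>t^N\<close> is
      taken.\<close>
    define L where "L n = {r \<in> carrier R. \<iota> r \<in> (\<lambda>x. \<beta> \<otimes> x) ` pspan t n}" for n
    have "\<exists>N. \<forall>n\<ge>N. L n = L N"
    proof (rule R.ascending_ideals_stabilise)
      show "ideal (L n) R" for n
        unfolding L_def by (intro asub_preimage_ideal asub_scale pspan_asub t \<beta>c)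
      show "L n \<subseteq> L (Suc n)" for n
        unfolding L_def using pspan_mono[OF t, of n "Suc n"] by auto
    qed
    then obtain N where N: "\<And>n. n \<ge> N \<Longrightarrow> L n = L N" by blast
    have tN: "t [^] N \<in> B" unfolding B_mem using pow_mem_pspan[OF t, of N "Suc N"] by blast
    obtain y r where y: "y \<in> B" and r: "r \<in> carrier R"
      and eq: "\<beta> \<otimes> t [^] N = \<iota> (b [^]\<^bsub>R\<^esub> Suc l) \<otimes> y \<oplus> \<iota> r"
      using bspec[OF l tN] unfolding \<beta>_def by blast
    have yc: "y \<in> carrier Q" using asubD(1)[OF B y] .
    define z where "z = t [^] N \<ominus> \<iota> b \<otimes> y"
    have z: "z \<in> B" unfolding z_def by (rule asub_minus[OF B tN asubD(4)[OF B bc y]])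
    have zc: "z \<in> carrier Q" using asubD(1)[OF B z] .
    have "\<beta> \<otimes> z = \<beta> \<otimes> t [^] N \<ominus> \<iota> (b [^]\<^bsub>R\<^esub> Suc l) \<otimes> y"
      unfolding z_def using t yc bc \<beta>c by (simp add: \<beta>_def Q.r_distr Q.r_minus a_minus_def Q.m_ac)
    also have "\<dots> = \<iota> r"
    proof -
      have "(p \<oplus> q) \<ominus> p = q" if "p \<in> carrier Q" "q \<in> carrier Q" for p q
        using that by (simp add: ring_arith)
      then show ?thesis unfolding eq using yc r bc by simp
    qed
    finally have \<beta>z: "\<beta> \<otimes> z = \<iota> r" .
    obtain M1 where "z \<in> pspan t M1" using z unfolding B_mem by blast
    then have "z \<in> pspan t (max M1 N)" using pspan_mono[OF t, of M1 "max M1 N"] by auto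
    then have "r \<in> L (max M1 N)" unfolding L_def using r \<beta>z[symmetric] by blast
    then have "r \<in> L N" using N[of "max M1 N"] by simp
    then obtain z' where z': "z' \<in> pspan t N" "\<iota> r = \<beta> \<otimes> z'" unfolding L_def by blast
    have "z = z'"
      by (rule unit_cancel[OF \<beta> zc]) (use z' \<beta>z asubD(1)[OF pspan_asub[OF t]] in auto)
    then obtain c1 where c1: "\<forall>i. c1 i \<in> carrier R" and z1: "z = hor t c1 N 0"
      using z'(1) unfolding pspan_def by blast
    obtain M2 where "y \<in> pspan t M2" using y unfolding B_mem by blast
    then have "y \<in> pspan t (Suc (max M2 N))"
      using pspan_mono[OF t, of M2 "Suc (max M2 N)"] by (auto simp: le_SucI)
    moreover define D where "D = max M2 N"
    ultimately obtain c2 where c2: "\<forall>i. c2 i \<in> carrier R" and y2: "y = hor t c2 (Suc D) 0"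
      unfolding pspan_def by blast
    have D: "N \<le> D" by (simp add: D_def)
    define \<delta> where "\<delta> i = (if i = N then \<one>\<^bsub>R\<^esub> else \<zero>\<^bsub>R\<^esub>)" for i
    define c1' where "c1' i = (if i < N then c1 i else \<zero>\<^bsub>R\<^esub>)" for i
    define m where "m = \<ominus>\<^bsub>R\<^esub> \<one>\<^bsub>R\<^esub>"
    \<comment> \<open>The coefficients of \<open>t^N - z - b y\<close>. Signs enter through the
      scalar \<open>m = -1\<close>, since \<open>hor_add\<close> and \<open>hor_smult\<close> deal
      with sums and multiples only.\<close>
    define c where "c i = (\<delta> i \<oplus>\<^bsub>R\<^esub> (m \<otimes>\<^bsub>R\<^esub> c1' i)) \<oplus>\<^bsub>R\<^esub> ((m \<otimes>\<^bsub>R\<^esub> b) \<otimes>\<^bsub>R\<^esub> c2 i)" for i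
    have cc: "\<forall>i. \<delta> i \<in> carrier R" "\<forall>i. c1' i \<in> carrier R" "m \<in> carrier R" "m \<otimes>\<^bsub>R\<^esub> b \<in> carrier R"
      using c1 bc by (auto simp: \<delta>_def c1'_def m_def)
    then have cc': "\<forall>i. m \<otimes>\<^bsub>R\<^esub> c1' i \<in> carrier R" "\<forall>i. (m \<otimes>\<^bsub>R\<^esub> b) \<otimes>\<^bsub>R\<^esub> c2 i \<in> carrier R"
      "\<forall>i. \<delta> i \<oplus>\<^bsub>R\<^esub> (m \<otimes>\<^bsub>R\<^esub> c1' i) \<in> carrier R" "\<forall>i. c i \<in> carrier R" using c2 by (auto simp: c_def)
    have "hor t c (Suc D) 0 = hor t \<delta> (Suc D) 0 \<oplus> \<iota> m \<otimes> hor t c1' (Suc D) 0 \<oplus>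
        \<iota> (m \<otimes>\<^bsub>R\<^esub> b) \<otimes> hor t c2 (Suc D) 0"
      unfolding hor_smult[OF t cc(2,3)] hor_smult[OF t c2 cc(4)] hor_add[OF t cc(1) cc'(1)]
        hor_add[OF t cc'(3,2)] c_def ..
    also have "hor t \<delta> (Suc D) 0 = t [^] N" unfolding \<delta>_def hor_delta[OF t] using D by simp
    also have "hor t c1' (Suc D) 0 = z"
      unfolding z1 c1'_def using hor_extend[OF t c1, of N "Suc D"] D by simp
    also have "t [^] N \<oplus> \<iota> m \<otimes> z \<oplus> \<iota> (m \<otimes>\<^bsub>R\<^esub> b) \<otimes> hor t c2 (Suc D) 0 = \<zero>"
    proof -
      have "p \<oplus> \<ominus> (p \<ominus> q \<otimes> v) \<oplus> \<ominus> q \<otimes> v = \<zero>"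
        if "p \<in> carrier Q" "q \<in> carrier Q" "v \<in> carrier Q" for p q v
        using that by (simp add: ring_arith)
      from this[of "t [^] N" "\<iota> b" y] show ?thesis
        unfolding y2[symmetric] m_def using t bc yc zc by (simp add: Q.l_minus z_def[symmetric])
    qed
    finally have rel: "hor t c (Suc D) 0 = \<zero>" .
    \<comment> \<open>The part coming from \<open>z\<close> vanishes at index \<open>N\<close>, but
      \<open>y\<close> may have any degree and contributes there; its contribution is a multiple of
      \<open>b\<close>.\<close>
    have "c N = \<one>\<^bsub>R\<^esub> \<ominus>\<^bsub>R\<^esub> b \<otimes>\<^bsub>R\<^esub> c2 N"
      using bc c2 by (simp add: c_def \<delta>_def c1'_def m_def R.l_minus a_minus_def)
    then have unit: "c N \<in> Units R" using R.one_minus_nonunit_multiple[OF bc False] c2 by simp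
    define v where "v = inv\<^bsub>R\<^esub> (c N)"
    have v: "v \<in> carrier R" "v \<otimes>\<^bsub>R\<^esub> c N = \<one>\<^bsub>R\<^esub>" using unit by (auto simp: v_def)
    have "hor t (\<lambda>i. v \<otimes>\<^bsub>R\<^esub> c i) (Suc D) 0 = \<zero>"
      unfolding hor_smult[OF t cc'(4) v(1), symmetric] rel using v by simp
    then show ?thesis
      using v cc'(4) D by (intro exI[of _ D] exI[of _ "\<lambda>i. v \<otimes>\<^bsub>R\<^esub> c i"] exI[of _ N]) auto
  qed
qed

text \<open>With \<open>b k = c k + c (k + 1) t + ...\<close>, the relation gives \<open>b k t^k = - (c 0 + ... +
  c (k - 1) t^(k - 1))\<close>, so that \<open>b k\<close> stabilises the span of \<open>1, ..., t^(D - 1)\<close>; and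
  \<open>b k - t b (k + 1) = c k\<close>.\<close>

lemma unimodular_pair_one:
  assumes t: "t \<in> carrier Q"
  shows "\<exists>p q. p \<in> Rbar \<and> q \<in> Rbar \<and> t \<otimes> p \<in> Rbar \<and> t \<otimes> q \<in> Rbar \<and> p \<oplus> t \<otimes> q = \<one>"
proof -
  obtain D c k where c: "\<forall>i. c i \<in> carrier R" and k: "k \<le> D" "c k = \<one>\<^bsub>R\<^esub>"
    and rel: "hor t c (Suc D) 0 = \<zero>" using polynomial_relation[OF t] by blast
  show ?thesis
  \<comment> \<open>A relation of degree zero with a coefficient \<open>1\<close> says that
    \<open>Q\<close> is the zero ring. In all other cases the span of \<open>D\<close> powers
    contains \<open>1\<close>.\<close>
  proof (cases "D = 0")
    case True
    then have "\<zero> = \<one>" using rel k t by simp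
    moreover have "\<zero> \<oplus> t \<otimes> \<zero> = \<zero>" using t by simp
    ultimately have "\<zero> \<oplus> t \<otimes> \<zero> = \<one>" by (rule trans[rotated])
    moreover have "t \<otimes> \<zero> \<in> Rbar" using t Rbar_zero by simp
    ultimately show ?thesis using Rbar_zero by blast
  next
    case False
    define b where "b j = hor t c (Suc D - j) j" for j
    have bc [simp]: "b j \<in> carrier Q" for j using t c by (simp add: b_def)
    have brec: "b j = \<iota> (c j) \<oplus> t \<otimes> b (Suc j)" if "j \<le> D" for j
      using that by (simp add: b_def Suc_diff_le)
    have b0: "b 0 = \<zero>" using rel by (simp add: b_def)
    have bmem: "b j \<in> pspan t (Suc D - j)" for j
      unfolding b_def hor_shift[of t c _ j] pspan_def
      using c by (intro CollectI exI[of _ "\<lambda>i. c (i + j)"]) auto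
    have bpow: "j \<le> Suc D \<Longrightarrow> b j \<otimes> t [^] j \<in> pspan t j" for j
    proof (induction j)
      case 0
      then show ?case using b0 asubD(2)[OF pspan_asub[OF t]] by simp
    next
      case (Suc j)
      have "b (Suc j) \<otimes> t [^] Suc j = b j \<otimes> t [^] j \<ominus> \<iota> (c j) \<otimes> t [^] j"
      proof -
        have "x \<otimes> (p \<otimes> t) = (y \<oplus> t \<otimes> x) \<otimes> p \<ominus> y \<otimes> p"
          if "x \<in> carrier Q" "p \<in> carrier Q" "y \<in> carrier Q" for x y p
          using that t by (simp add: ring_arith)
        from this[of "b (Suc j)" "t [^] j" "\<iota> (c j)"] show ?thesis
          using brec[of j] Suc.prems t c by simp
      qed
      moreover have "b j \<otimes> t [^] j \<in> pspan t (Suc j)"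
        using Suc pspan_mono[OF t, of j "Suc j"] by auto
      moreover have "\<iota> (c j) \<otimes> t [^] j \<in> pspan t (Suc j)"
        using asubD(4)[OF pspan_asub[OF t]] pow_mem_pspan[OF t] c by auto
      ultimately show ?case using asub_minus[OF pspan_asub[OF t]] by simp
    qed
    obtain d where d: "d \<in> Units Q" "\<And>x. x \<in> pspan t D \<Longrightarrow> d \<otimes> x \<in> A"
      using pspan_bounded[OF t] by blast
    have bR: "b j \<in> Rbar" if j: "j \<le> Suc D" for j
    proof (rule RbarI[OF bc pspan_asub[OF t] _ _ d])
      show "\<one> \<in> pspan t D" using pow_mem_pspan[OF t, of 0 D] False by simp
      \<comment> \<open>For \<open>i < j\<close> the product has degree at most
        \<open>D - j + i\<close>, below \<open>D\<close>. For \<open>i \<ge> j\<close> the relation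
        has already rewritten \<open>b j t^j\<close> by powers below \<open>j\<close>, and
        \<open>i - j\<close> further factors keep the degree below \<open>D\<close>.\<close>
      have "b j \<otimes> t [^] i \<in> pspan t D" if i: "i < D" for i
      proof (cases "i < j")
        case True
        have "b j \<otimes> t [^] i \<in> pspan t (Suc D - j + i)" by (rule pspan_mult_pow[OF t bmem])
        moreover have "Suc D - j + i \<le> D" using True j by linarith
        ultimately show ?thesis using pspan_mono[OF t] by blast
      next
        case False
        have "b j \<otimes> t [^] i = b j \<otimes> t [^] j \<otimes> t [^] (i - j)"
          using False t by (simp add: Q.m_assoc Q.nat_pow_mult)
        also have "\<dots> \<in> pspan t (j + (i - j))" by (rule pspan_mult_pow[OF t bpow[OF j]])
        finally have "b j \<otimes> t [^] i \<in> pspan t (j + (i - j))" .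
        moreover have "j + (i - j) \<le> D" using False i by linarith
        ultimately show ?thesis using pspan_mono[OF t] by blast
      qed
      then have "pspan t D \<subseteq> {x \<in> carrier Q. b j \<otimes> x \<in> pspan t D}"
        using t by (intro pspan_least[OF t asub_colon[OF pspan_asub[OF t]]]) auto
      then show "b j \<otimes> x \<in> pspan t D" if "x \<in> pspan t D" for x using that by blast
    qed auto
    have tb: "t \<otimes> b j \<in> Rbar" if j: "j \<le> Suc D" for j
    proof (cases j)
      case 0
      then show ?thesis using b0 t Rbar_zero by simp
    next
      case (Suc i)
      have "t \<otimes> b j = b i \<ominus> \<iota> (c i)"
      proof -
        have "x = (y \<oplus> x) \<ominus> y" if "x \<in> carrier Q" "y \<in> carrier Q" for x y
          using that by (simp add: ring_arith)
        from this[of "t \<otimes> b j" "\<iota> (c i)"] show ?thesis using brec[of i] Suc j t c by simp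
      qed
      then show ?thesis using Rbar_minus[OF bR A_subset_Rbar] c j Suc by simp
    qed
    have "b k \<oplus> t \<otimes> (\<ominus> b (Suc k)) = \<one>"
    proof -
      have "(y \<oplus> t \<otimes> x) \<oplus> t \<otimes> (\<ominus> x) = y" if "x \<in> carrier Q" "y \<in> carrier Q" for x y
        using that t by (simp add: ring_arith)
      from this[of "b (Suc k)" "\<iota> (c k)"] show ?thesis using brec[of k] k c by simp
    qed
    moreover have "t \<otimes> (\<ominus> b (Suc k)) \<in> Rbar"
      using Rbar_uminus[OF tb[of "Suc k"]] k(1) t by (simp add: Q.r_minus)
    moreover have "b k \<in> Rbar" "\<ominus> b (Suc k) \<in> Rbar" "t \<otimes> b k \<in> Rbar"
      using bR tb Rbar_uminus k(1) by auto
    ultimately show ?thesis by blast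
  qed
qed

text \<open>The idempotents \<open>e = a a'\<close> and \<open>f = b b'\<close> are the supports of
  \<open>a\<close> and \<open>b\<close>. On \<open>e Q\<close> the element \<open>a\<close> is
  invertible and the pair is \<open>a\<close> times \<open>(1, t)\<close> with
  \<open>t = a' b\<close>, so \<open>unimodular_pair_one\<close> applies. On
  \<open>(1 - e) Q\<close> the element \<open>a\<close> vanishes and \<open>b'\<close> inverts
  \<open>b\<close> on its support. \<open>p\<close> and \<open>q\<close> are glued from these two
  solutions.\<close>

lemma unimodular_pair:
  assumes a: "a \<in> carrier Q" and b: "b \<in> carrier Q"
  shows "\<exists>p\<in>carrier Q. \<exists>q\<in>carrier Q. p \<otimes> a \<in> Rbar \<and> p \<otimes> b \<in> Rbar \<and> q \<otimes> a \<in> Rbar \<and> q \<otimes> b \<in> Rbar \<and>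
    (p \<otimes> a \<oplus> q \<otimes> b) \<otimes> a = a \<and> (p \<otimes> a \<oplus> q \<otimes> b) \<otimes> b = b"
proof -
  obtain a' where a': "a' \<in> carrier Q" "a \<otimes> a' \<otimes> a = a" using quasi_inverse[OF a] by blast
  obtain b' where b': "b' \<in> carrier Q" "b \<otimes> b' \<otimes> b = b" using quasi_inverse[OF b] by blast
  define e f t where "e = a \<otimes> a'" and "f = b \<otimes> b'" and "t = a' \<otimes> b"
  have c: "e \<in> carrier Q" "f \<in> carrier Q" "t \<in> carrier Q" using a a'(1) b b'(1) by (auto simp: e_def f_def t_def)
  have ea: "e \<otimes> a = a" and fb: "f \<otimes> b = b" using a' b' by (auto simp: e_def f_def)
  have ee: "e \<otimes> e = e" using ea a a'(1) c by (metis e_def Q.m_assoc)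
  have ff: "f \<otimes> f = f" using fb b b'(1) c by (metis f_def Q.m_assoc)
  have eR: "e \<in> Rbar" and fR: "f \<in> Rbar" using idempotent_in_Rbar ee ff c by auto
  obtain x y where xy: "x \<in> Rbar" "y \<in> Rbar" "t \<otimes> x \<in> Rbar" "t \<otimes> y \<in> Rbar" "x \<oplus> t \<otimes> y = \<one>"
    using unimodular_pair_one[OF c(3)] by blast
  have xyc: "x \<in> carrier Q" "y \<in> carrier Q" using xy(1,2) by (auto simp: Rbar_carrier)
  define p q where "p = e \<otimes> x \<otimes> a'" and "q = e \<otimes> y \<otimes> a' \<oplus> (\<one> \<ominus> e) \<otimes> b'"
  have pq: "p \<in> carrier Q" "q \<in> carrier Q" using c xyc a' b' by (auto simp: p_def q_def)
  have "p \<otimes> a = (e \<otimes> e) \<otimes> x" unfolding p_def e_def using a a'(1) xyc by (simp add: Q.m_ac)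
  then have pa: "p \<otimes> a = e \<otimes> x" using ee by simp
  have pb: "p \<otimes> b = e \<otimes> (t \<otimes> x)" unfolding p_def t_def using a'(1) xyc b c by (simp add: Q.m_ac)
  have "q \<otimes> a = (e \<otimes> e) \<otimes> y \<oplus> (a \<ominus> e \<otimes> a) \<otimes> b'"
    unfolding q_def e_def using a a'(1) b'(1) xyc by (simp add: ring_arith)
  then have qa: "q \<otimes> a = e \<otimes> y" unfolding ee ea using a b'(1) c xyc by simp
  have qb: "q \<otimes> b = e \<otimes> (t \<otimes> y) \<oplus> (\<one> \<ominus> e) \<otimes> f"
    unfolding q_def t_def f_def using a'(1) b'(1) b c xyc by (simp add: ring_arith)
  have sum: "p \<otimes> a \<oplus> q \<otimes> b = e \<oplus> (\<one> \<ominus> e) \<otimes> f"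
  proof -
    have "p \<otimes> a \<oplus> q \<otimes> b = e \<otimes> (x \<oplus> t \<otimes> y) \<oplus> (\<one> \<ominus> e) \<otimes> f"
      unfolding pa qb using c xyc by (simp add: ring_arith)
    then show ?thesis unfolding xy(5) using c by simp
  qed
  have "(e \<oplus> (\<one> \<ominus> e) \<otimes> f) \<otimes> a = e \<otimes> a \<oplus> (a \<ominus> e \<otimes> a) \<otimes> f"
    using a c by (simp add: ring_arith)
  then have 1: "(p \<otimes> a \<oplus> q \<otimes> b) \<otimes> a = a" unfolding sum ea using a c by simp
  have "(e \<oplus> (\<one> \<ominus> e) \<otimes> f) \<otimes> b = e \<otimes> b \<oplus> (\<one> \<ominus> e) \<otimes> (f \<otimes> b)"
    using b c by (simp add: ring_arith)
  also have "\<dots> = b" unfolding fb using b c by (simp add: ring_arith)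
  finally have 2: "(p \<otimes> a \<oplus> q \<otimes> b) \<otimes> b = b" unfolding sum .
  have "p \<otimes> a \<in> Rbar" "p \<otimes> b \<in> Rbar" "q \<otimes> a \<in> Rbar" "q \<otimes> b \<in> Rbar"
    unfolding pa pb qa qb using eR fR xy Rbar_one by (auto intro: Rbar_mult Rbar_add Rbar_minus)
  then show ?thesis using 1 2 pq by blast
qed

text \<open>The row \<open>s\<close> is dual to the column \<open>t\<close>: it shows that the
  fractional ideal generated by the entries is invertible on its support, cut out by the idempotent
  \<open>sum s i t i\<close>. To add an entry \<open>u\<close>, the weights
  \<open>e i = s i t i\<close>, with sum \<open>\<epsilon>\<close>, glue the solutions
  \<open>p i\<close>, \<open>q i\<close> for the pairs \<open>(t i, u)\<close>. On
  \<open>(1 - \<epsilon>) Q\<close> the old entries vanish and a quasi-inverse \<open>v\<close> of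
  \<open>u\<close> suffices.\<close>

lemma unimodular_column:
  fixes k :: nat
  assumes "t \<in> {..<k} \<rightarrow> carrier Q"
  shows "\<exists>s\<in>{..<k} \<rightarrow> carrier Q. (\<forall>i<k. \<forall>j<k. s i \<otimes> t j \<in> Rbar) \<and>
    (\<forall>j<k. (\<Oplus>i\<in>{..<k}. s i \<otimes> t i) \<otimes> t j = t j)"
  using assms
proof (induction k)
  case 0
  then show ?case by auto
next
  case (Suc k)
  define u where "u = t k"
  have tc: "t j \<in> carrier Q" if "j < k" for j using Suc.prems that by auto
  have uc: "u \<in> carrier Q" using Suc.prems by (auto simp: u_def)
  have "t \<in> {..<k} \<rightarrow> carrier Q" using tc by auto
  then obtain s where s: "s \<in> {..<k} \<rightarrow> carrier Q" and sR: "\<And>i j. i < k \<Longrightarrow> j < k \<Longrightarrow> s i \<otimes> t j \<in> Rbar"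
    and s1: "\<And>j. j < k \<Longrightarrow> (\<Oplus>i\<in>{..<k}. s i \<otimes> t i) \<otimes> t j = t j" using Suc.IH by blast
  have sc: "s j \<in> carrier Q" if "j < k" for j using s that by auto
  have "\<forall>i. \<exists>p q. i < k \<longrightarrow> p \<in> carrier Q \<and> q \<in> carrier Q \<and>
     p \<otimes> t i \<in> Rbar \<and> p \<otimes> u \<in> Rbar \<and> q \<otimes> t i \<in> Rbar \<and> q \<otimes> u \<in> Rbar \<and>
    (p \<otimes> t i \<oplus> q \<otimes> u) \<otimes> t i = t i \<and> (p \<otimes> t i \<oplus> q \<otimes> u) \<otimes> u = u"
    using unimodular_pair[OF tc uc] by blast
  then obtain p q where "\<forall>i. i < k \<longrightarrow> p i \<in> carrier Q \<and> q i \<in> carrier Q \<and>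
     p i \<otimes> t i \<in> Rbar \<and> p i \<otimes> u \<in> Rbar \<and> q i \<otimes> t i \<in> Rbar \<and> q i \<otimes> u \<in> Rbar \<and>
    (p i \<otimes> t i \<oplus> q i \<otimes> u) \<otimes> t i = t i \<and> (p i \<otimes> t i \<oplus> q i \<otimes> u) \<otimes> u = u"
    by metis
  then have pq: "p i \<in> carrier Q" "q i \<in> carrier Q" "p i \<otimes> t i \<in> Rbar" "p i \<otimes> u \<in> Rbar"
      "q i \<otimes> t i \<in> Rbar" "q i \<otimes> u \<in> Rbar" "(p i \<otimes> t i \<oplus> q i \<otimes> u) \<otimes> t i = t i"
      "(p i \<otimes> t i \<oplus> q i \<otimes> u) \<otimes> u = u" if "i < k" for i
    using that by auto
  obtain v where v: "v \<in> carrier Q" "u \<otimes> v \<otimes> u = u" using quasi_inverse[OF uc] by blast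
  define e where "e i = s i \<otimes> t i" for i
  define \<epsilon> where "\<epsilon> = (\<Oplus>i\<in>{..<k}. e i)"
  define w where "w = (\<Oplus>i\<in>{..<k}. e i \<otimes> q i)"
  have ec: "e i \<in> carrier Q" "e i \<in> Rbar" if "i < k" for i using sc tc sR that by (auto simp: e_def)
  have \<epsilon>: "\<epsilon> \<in> Rbar" "\<epsilon> \<in> carrier Q"
    using Rbar_finsum[of "{..<k}" e] ec Rbar_carrier by (auto simp: \<epsilon>_def)
  have \<epsilon>t: "\<epsilon> \<otimes> t j = t j" if "j < k" for j using s1[OF that] by (simp add: \<epsilon>_def e_def)
  have wc: "w \<in> carrier Q" unfolding w_def using ec pq by (intro Q.finsum_closed) auto
  have vu: "u \<otimes> v \<in> carrier Q" "u \<otimes> v \<in> Rbar"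
  proof -
    show "u \<otimes> v \<in> carrier Q" using uc v by simp
    moreover have "(u \<otimes> v) \<otimes> (u \<otimes> v) = (u \<otimes> v \<otimes> u) \<otimes> v" using uc v(1) by (simp add: Q.m_assoc)
    ultimately show "u \<otimes> v \<in> Rbar" using v(2) idempotent_in_Rbar by simp
  qed
  define s' where "s' i = (if i < k then e i \<otimes> p i else w \<oplus> (\<one> \<ominus> \<epsilon>) \<otimes> v)" for i
  have s'c: "s' i \<in> carrier Q" for i using ec pq wc \<epsilon> v by (simp add: s'_def)
  define z where "z = (\<Oplus>i\<in>{..<k}. s' i \<otimes> t i)"
  have zc: "z \<in> carrier Q" unfolding z_def using s'c tc by (intro Q.finsum_closed) auto
  have sum: "(\<Oplus>i\<in>{..<Suc k}. s' i \<otimes> t i) = (z \<oplus> w \<otimes> u) \<oplus> (\<one> \<ominus> \<epsilon>) \<otimes> (u \<otimes> v)"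
  proof -
    have "(\<Oplus>i\<in>{..<Suc k}. s' i \<otimes> t i) = s' k \<otimes> t k \<oplus> (\<Oplus>i\<in>{..<k}. s' i \<otimes> t i)"
      unfolding lessThan_Suc using s'c tc uc by (intro Q.finsum_insert) (auto simp: u_def)
    also have "\<dots> = (w \<oplus> (\<one> \<ominus> \<epsilon>) \<otimes> v) \<otimes> u \<oplus> z"
      by (simp add: z_def u_def s'_def)
    also have "\<dots> = (z \<oplus> w \<otimes> u) \<oplus> (\<one> \<ominus> \<epsilon>) \<otimes> (u \<otimes> v)"
      using uc v(1) \<epsilon>(2) wc zc by (simp add: ring_arith)
    finally show ?thesis .
  qed
  have zw: "z \<oplus> w \<otimes> u = (\<Oplus>i\<in>{..<k}. e i \<otimes> (p i \<otimes> t i \<oplus> q i \<otimes> u))"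
  proof -
    have "w \<otimes> u = (\<Oplus>i\<in>{..<k}. e i \<otimes> q i \<otimes> u)"
      unfolding w_def using ec pq uc by (intro Q.finsum_ldistr) auto
    then have "z \<oplus> w \<otimes> u = (\<Oplus>i\<in>{..<k}. s' i \<otimes> t i \<oplus> e i \<otimes> q i \<otimes> u)"
      unfolding z_def using s'c tc ec pq uc by (subst Q.finsum_addf) auto
    also have "\<dots> = (\<Oplus>i\<in>{..<k}. e i \<otimes> (p i \<otimes> t i \<oplus> q i \<otimes> u))"
      using ec pq tc uc by (intro Q.finsum_cong') (auto simp: s'_def Q.r_distr Q.m_assoc)
    finally show ?thesis .
  qed
  have zx: "(z \<oplus> w \<otimes> u) \<otimes> x = \<epsilon> \<otimes> x"
    if x: "x \<in> carrier Q" and "\<And>i. i < k \<Longrightarrow> e i \<otimes> (p i \<otimes> t i \<oplus> q i \<otimes> u) \<otimes> x = e i \<otimes> x" for x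
  proof -
    have "(z \<oplus> w \<otimes> u) \<otimes> x = (\<Oplus>i\<in>{..<k}. e i \<otimes> (p i \<otimes> t i \<oplus> q i \<otimes> u) \<otimes> x)"
      unfolding zw using ec pq tc uc x by (intro Q.finsum_ldistr) auto
    also have "\<dots> = (\<Oplus>i\<in>{..<k}. e i \<otimes> x)"
      using that ec x by (intro Q.finsum_cong') auto
    also have "\<dots> = \<epsilon> \<otimes> x"
      unfolding \<epsilon>_def using ec x by (intro Q.finsum_ldistr[symmetric]) auto
    finally show ?thesis .
  qed
  have zu: "(z \<oplus> w \<otimes> u) \<otimes> u = \<epsilon> \<otimes> u"
    by (rule zx[OF uc]) (use pq ec tc uc in \<open>simp add: Q.m_assoc\<close>)
  have zt: "(z \<oplus> w \<otimes> u) \<otimes> t j = \<epsilon> \<otimes> t j" if j: "j < k" for j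
  proof (rule zx[OF tc[OF j]])
    fix i assume i: "i < k"
    \<comment> \<open>The pair solution fixes \<open>t i\<close>, not \<open>t j\<close>. Therefore
      \<open>t j\<close> trades places with the factor \<open>t i\<close> of \<open>e i\<close>; the
      same exchange makes \<open>w t j\<close> integral further down.\<close>
    have "e i \<otimes> (p i \<otimes> t i \<oplus> q i \<otimes> u) \<otimes> t j = s i \<otimes> t j \<otimes> ((p i \<otimes> t i \<oplus> q i \<otimes> u) \<otimes> t i)"
      unfolding e_def using sc tc pq(1,2) uc i j by (simp add: Q.m_ac)
    also have "\<dots> = e i \<otimes> t j" unfolding pq(7)[OF i] e_def using sc tc i j by (simp add: Q.m_ac)
    finally show "e i \<otimes> (p i \<otimes> t i \<oplus> q i \<otimes> u) \<otimes> t j = e i \<otimes> t j" .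
  qed
  have "(\<Oplus>i\<in>{..<Suc k}. s' i \<otimes> t i) \<otimes> t j = t j" if j: "j < Suc k" for j
  proof (cases "j < k")
    case True
    have "((z \<oplus> w \<otimes> u) \<oplus> (\<one> \<ominus> \<epsilon>) \<otimes> (u \<otimes> v)) \<otimes> t j =
        (z \<oplus> w \<otimes> u) \<otimes> t j \<oplus> (t j \<ominus> \<epsilon> \<otimes> t j) \<otimes> (u \<otimes> v)"
    proof -
      have "(x \<oplus> (\<one> \<ominus> \<epsilon>) \<otimes> y) \<otimes> r = x \<otimes> r \<oplus> (r \<ominus> \<epsilon> \<otimes> r) \<otimes> y"
        if "x \<in> carrier Q" "y \<in> carrier Q" "r \<in> carrier Q" for x y r
        using that \<epsilon>(2) by (simp add: ring_arith)
      then show ?thesis using zc wc uc vu(1) tc[OF True] by simp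
    qed
    also have "\<dots> = t j" unfolding zt[OF True] \<epsilon>t[OF True] using tc[OF True] vu(1) by simp
    finally show ?thesis unfolding sum .
  next
    case False
    then have j: "t j = u" using j by (simp add: u_def less_Suc_eq)
    have "((z \<oplus> w \<otimes> u) \<oplus> (\<one> \<ominus> \<epsilon>) \<otimes> (u \<otimes> v)) \<otimes> u = (z \<oplus> w \<otimes> u) \<otimes> u \<oplus> (\<one> \<ominus> \<epsilon>) \<otimes> (u \<otimes> v \<otimes> u)"
      using zc wc uc vu(1) v(1) \<epsilon>(2) by (simp add: Q.l_distr Q.m_assoc)
    also have "\<dots> = u" unfolding zu v(2) using \<epsilon>(2) uc by (simp add: ring_arith)
    finally show ?thesis unfolding sum j .
  qed
  moreover have "s' i \<otimes> t j \<in> Rbar" if i: "i < Suc k" and j: "j < Suc k" for i j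
  proof (cases "i < k")
    case i: True
    show ?thesis
    proof (cases "j < k")
      case j: True
      have "s' i \<otimes> t j = (s i \<otimes> t j) \<otimes> (p i \<otimes> t i)"
        using i j sc tc pq by (simp add: s'_def e_def Q.m_ac)
      then show ?thesis using sR[OF i j] pq(3)[OF i] by (simp add: Rbar_mult)
    next
      case False
      then have "t j = u" using j by (simp add: u_def less_Suc_eq)
      then have "s' i \<otimes> t j = e i \<otimes> (p i \<otimes> u)"
        using i ec pq uc by (simp add: s'_def Q.m_assoc)
      then show ?thesis using ec(2)[OF i] pq(4)[OF i] by (simp add: Rbar_mult)
    qed
  next
    case i: False
    show ?thesis
    proof (cases "j < k")
      case j: True
      have "s' i \<otimes> t j = w \<otimes> t j \<oplus> (t j \<ominus> \<epsilon> \<otimes> t j) \<otimes> v"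
      proof -
        have "(w \<oplus> (\<one> \<ominus> \<epsilon>) \<otimes> v) \<otimes> r = w \<otimes> r \<oplus> (r \<ominus> \<epsilon> \<otimes> r) \<otimes> v" if "r \<in> carrier Q" for r
          using that \<epsilon>(2) wc v(1) by (simp add: ring_arith)
        then show ?thesis using i tc[OF j] by (simp add: s'_def)
      qed
      also have "\<dots> = w \<otimes> t j" unfolding \<epsilon>t[OF j] using wc v(1) tc[OF j] by simp
      also have "\<dots> = (\<Oplus>i\<in>{..<k}. e i \<otimes> q i \<otimes> t j)"
        unfolding w_def using ec pq tc[OF j] by (intro Q.finsum_ldistr) auto
      also have "\<dots> = (\<Oplus>i\<in>{..<k}. (s i \<otimes> t j) \<otimes> (q i \<otimes> t i))"
        using sc tc pq j by (intro Q.finsum_cong') (auto simp: e_def Q.m_ac)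
      also have "\<dots> \<in> Rbar"
        using sR[OF _ j] pq(5) by (intro Rbar_finsum) (auto intro: Rbar_mult)
      finally show ?thesis .
    next
      case False
      then have "t j = u" using j by (simp add: u_def less_Suc_eq)
      then have "s' i \<otimes> t j = w \<otimes> u \<oplus> (\<one> \<ominus> \<epsilon>) \<otimes> (u \<otimes> v)"
        using i wc uc v(1) \<epsilon>(2) by (simp add: s'_def Q.l_distr Q.r_distr Q.m_ac)
      moreover have "w \<otimes> u = (\<Oplus>i\<in>{..<k}. e i \<otimes> q i \<otimes> u)"
        unfolding w_def using ec pq uc by (intro Q.finsum_ldistr) auto
      moreover have "\<dots> = (\<Oplus>i\<in>{..<k}. e i \<otimes> (q i \<otimes> u))"
        using ec uc pq by (intro Q.finsum_cong') (auto simp: Q.m_assoc)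
      moreover have "\<dots> \<in> Rbar"
        using ec(2) pq(6) by (intro Rbar_finsum) (auto intro: Rbar_mult)
      ultimately show ?thesis
        using Rbar_add Rbar_mult Rbar_minus Rbar_one \<epsilon>(1) vu(2) by simp
    qed
  qed
  ultimately show ?case using s'c by (intro bexI[of _ s']) auto
qed

end

section \<open>Linear maps on free modules\<close>

text \<open>Linearity on a subset of the carrier and without the extensionality of
  \<open>mod_hom\<close>, so that submodules need no record of their own and maps can be plain
  lambda terms.\<close>

definition linear_on :: "('a, 'm) ring_scheme \<Rightarrow> ('a, 'b) module \<Rightarrow> 'b set \<Rightarrow> ('a, 'c) module \<Rightarrow>
    ('b \<Rightarrow> 'c) \<Rightarrow> bool" where
  "linear_on R M S N f \<longleftrightarrow> (\<forall>x\<in>S. f x \<in> carrier N) \<and>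
     (\<forall>x\<in>S. \<forall>y\<in>S. f (x \<oplus>\<^bsub>M\<^esub> y) = f x \<oplus>\<^bsub>N\<^esub> f y) \<and>
     (\<forall>r\<in>carrier R. \<forall>x\<in>S. f (r \<odot>\<^bsub>M\<^esub> x) = r \<odot>\<^bsub>N\<^esub> f x)"

abbreviation linear :: "('a, 'm) ring_scheme \<Rightarrow> ('a, 'b) module \<Rightarrow> ('a, 'c) module \<Rightarrow>
    ('b \<Rightarrow> 'c) \<Rightarrow> bool" where
  "linear R M N f \<equiv> linear_on R M (carrier M) N f"

lemma linear_onD:
  assumes "linear_on R M S N f"
  shows "x \<in> S \<Longrightarrow> f x \<in> carrier N"
    "x \<in> S \<Longrightarrow> y \<in> S \<Longrightarrow> f (x \<oplus>\<^bsub>M\<^esub> y) = f x \<oplus>\<^bsub>N\<^esub> f y"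
    "r \<in> carrier R \<Longrightarrow> x \<in> S \<Longrightarrow> f (r \<odot>\<^bsub>M\<^esub> x) = r \<odot>\<^bsub>N\<^esub> f x"
  using assms by (auto simp: linear_on_def)

lemma linear_onI:
  assumes "\<And>x. x \<in> S \<Longrightarrow> f x \<in> carrier N"
    "\<And>x y. x \<in> S \<Longrightarrow> y \<in> S \<Longrightarrow> f (x \<oplus>\<^bsub>M\<^esub> y) = f x \<oplus>\<^bsub>N\<^esub> f y"
    "\<And>r x. r \<in> carrier R \<Longrightarrow> x \<in> S \<Longrightarrow> f (r \<odot>\<^bsub>M\<^esub> x) = r \<odot>\<^bsub>N\<^esub> f x"
  shows "linear_on R M S N f"
  using assms by (auto simp: linear_on_def)

lemma linear_on_subset: "linear_on R M S N f \<Longrightarrow> T \<subseteq> S \<Longrightarrow> linear_on R M T N f"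
  unfolding linear_on_def by blast

lemma mod_hom_linear: "f \<in> mod_hom R M N \<Longrightarrow> linear R M N f"
  by (auto simp: mod_hom_def linear_on_def)

lemma linear_mod_hom:
  assumes M: "module R M" and f: "linear R M N f"
  shows "restrict f (carrier M) \<in> mod_hom R M N"
proof -
  interpret M: module R M by fact
  show ?thesis using f by (auto simp: mod_hom_def linear_on_def)
qed

lemma linear_on_zero:
  assumes M: "module R M" and N: "module R N" and f: "linear_on R M S N f" and S: "submodule S R M"
  shows "f \<zero>\<^bsub>M\<^esub> = \<zero>\<^bsub>N\<^esub>"
proof -
  interpret M: module R M by fact
  interpret N: module R N by fact
  obtain x where x: "x \<in> S" using M.submoduleE(2)[OF S] by blast
  have xc: "x \<in> carrier M" using M.submoduleE(1)[OF S] x by blast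
  have "f (\<zero>\<^bsub>R\<^esub> \<odot>\<^bsub>M\<^esub> x) = \<zero>\<^bsub>R\<^esub> \<odot>\<^bsub>N\<^esub> f x" by (rule linear_onD(3)[OF f]) (use x in auto)
  then show ?thesis using xc linear_onD(1)[OF f x] by simp
qed

lemma linear_on_minus:
  assumes M: "module R M" and N: "module R N" and f: "linear_on R M S N f" and S: "submodule S R M"
    and x: "x \<in> S" and y: "y \<in> S"
  shows "f (x \<ominus>\<^bsub>M\<^esub> y) = f x \<ominus>\<^bsub>N\<^esub> f y"
proof -
  interpret M: module R M by fact
  interpret N: module R N by fact
  let ?m = "\<ominus>\<^bsub>R\<^esub> \<one>\<^bsub>R\<^esub>"
  have c: "x \<in> carrier M" "y \<in> carrier M" using M.submoduleE(1)[OF S] x y by auto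
  have m: "\<ominus>\<^bsub>M\<^esub> y = ?m \<odot>\<^bsub>M\<^esub> y" using c by (simp add: M.smult_l_minus)
  have my: "?m \<odot>\<^bsub>M\<^esub> y \<in> S" using M.submoduleE(4)[OF S _ y] by simp
  have "f (x \<ominus>\<^bsub>M\<^esub> y) = f x \<oplus>\<^bsub>N\<^esub> ?m \<odot>\<^bsub>N\<^esub> f y"
    unfolding a_minus_def m using linear_onD(2)[OF f x my] linear_onD(3)[OF f _ y] by simp
  also have "\<dots> = f x \<ominus>\<^bsub>N\<^esub> f y"
    using linear_onD(1)[OF f y] by (simp add: N.smult_l_minus a_minus_def)
  finally show ?thesis .
qed

lemma (in module) submodule_minus:
  assumes "submodule S R M" "x \<in> S" "y \<in> S" shows "x \<ominus>\<^bsub>M\<^esub> y \<in> S"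
  unfolding a_minus_def using submoduleE(3,5)[OF assms(1)] assms(2,3) by blast

lemma (in module) submodule_zero:
  assumes "submodule S R M" shows "\<zero>\<^bsub>M\<^esub> \<in> S"
proof -
  obtain x where "x \<in> S" using submoduleE(2)[OF assms] by blast
  then have "x \<ominus>\<^bsub>M\<^esub> x \<in> S" "x \<in> carrier M" using submodule_minus[OF assms] submoduleE(1)[OF assms] by auto
  then show ?thesis by (simp add: M.r_neg a_minus_def)
qed

lemma (in module) submodule_intro:
  assumes "S \<subseteq> carrier M" "\<zero>\<^bsub>M\<^esub> \<in> S" "\<And>x y. x \<in> S \<Longrightarrow> y \<in> S \<Longrightarrow> x \<oplus>\<^bsub>M\<^esub> y \<in> S"
    and s: "\<And>r x. r \<in> carrier R \<Longrightarrow> x \<in> S \<Longrightarrow> r \<odot>\<^bsub>M\<^esub> x \<in> S"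
  shows "submodule S R M"
proof (rule submoduleI[OF assms(1,2) _ assms(3,4)])
  fix x assume x: "x \<in> S"
  then have "(\<ominus> \<one>) \<odot>\<^bsub>M\<^esub> x \<in> S" using s by simp
  then show "\<ominus>\<^bsub>M\<^esub> x \<in> S" using assms(1) x by (auto simp: smult_l_minus)
qed auto

lemma linear_on_kernel:
  assumes M: "module R M" and N: "module R N" and f: "linear_on R M S N f" and S: "submodule S R M"
  shows "submodule {x \<in> S. f x = \<zero>\<^bsub>N\<^esub>} R M"
proof -
  interpret M: module R M by fact
  interpret N: module R N by fact
  show ?thesis
  proof (rule M.submodule_intro)
    show "\<zero>\<^bsub>M\<^esub> \<in> {x \<in> S. f x = \<zero>\<^bsub>N\<^esub>}"
      using M.submodule_zero[OF S] linear_on_zero[OF assms] by simp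
  qed (use linear_onD[OF f] M.submoduleE[OF S] in auto)
qed

lemma linear_on_image:
  assumes M: "module R M" and N: "module R N" and f: "linear_on R M S N f" and S: "submodule S R M"
  shows "submodule (f ` S) R N"
proof -
  interpret M: module R M by fact
  interpret N: module R N by fact
  show ?thesis
  proof (rule N.submodule_intro)
    show "f ` S \<subseteq> carrier N" using linear_onD(1)[OF f] by auto
    show "\<zero>\<^bsub>N\<^esub> \<in> f ` S"
      using M.submodule_zero[OF S] linear_on_zero[OF assms] by (metis imageI)
  next
    fix x y assume "x \<in> f ` S" "y \<in> f ` S"
    then show "x \<oplus>\<^bsub>N\<^esub> y \<in> f ` S"
      using M.submoduleE(5)[OF S] by (auto simp flip: linear_onD(2)[OF f])
  next
    fix r x assume "r \<in> carrier R" "x \<in> f ` S"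
    then show "r \<odot>\<^bsub>N\<^esub> x \<in> f ` S"
      using M.submoduleE(4)[OF S] by (auto simp flip: linear_onD(3)[OF f])
  qed
qed

lemma a_kernel_eq: "a_kernel M N f = {x \<in> carrier M. f x = \<zero>\<^bsub>N\<^esub>}"
  by (simp add: a_kernel_def' )

context cring
begin

lemma free_carrier: "carrier (free_module R n) = ({..<n} \<rightarrow>\<^sub>E carrier R)"
  by (simp add: free_module_def)

lemma free_closed: "x \<in> carrier (free_module R n) \<Longrightarrow> i < n \<Longrightarrow> x i \<in> carrier R"
  by (auto simp: free_carrier)

lemma free_eqI:
  assumes "x \<in> carrier (free_module R n)" "y \<in> carrier (free_module R n)" "\<And>i. i < n \<Longrightarrow> x i = y i"
  shows "x = y"
  using assms by (auto simp: free_carrier intro: PiE_ext)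

lemma free_zero: "\<zero>\<^bsub>free_module R n\<^esub> = (\<lambda>i\<in>{..<n}. \<zero>)"
  and free_add: "x \<oplus>\<^bsub>free_module R n\<^esub> y = (\<lambda>i\<in>{..<n}. x i \<oplus> y i)"
  and free_smult: "r \<odot>\<^bsub>free_module R n\<^esub> x = (\<lambda>i\<in>{..<n}. r \<otimes> x i)"
  by (simp_all add: free_module_def)

lemma free_restrict: "(\<And>i. i < n \<Longrightarrow> f i \<in> carrier R) \<Longrightarrow> restrict f {..<n} \<in> carrier (free_module R n)"
  by (auto simp: free_carrier)

lemma free_module_module: "module R (free_module R n)"
proof (rule moduleI)
  show "abelian_group (free_module R n)"
  proof (rule abelian_groupI)
    fix x assume x: "x \<in> carrier (free_module R n)"
    show "\<exists>y\<in>carrier (free_module R n). y \<oplus>\<^bsub>free_module R n\<^esub> x = \<zero>\<^bsub>free_module R n\<^esub>"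
    proof (rule bexI[of _ "\<lambda>i\<in>{..<n}. \<ominus> x i"])
      show "(\<lambda>i\<in>{..<n}. \<ominus> x i) \<oplus>\<^bsub>free_module R n\<^esub> x = \<zero>\<^bsub>free_module R n\<^esub>"
        using free_closed[OF x] by (auto simp: free_add free_zero l_neg intro!: restrict_ext)
      show "(\<lambda>i\<in>{..<n}. \<ominus> x i) \<in> carrier (free_module R n)"
        using free_closed[OF x] by (intro free_restrict) auto
    qed
    show "\<zero>\<^bsub>free_module R n\<^esub> \<oplus>\<^bsub>free_module R n\<^esub> x = x"
      using x free_closed[OF x] by (intro free_eqI[OF _ x]) (auto simp: free_add free_zero intro: free_restrict)
  qed (auto simp: free_add free_zero a_ac free_closed intro!: free_restrict restrict_ext)
next
  fix x assume x: "x \<in> carrier (free_module R n)"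
  show "\<one> \<odot>\<^bsub>free_module R n\<^esub> x = x"
    using free_closed[OF x] by (intro free_eqI[OF _ x]) (auto simp: free_smult intro: free_restrict)
qed (auto simp: free_add free_smult l_distr r_distr m_assoc free_closed cring_axioms
      intro!: free_restrict restrict_ext)

definition unit_vec :: "nat \<Rightarrow> nat \<Rightarrow> nat \<Rightarrow> 'a" where
  "unit_vec n i = (\<lambda>j\<in>{..<n}. if j = i then \<one> else \<zero>)"

lemma unit_vec_closed: "unit_vec n i \<in> carrier (free_module R n)"
  unfolding unit_vec_def by (intro free_restrict) auto

lemma ring_module_module: "module R (ring_module R)"
proof (rule moduleI)
  show "abelian_group (ring_module R)"
  proof (rule abelian_groupI)
    fix x assume x: "x \<in> carrier (ring_module R)"
    then have "\<ominus> x \<in> carrier R" "\<ominus> x \<oplus> x = \<zero>" by (auto simp: ring_module_def l_neg)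
    then show "\<exists>y\<in>carrier (ring_module R). y \<oplus>\<^bsub>ring_module R\<^esub> x = \<zero>\<^bsub>ring_module R\<^esub>"
      by (auto simp: ring_module_def)
  qed (auto simp: ring_module_def a_ac)
qed (auto simp: ring_module_def l_distr r_distr m_assoc cring_axioms)

lemma ring_module_simps [simp]:
  "carrier (ring_module R) = carrier R" "\<zero>\<^bsub>ring_module R\<^esub> = \<zero>"
  "x \<oplus>\<^bsub>ring_module R\<^esub> y = x \<oplus> y" "r \<odot>\<^bsub>ring_module R\<^esub> x = r \<otimes> x"
  by (simp_all add: ring_module_def)

lemma ring_module_minus [simp]: "x \<ominus>\<^bsub>ring_module R\<^esub> y = x \<ominus> y"
proof -
  have "\<ominus>\<^bsub>ring_module R\<^esub> y = \<ominus> y" by (simp add: a_inv_def m_inv_def ring_module_def)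
  then show ?thesis by (simp add: a_minus_def)
qed

lemma ring_module_finsum [simp]: "finsum (ring_module R) f I = finsum R f I"
  by (simp add: finsum_def finprod_def ring_module_def)

lemma ideal_submodule: "ideal J R \<Longrightarrow> submodule J R (ring_module R)"
proof -
  assume J: "ideal J R"
  interpret M: module R "ring_module R" by (rule ring_module_module)
  show ?thesis
    by (rule M.submodule_intro)
      (use ideal_zero[OF J] ideal_add_closed[OF J] ideal_mult_closed[OF J] ideal_carrier[OF J] in auto)
qed

lemma submodule_ideal: "submodule J R (ring_module R) \<Longrightarrow> ideal J R"
proof -
  assume J: "submodule J R (ring_module R)"
  interpret M: module R "ring_module R" by (rule ring_module_module)
  show ?thesis
    by (rule ideal_criterion)
      (use M.submoduleE[OF J] M.submodule_zero[OF J] in auto)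
qed

lemma linear_coordinate:
  assumes "i < n" shows "linear R (free_module R n) (ring_module R) (\<lambda>x. x i)"
  by (rule linear_onI) (use assms in \<open>auto simp: free_add free_smult free_closed\<close>)

text \<open>The existence half of the universal property of free modules;
  \<open>linear_expand\<close> is the uniqueness half.\<close>

lemma linear_combination:
  assumes N: "module R N" and z: "\<And>i. i < n \<Longrightarrow> z i \<in> carrier N"
  shows "linear R (free_module R n) N (\<lambda>x. \<Oplus>\<^bsub>N\<^esub>i\<in>{..<n}. x i \<odot>\<^bsub>N\<^esub> z i)"
proof -
  interpret N: module R N by fact
  have xz: "x i \<odot>\<^bsub>N\<^esub> z i \<in> carrier N" if "x \<in> carrier (free_module R n)" "i < n" for x i
    using that z free_closed by auto
  show ?thesis
  proof (rule linear_onI)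
    fix x assume x: "x \<in> carrier (free_module R n)"
    show "(\<Oplus>\<^bsub>N\<^esub>i\<in>{..<n}. x i \<odot>\<^bsub>N\<^esub> z i) \<in> carrier N"
      using xz[OF x] by (intro N.M.finsum_closed) auto
  next
    fix x y assume x: "x \<in> carrier (free_module R n)" and y: "y \<in> carrier (free_module R n)"
    have "(\<Oplus>\<^bsub>N\<^esub>i\<in>{..<n}. (x \<oplus>\<^bsub>free_module R n\<^esub> y) i \<odot>\<^bsub>N\<^esub> z i) =
        (\<Oplus>\<^bsub>N\<^esub>i\<in>{..<n}. x i \<odot>\<^bsub>N\<^esub> z i \<oplus>\<^bsub>N\<^esub> y i \<odot>\<^bsub>N\<^esub> z i)"
      using x y z xz by (intro N.M.finsum_cong') (auto simp: free_add N.smult_l_distr free_closed)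
    also have "\<dots> = (\<Oplus>\<^bsub>N\<^esub>i\<in>{..<n}. x i \<odot>\<^bsub>N\<^esub> z i) \<oplus>\<^bsub>N\<^esub> (\<Oplus>\<^bsub>N\<^esub>i\<in>{..<n}. y i \<odot>\<^bsub>N\<^esub> z i)"
      using x y xz by (intro N.M.finsum_addf) auto
    finally show "(\<Oplus>\<^bsub>N\<^esub>i\<in>{..<n}. (x \<oplus>\<^bsub>free_module R n\<^esub> y) i \<odot>\<^bsub>N\<^esub> z i) = \<dots>" .
  next
    fix r x assume r: "r \<in> carrier R" and x: "x \<in> carrier (free_module R n)"
    have "(\<Oplus>\<^bsub>N\<^esub>i\<in>{..<n}. (r \<odot>\<^bsub>free_module R n\<^esub> x) i \<odot>\<^bsub>N\<^esub> z i) =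
        (\<Oplus>\<^bsub>N\<^esub>i\<in>{..<n}. r \<odot>\<^bsub>N\<^esub> (x i \<odot>\<^bsub>N\<^esub> z i))"
      using r x z xz by (intro N.M.finsum_cong') (auto simp: free_smult N.smult_assoc1 free_closed)
    also have "\<dots> = r \<odot>\<^bsub>N\<^esub> (\<Oplus>\<^bsub>N\<^esub>i\<in>{..<n}. x i \<odot>\<^bsub>N\<^esub> z i)"
      using r x xz by (intro N.finsum_smult_ldistr[symmetric]) auto
    finally show "(\<Oplus>\<^bsub>N\<^esub>i\<in>{..<n}. (r \<odot>\<^bsub>free_module R n\<^esub> x) i \<odot>\<^bsub>N\<^esub> z i) = \<dots>" .
  qed
qed

lemma linear_expand:
  assumes N: "module R N" and f: "linear R (free_module R n) N f" and x: "x \<in> carrier (free_module R n)"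
  shows "f x = (\<Oplus>\<^bsub>N\<^esub>i\<in>{..<n}. x i \<odot>\<^bsub>N\<^esub> f (unit_vec n i))"
proof -
  interpret N: module R N by fact
  interpret F: module R "free_module R n" by (rule free_module_module)
  define tr where "tr k = (\<lambda>i\<in>{..<n}. if i < k then x i else \<zero>)" for k
  have tr: "tr k \<in> carrier (free_module R n)" for k
    unfolding tr_def using free_closed[OF x] by (intro free_restrict) auto
  have fu: "f (unit_vec n i) \<in> carrier N" for i using linear_onD(1)[OF f unit_vec_closed] .
  have "k \<le> n \<Longrightarrow> f (tr k) = (\<Oplus>\<^bsub>N\<^esub>i\<in>{..<k}. x i \<odot>\<^bsub>N\<^esub> f (unit_vec n i))" for k
  proof (induction k)
    case 0
    have "tr 0 = \<zero>\<^bsub>free_module R n\<^esub>" by (simp add: tr_def free_zero)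
    then show ?case
      using linear_on_zero[OF free_module_module N f F.carrier_is_submodule] by simp
  next
    case (Suc k)
    have xk: "x k \<in> carrier R" using free_closed[OF x] Suc.prems by simp
    have s: "x k \<odot>\<^bsub>free_module R n\<^esub> unit_vec n k \<in> carrier (free_module R n)"
      using xk unit_vec_closed by simp
    have "tr (Suc k) = tr k \<oplus>\<^bsub>free_module R n\<^esub> x k \<odot>\<^bsub>free_module R n\<^esub> unit_vec n k"
      using free_closed[OF x] xk Suc.prems
      by (intro free_eqI[OF tr]) (auto simp: free_add free_smult tr_def unit_vec_def less_Suc_eq intro!: free_restrict)
    then have "f (tr (Suc k)) = f (tr k) \<oplus>\<^bsub>N\<^esub> x k \<odot>\<^bsub>N\<^esub> f (unit_vec n k)"
      using linear_onD(2)[OF f tr s] linear_onD(3)[OF f xk unit_vec_closed] by simp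
    also have "\<dots> = x k \<odot>\<^bsub>N\<^esub> f (unit_vec n k) \<oplus>\<^bsub>N\<^esub> (\<Oplus>\<^bsub>N\<^esub>i\<in>{..<k}. x i \<odot>\<^bsub>N\<^esub> f (unit_vec n i))"
    proof -
      have "(\<Oplus>\<^bsub>N\<^esub>i\<in>{..<k}. x i \<odot>\<^bsub>N\<^esub> f (unit_vec n i)) \<in> carrier N"
        using fu free_closed[OF x] Suc.prems by (intro N.M.finsum_closed) auto
      then show ?thesis using Suc fu[of k] xk by (simp add: N.M.a_comm)
    qed
    also have "\<dots> = (\<Oplus>\<^bsub>N\<^esub>i\<in>{..<Suc k}. x i \<odot>\<^bsub>N\<^esub> f (unit_vec n i))"
      unfolding lessThan_Suc using fu free_closed[OF x] Suc.prems
      by (intro N.M.finsum_insert[symmetric]) auto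
    finally show ?case .
  qed
  moreover have "tr n = x"
    using free_closed[OF x] by (intro free_eqI[OF tr x]) (simp add: tr_def)
  ultimately show ?thesis by auto
qed

lemma linear_compose:
  assumes f: "linear_on R M S N f" and g: "linear_on R N T P g" and "\<And>x. x \<in> S \<Longrightarrow> f x \<in> T"
  shows "linear_on R M S P (\<lambda>x. g (f x))"
  using assms by (auto simp: linear_on_def)

end

section \<open>Integral projections\<close>

context curve_quotient
begin

text \<open>This expresses that finitely generated torsion-free modules over the normalization are
  projective: \<open>e\<close> is an integral projection along the common kernel of the functionals.\<close>

lemma integral_projection:
  fixes g :: "nat \<Rightarrow> (nat \<Rightarrow> 'q) \<Rightarrow> 'q"
  assumes "\<And>l. l < n \<Longrightarrow> linear Q (free_module Q k) (ring_module Q) (g l)"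
  shows "\<exists>e. linear Q (free_module Q k) (free_module Q k) e \<and>
    (\<forall>y\<in>carrier (free_module Q k). (\<forall>l<n. g l y = \<zero>) \<longrightarrow> e y = \<zero>\<^bsub>free_module Q k\<^esub>) \<and>
    (\<forall>y\<in>carrier (free_module Q k). \<forall>l<n. g l (e y) = g l y) \<and>
    (\<forall>y\<in>carrier (free_module Q k). (\<forall>i<k. y i \<in> Rbar) \<longrightarrow> (\<forall>i<k. e y i \<in> Rbar))"
  using assms
proof (induction n)
  case 0
  interpret F: module Q "free_module Q k" by (rule Q.free_module_module)
  show ?case
  proof (intro exI[of _ "\<lambda>y. \<zero>\<^bsub>free_module Q k\<^esub>"] conjI ballI impI allI)
    show "linear Q (free_module Q k) (free_module Q k) (\<lambda>y. \<zero>\<^bsub>free_module Q k\<^esub>)"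
      by (rule linear_onI) auto
    show "\<zero>\<^bsub>free_module Q k\<^esub> i \<in> Rbar" if "i < k" for i
      using that Rbar_zero by (simp add: Q.free_zero)
  qed auto
next
  case (Suc n)
  let ?F = "free_module Q k"
  interpret F: module Q ?F by (rule Q.free_module_module)
  note Fm = Q.free_module_module and Qm = Q.ring_module_module
  have glin: "linear Q ?F (ring_module Q) (g l)" if "l < n" for l using Suc.prems that by simp
  have Glin: "linear Q ?F (ring_module Q) (g n)" using Suc.prems by simp
  obtain e where E: "linear Q ?F ?F e \<and>
    (\<forall>y\<in>carrier ?F. (\<forall>l<n. g l y = \<zero>) \<longrightarrow> e y = \<zero>\<^bsub>?F\<^esub>) \<and>
    (\<forall>y\<in>carrier ?F. \<forall>l<n. g l (e y) = g l y) \<and>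
    (\<forall>y\<in>carrier ?F. (\<forall>i<k. y i \<in> Rbar) \<longrightarrow> (\<forall>i<k. e y i \<in> Rbar))"
    using Suc.IH[OF glin] by (rule exE)
  have e: "linear Q ?F ?F e" using E by (rule conjunct1)
  have eker: "e y = \<zero>\<^bsub>?F\<^esub>" if "y \<in> carrier ?F" "\<forall>l<n. g l y = \<zero>" for y
    using bspec[OF E[THEN conjunct2, THEN conjunct1] that(1)] that(2) by simp
  have eg: "g l (e y) = g l y" if "y \<in> carrier ?F" "l < n" for y l
    using bspec[OF E[THEN conjunct2, THEN conjunct2, THEN conjunct1] that(1)] that(2) by simp
  have eR: "e y i \<in> Rbar" if "y \<in> carrier ?F" "\<forall>i<k. y i \<in> Rbar" "i < k" for y i
    using bspec[OF E[THEN conjunct2, THEN conjunct2, THEN conjunct2] that(1)] that(2,3) by simp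
  note ec = linear_onD(1)[OF e]
  have Gc: "g n y \<in> carrier Q" if "y \<in> carrier ?F" for y using linear_onD(1)[OF Glin that] by simp
  \<comment> \<open>The new functional on \<open>y - e y\<close>, which lies in the common kernel of
    the old ones. Its values on the unit vectors are the column to which
    \<open>unimodular_column\<close> is applied.\<close>
  define g' where "g' y = g n (y \<ominus>\<^bsub>?F\<^esub> e y)" for y
  have g'_eq: "g' y = g n y \<ominus> g n (e y)" if "y \<in> carrier ?F" for y
    unfolding g'_def using linear_on_minus[OF Fm Qm Glin F.carrier_is_submodule that ec[OF that]]
    by simp
  have g'c: "g' y \<in> carrier Q" if "y \<in> carrier ?F" for y
    using that Gc ec by (simp add: g'_eq)
  have g'lin: "linear Q ?F (ring_module Q) g'"
  proof (rule linear_onI)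
    fix x y assume x: "x \<in> carrier ?F" and y: "y \<in> carrier ?F"
    have "(p \<oplus> q) \<ominus> (p' \<oplus> q') = (p \<ominus> p') \<oplus> (q \<ominus> q')"
      if "p \<in> carrier Q" "q \<in> carrier Q" "p' \<in> carrier Q" "q' \<in> carrier Q" for p q p' q'
      using that by (simp add: ring_arith)
    then show "g' (x \<oplus>\<^bsub>?F\<^esub> y) = g' x \<oplus>\<^bsub>ring_module Q\<^esub> g' y"
      using x y Gc ec linear_onD(2)[OF Glin x y] linear_onD(2)[OF Glin ec[OF x] ec[OF y]]
        linear_onD(2)[OF e x y] by (simp add: g'_eq)
  next
    fix r x assume r: "r \<in> carrier Q" and x: "x \<in> carrier ?F"
    have "r \<otimes> p \<ominus> r \<otimes> q = r \<otimes> (p \<ominus> q)" if "p \<in> carrier Q" "q \<in> carrier Q" for p q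
      using that r by (simp add: ring_arith)
    then show "g' (r \<odot>\<^bsub>?F\<^esub> x) = r \<odot>\<^bsub>ring_module Q\<^esub> g' x"
      using r x Gc ec linear_onD(3)[OF Glin r x] linear_onD(3)[OF Glin r ec[OF x]]
        linear_onD(3)[OF e r x] by (simp add: g'_eq)
  qed (use g'c in simp)
  define t where "t i = g' (Q.unit_vec k i)" for i
  have tc: "t i \<in> carrier Q" for i using g'c[OF Q.unit_vec_closed] by (simp add: t_def)
  have g'_sum: "g' y = (\<Oplus>i\<in>{..<k}. y i \<otimes> t i)" if "y \<in> carrier ?F" for y
    using Q.linear_expand[OF Qm g'lin that] by (simp add: t_def)
  obtain s where s: "s \<in> {..<k} \<rightarrow> carrier Q" and sR: "\<And>i j. i < k \<Longrightarrow> j < k \<Longrightarrow> s i \<otimes> t j \<in> Rbar"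
    and s1: "\<And>j. j < k \<Longrightarrow> (\<Oplus>i\<in>{..<k}. s i \<otimes> t i) \<otimes> t j = t j"
    using unimodular_column[of t k] tc by blast
  define v where "v = restrict s {..<k}"
  have v: "v \<in> carrier ?F" unfolding v_def using s by (intro Q.free_restrict) auto
  have g'v: "g' v = (\<Oplus>i\<in>{..<k}. s i \<otimes> t i)"
    unfolding g'_sum[OF v] using s tc by (intro Q.finsum_cong') (auto simp: v_def)
  have g'v1: "g' y \<otimes> g' v = g' y" if y: "y \<in> carrier ?F" for y
  proof -
    have "g' y \<otimes> g' v = (\<Oplus>i\<in>{..<k}. y i \<otimes> t i \<otimes> g' v)"
      unfolding g'_sum[OF y] using Q.free_closed[OF y] tc g'c[OF v] by (intro Q.finsum_ldistr) auto
    also have "\<dots> = (\<Oplus>i\<in>{..<k}. y i \<otimes> t i)"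
    proof (intro Q.finsum_cong')
      fix i assume i: "i \<in> {..<k}"
      have "y i \<otimes> t i \<otimes> g' v = y i \<otimes> (g' v \<otimes> t i)"
        using Q.free_closed[OF y] tc g'c[OF v] i by (simp add: Q.m_ac)
      then show "y i \<otimes> t i \<otimes> g' v = y i \<otimes> t i" using s1[of i] i by (simp add: g'v)
    qed (use Q.free_closed[OF y] tc in auto)
    finally show ?thesis by (simp add: g'_sum[OF y])
  qed
  \<comment> \<open>\<open>w\<close> is killed by the old functionals, because \<open>e\<close>
    preserves their values, and \<open>g n w = g' v\<close> acts as identity on the values of
    \<open>g'\<close>. Adding \<open>g' y w\<close> to \<open>e y\<close> therefore corrects the
    value of \<open>g n\<close> and no other.\<close>
  define w where "w = v \<ominus>\<^bsub>?F\<^esub> e v"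
  have w: "w \<in> carrier ?F" unfolding w_def using v ec[OF v] by simp
  define e' where "e' y = e y \<oplus>\<^bsub>?F\<^esub> g' y \<odot>\<^bsub>?F\<^esub> w" for y
  have gw: "g' y \<odot>\<^bsub>?F\<^esub> w \<in> carrier ?F" if "y \<in> carrier ?F" for y using g'c[OF that] w by simp
  have "linear Q ?F ?F e'"
  proof (rule linear_onI)
    fix x y assume x: "x \<in> carrier ?F" and y: "y \<in> carrier ?F"
    have "g' (x \<oplus>\<^bsub>?F\<^esub> y) \<odot>\<^bsub>?F\<^esub> w = g' x \<odot>\<^bsub>?F\<^esub> w \<oplus>\<^bsub>?F\<^esub> g' y \<odot>\<^bsub>?F\<^esub> w"
      using linear_onD(2)[OF g'lin x y] g'c x y w by (simp add: F.smult_l_distr)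
    then show "e' (x \<oplus>\<^bsub>?F\<^esub> y) = e' x \<oplus>\<^bsub>?F\<^esub> e' y"
      unfolding e'_def using linear_onD(2)[OF e x y] ec x y gw by (simp add: F.M.a_ac)
  next
    fix r x assume r: "r \<in> carrier Q" and x: "x \<in> carrier ?F"
    have "g' (r \<odot>\<^bsub>?F\<^esub> x) \<odot>\<^bsub>?F\<^esub> w = r \<odot>\<^bsub>?F\<^esub> (g' x \<odot>\<^bsub>?F\<^esub> w)"
      using linear_onD(3)[OF g'lin r x] g'c[OF x] r w by (simp add: F.smult_assoc1)
    then show "e' (r \<odot>\<^bsub>?F\<^esub> x) = r \<odot>\<^bsub>?F\<^esub> e' x"
      unfolding e'_def using linear_onD(3)[OF e r x] ec[OF x] r gw[OF x] by (simp add: F.smult_r_distr)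
  qed (use ec gw in \<open>simp add: e'_def\<close>)
  moreover have "e' y = \<zero>\<^bsub>?F\<^esub>" if y: "y \<in> carrier ?F" "\<forall>l<Suc n. g l y = \<zero>" for y
  proof -
    have "e y = \<zero>\<^bsub>?F\<^esub>" using eker[OF y(1)] y(2) by simp
    moreover have "g' y = \<zero>"
      unfolding g'_eq[OF y(1)] \<open>e y = _\<close>
      using y(2) linear_on_zero[OF Fm Qm Glin F.carrier_is_submodule] by simp
    ultimately show ?thesis using w by (simp add: e'_def)
  qed
  moreover have "g l (e' y) = g l y" if y: "y \<in> carrier ?F" and l: "l < Suc n" for y l
  proof -
    have gl: "linear Q ?F (ring_module Q) (g l)" using Suc.prems l by simp
    have glc: "g l z \<in> carrier Q" if "z \<in> carrier ?F" for z using linear_onD(1)[OF gl that] by simp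
    have 1: "g l (e' y) = g l (e y) \<oplus> g' y \<otimes> g l w"
      unfolding e'_def using linear_onD(2)[OF gl ec[OF y] gw[OF y]] linear_onD(3)[OF gl g'c[OF y] w] by simp
    show ?thesis
    proof (cases "l < n")
      case True
      have "g l w = \<zero>"
        unfolding w_def using linear_on_minus[OF Fm Qm gl F.carrier_is_submodule v ec[OF v]]
          eg[OF v True] glc[OF v] by simp
      then show ?thesis using 1 eg[OF y True] glc[OF y] g'c[OF y] by simp
    next
      case False
      then have ln: "l = n" using l by simp
      have "g l w = g' v" unfolding ln g'_def w_def ..
      then have "g l (e' y) = g n (e y) \<oplus> g' y" using 1 g'v1[OF y] ln by simp
      also have "\<dots> = g n y"
      proof -
        have "p \<oplus> (q \<ominus> p) = q" if "p \<in> carrier Q" "q \<in> carrier Q" for p q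
          using that by (simp add: ring_arith)
        then show ?thesis unfolding g'_eq[OF y] using Gc[OF y] Gc[OF ec[OF y]] by simp
      qed
      finally show ?thesis using ln by simp
    qed
  qed
  moreover have "e' y i \<in> Rbar"
    if y: "y \<in> carrier ?F" and yR: "\<forall>i<k. y i \<in> Rbar" and i: "i < k" for y i
  proof -
    \<comment> \<open>Neither \<open>g' y\<close> nor \<open>v\<close> need be integral, but the
      entries of their product are sums of terms \<open>y j (s i t j)\<close>. As \<open>e\<close>
      preserves integrality, \<open>g' y w = x - e x\<close> is integral too.\<close>
    define x where "x = g' y \<odot>\<^bsub>?F\<^esub> v"
    have x: "x \<in> carrier ?F" unfolding x_def using g'c[OF y] v by simp
    have xR: "\<forall>i<k. x i \<in> Rbar"
    proof (intro allI impI)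
      fix i assume i: "i < k"
      have sc: "s i \<in> carrier Q" using s i by auto
      have "x i = (\<Oplus>j\<in>{..<k}. y j \<otimes> t j) \<otimes> s i"
        using i by (simp add: x_def Q.free_smult v_def g'_sum[OF y])
      also have "\<dots> = (\<Oplus>j\<in>{..<k}. y j \<otimes> t j \<otimes> s i)"
        using Q.free_closed[OF y] tc sc by (intro Q.finsum_ldistr) auto
      also have "\<dots> = (\<Oplus>j\<in>{..<k}. y j \<otimes> (s i \<otimes> t j))"
        using Q.free_closed[OF y] tc sc by (intro Q.finsum_cong') (auto simp: Q.m_ac)
      also have "\<dots> \<in> Rbar" using yR sR[OF i] by (intro Rbar_finsum) (auto intro: Rbar_mult)
      finally show "x i \<in> Rbar" .
    qed
    have "g' y \<odot>\<^bsub>?F\<^esub> w = x \<ominus>\<^bsub>?F\<^esub> e x"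
      unfolding w_def x_def using linear_onD(3)[OF e g'c[OF y] v] g'c[OF y] v ec[OF v]
      by (simp add: a_minus_def F.smult_r_distr F.smult_r_minus)
    then have "g' y \<odot>\<^bsub>?F\<^esub> w = x \<oplus>\<^bsub>?F\<^esub> (\<ominus> \<one>) \<odot>\<^bsub>?F\<^esub> e x"
      using ec[OF x] by (simp add: a_minus_def F.smult_l_minus)
    then have "e' y i = e y i \<oplus> (x i \<oplus> (\<ominus> \<one>) \<otimes> e x i)"
      using i by (simp add: e'_def Q.free_add Q.free_smult)
    then show ?thesis
      using eR[OF y yR i] eR[OF x xR i] xR i Rbar_one by (simp add: Rbar_add Rbar_mult Rbar_uminus)
  qed
  ultimately show ?case by (intro exI[of _ e'] conjI ballI impI allI)
qed

text \<open>The map \<open>h\<close> is \<open>c e\<close> on \<open>R^k\<close>, where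
  \<open>e\<close> is the integral projection for the coordinates of \<open>\<phi>\<close> extended
  to \<open>Q\<close>: vectors over \<open>R\<close> have integral image under \<open>e\<close>, and
  the conductor element \<open>c\<close> brings it back into \<open>R^k\<close>. Multiplication by
  \<open>c\<close> on the image of \<open>\<phi>\<close> thus factors through a free module.\<close>

lemma conductor_homotopy:
  assumes c: "c \<in> carrier R" and cond: "\<And>q. q \<in> Rbar \<Longrightarrow> \<iota> c \<otimes> q \<in> A"
    and \<phi>: "linear R (free_module R k) (free_module R n) \<phi>"
  shows "\<exists>h. linear R (free_module R k) (free_module R k) h \<and>
    (\<forall>x\<in>carrier (free_module R k). \<phi> (h x) = c \<odot>\<^bsub>free_module R n\<^esub> \<phi> x) \<and>
    (\<forall>x\<in>carrier (free_module R k). \<phi> x = \<zero>\<^bsub>free_module R n\<^esub> \<longrightarrow> h x = \<zero>\<^bsub>free_module R k\<^esub>)"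
proof -
  let ?F = "free_module R k" and ?G = "free_module R n" and ?E = "free_module Q k"
  interpret E: module Q ?E by (rule Q.free_module_module)
  interpret F: module R ?F by (rule R.free_module_module)
  define emb where "emb x = (\<lambda>i\<in>{..<k}. \<iota> (x i))" for x
  have emb: "emb x \<in> carrier ?E" if "x \<in> carrier ?F" for x
    unfolding emb_def using R.free_closed[OF that] by (intro Q.free_restrict) auto
  have emb_inj: "x = y" if x: "x \<in> carrier ?F" and y: "y \<in> carrier ?F" and eq: "emb x = emb y" for x y
  proof (rule R.free_eqI[OF x y])
    fix i assume i: "i < k"
    have "emb x i = emb y i" using eq by simp
    then show "x i = y i"
      using i R.free_closed[OF x i] R.free_closed[OF y i] by (simp add: emb_def \<iota>_eq_iff)
  qed
  note \<phi>c = linear_onD(1)[OF \<phi>]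
  have coef: "\<phi> (R.unit_vec k i) l \<in> carrier R" if "l < n" for i l
    using R.free_closed[OF \<phi>c[OF R.unit_vec_closed] that] .
  define g where "g l y = (\<Oplus>i\<in>{..<k}. y i \<otimes> \<iota> (\<phi> (R.unit_vec k i) l))" for l y
  have glin: "linear Q ?E (ring_module Q) (g l)" if "l < n" for l
    using Q.linear_combination[OF Q.ring_module_module, of k "\<lambda>i. \<iota> (\<phi> (R.unit_vec k i) l)"] coef[OF that]
    unfolding g_def[abs_def] by simp
  have gemb: "g l (emb x) = \<iota> (\<phi> x l)" if x: "x \<in> carrier ?F" and l: "l < n" for x l
  proof -
    have "linear R ?F (ring_module R) (\<lambda>x. \<phi> x l)"
      by (rule R.linear_compose[OF \<phi> R.linear_coordinate[OF l]]) (rule \<phi>c)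
    from R.linear_expand[OF R.ring_module_module this x]
    have "\<phi> x l = (\<Oplus>\<^bsub>R\<^esub>i\<in>{..<k}. x i \<otimes>\<^bsub>R\<^esub> \<phi> (R.unit_vec k i) l)" by simp
    then have "\<iota> (\<phi> x l) = (\<Oplus>i\<in>{..<k}. \<iota> (x i \<otimes>\<^bsub>R\<^esub> \<phi> (R.unit_vec k i) l))"
      using R.free_closed[OF x] coef[OF l] by (simp add: \<iota>.hom_finsum Pi_iff o_def)
    also have "\<dots> = g l (emb x)"
      unfolding g_def using R.free_closed[OF x] coef[OF l] by (intro Q.finsum_cong') (auto simp: emb_def)
    finally show ?thesis ..
  qed
  obtain e where E: "linear Q ?E ?E e \<and>
    (\<forall>y\<in>carrier ?E. (\<forall>l<n. g l y = \<zero>) \<longrightarrow> e y = \<zero>\<^bsub>?E\<^esub>) \<and>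
    (\<forall>y\<in>carrier ?E. \<forall>l<n. g l (e y) = g l y) \<and>
    (\<forall>y\<in>carrier ?E. (\<forall>i<k. y i \<in> Rbar) \<longrightarrow> (\<forall>i<k. e y i \<in> Rbar))"
    using integral_projection[OF glin] by (rule exE)
  have e: "linear Q ?E ?E e" using E by (rule conjunct1)
  have eker: "e y = \<zero>\<^bsub>?E\<^esub>" if "y \<in> carrier ?E" "\<forall>l<n. g l y = \<zero>" for y
    using bspec[OF E[THEN conjunct2, THEN conjunct1] that(1)] that(2) by simp
  have eg: "g l (e y) = g l y" if "y \<in> carrier ?E" "l < n" for y l
    using bspec[OF E[THEN conjunct2, THEN conjunct2, THEN conjunct1] that(1)] that(2) by simp
  have eR: "e y i \<in> Rbar" if "y \<in> carrier ?E" "\<forall>i<k. y i \<in> Rbar" "i < k" for y i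
    using bspec[OF E[THEN conjunct2, THEN conjunct2, THEN conjunct2] that(1)] that(2,3) by simp
  note ec = linear_onD(1)[OF e]
  define h where "h x = (\<lambda>i\<in>{..<k}. inv_into (carrier R) \<iota> (\<iota> c \<otimes> e (emb x) i))" for x
  have mem: "\<iota> c \<otimes> e (emb x) i \<in> A" if x: "x \<in> carrier ?F" and i: "i < k" for x i
    using cond eR[OF emb[OF x] _ i] A_subset_Rbar R.free_closed[OF x] by (simp add: emb_def)
  have hc: "h x \<in> carrier ?F" if x: "x \<in> carrier ?F" for x
    unfolding h_def using mem[OF x] by (intro R.free_restrict inv_into_into)
  have emb_h: "emb (h x) = \<iota> c \<odot>\<^bsub>?E\<^esub> e (emb x)" if x: "x \<in> carrier ?F" for x
  proof (rule Q.free_eqI[OF emb[OF hc[OF x]]])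
    show "\<iota> c \<odot>\<^bsub>?E\<^esub> e (emb x) \<in> carrier ?E" using c ec[OF emb[OF x]] by simp
    fix i assume i: "i < k"
    then show "emb (h x) i = (\<iota> c \<odot>\<^bsub>?E\<^esub> e (emb x)) i"
      using f_inv_into_f[OF mem[OF x i]] by (simp add: emb_def h_def Q.free_smult)
  qed
  have emb_add: "emb (x \<oplus>\<^bsub>?F\<^esub> y) = emb x \<oplus>\<^bsub>?E\<^esub> emb y" if "x \<in> carrier ?F" "y \<in> carrier ?F" for x y
    using R.free_closed[OF that(1)] R.free_closed[OF that(2)]
    by (auto simp: emb_def R.free_add Q.free_add intro!: restrict_ext)
  have emb_smult: "emb (r \<odot>\<^bsub>?F\<^esub> x) = \<iota> r \<odot>\<^bsub>?E\<^esub> emb x" if "r \<in> carrier R" "x \<in> carrier ?F" for r x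
    using R.free_closed[OF that(2)] that(1)
    by (auto simp: emb_def R.free_smult Q.free_smult intro!: restrict_ext)
  have "linear R ?F ?F h"
  proof (rule linear_onI)
    fix x y assume x: "x \<in> carrier ?F" and y: "y \<in> carrier ?F"
    show "h (x \<oplus>\<^bsub>?F\<^esub> y) = h x \<oplus>\<^bsub>?F\<^esub> h y"
    proof (rule emb_inj)
      show "emb (h (x \<oplus>\<^bsub>?F\<^esub> y)) = emb (h x \<oplus>\<^bsub>?F\<^esub> h y)"
        using x y hc c emb ec
        by (simp add: emb_h emb_add linear_onD(2)[OF e] E.smult_r_distr)
    qed (use x y hc in auto)
  next
    fix r x assume r: "r \<in> carrier R" and x: "x \<in> carrier ?F"
    show "h (r \<odot>\<^bsub>?F\<^esub> x) = r \<odot>\<^bsub>?F\<^esub> h x"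
    proof (rule emb_inj)
      have "\<iota> c \<odot>\<^bsub>?E\<^esub> (\<iota> r \<odot>\<^bsub>?E\<^esub> z) = \<iota> r \<odot>\<^bsub>?E\<^esub> (\<iota> c \<odot>\<^bsub>?E\<^esub> z)" if "z \<in> carrier ?E" for z
        using that r c by (simp add: Q.m_comm flip: E.smult_assoc1)
      then show "emb (h (r \<odot>\<^bsub>?F\<^esub> x)) = emb (r \<odot>\<^bsub>?F\<^esub> h x)"
        using r x hc c emb ec
        by (simp add: emb_h emb_smult linear_onD(3)[OF e])
    qed (use r x hc in auto)
  qed (rule hc)
  moreover have "\<phi> (h x) = c \<odot>\<^bsub>?G\<^esub> \<phi> x" if x: "x \<in> carrier ?F" for x
  proof (rule R.free_eqI[OF \<phi>c[OF hc[OF x]]])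
    interpret G: module R ?G by (rule R.free_module_module)
    show "c \<odot>\<^bsub>?G\<^esub> \<phi> x \<in> carrier ?G" using c \<phi>c[OF x] by simp
    fix l assume l: "l < n"
    note el = ec[OF emb[OF x]]
    have "\<iota> (\<phi> (h x) l) = \<iota> c \<otimes> g l (e (emb x))"
      using gemb[OF hc[OF x] l] emb_h[OF x] linear_onD(3)[OF glin[OF l] _ el, of "\<iota> c"] c by simp
    also have "\<dots> = \<iota> (c \<otimes>\<^bsub>R\<^esub> \<phi> x l)"
      using eg[OF emb[OF x] l] gemb[OF x l] c R.free_closed[OF \<phi>c[OF x] l] by simp
    finally show "\<phi> (h x) l = (c \<odot>\<^bsub>?G\<^esub> \<phi> x) l"
      using c R.free_closed[OF \<phi>c[OF x] l] R.free_closed[OF \<phi>c[OF hc[OF x]] l] l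
      by (simp add: R.free_smult \<iota>_eq_iff del: \<iota>.hom_mult)
  qed
  moreover have "h x = \<zero>\<^bsub>?F\<^esub>" if x: "x \<in> carrier ?F" and z: "\<phi> x = \<zero>\<^bsub>?G\<^esub>" for x
  proof (rule emb_inj[OF hc[OF x]])
    have "e (emb x) = \<zero>\<^bsub>?E\<^esub>"
      by (rule eker[OF emb[OF x]]) (simp add: gemb[OF x] z R.free_zero)
    then have "emb (h x) = \<zero>\<^bsub>?E\<^esub>" using emb_h[OF x] c by simp
    also have "\<dots> = emb \<zero>\<^bsub>?F\<^esub>" by (auto simp: emb_def R.free_zero Q.free_zero intro!: restrict_ext)
    finally show "emb (h x) = emb \<zero>\<^bsub>?F\<^esub>" .
  qed auto
  ultimately show ?thesis by blast
qed

end

section \<open>Free resolutions and Ext\<close>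

lemma (in module) submodule_finsum:
  assumes S: "submodule S R M" and "finite I" "\<And>i. i \<in> I \<Longrightarrow> f i \<in> S"
  shows "(\<Oplus>\<^bsub>M\<^esub>i\<in>I. f i) \<in> S"
  using assms(2,3)
proof (induction I rule: finite_induct)
  case empty
  then show ?case using submodule_zero[OF S] by simp
next
  case (insert i I)
  have "(\<Oplus>\<^bsub>M\<^esub>j\<in>insert i I. f j) = f i \<oplus>\<^bsub>M\<^esub> (\<Oplus>\<^bsub>M\<^esub>j\<in>I. f j)"
    using insert submoduleE(1)[OF S] by (intro M.finsum_insert) auto
  then show ?case using insert submoduleE(5)[OF S] by simp
qed

lemma (in module) submodule_Int:
  assumes "submodule S R M" "submodule T R M" shows "submodule (S \<inter> T) R M"
  by (rule submodule_intro)
    (use submoduleE[OF assms(1)] submoduleE[OF assms(2)] submodule_zero[OF assms(1)]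
      submodule_zero[OF assms(2)] in auto)

lemma (in cring) linear_combination_unit:
  assumes N: "module R N" and z: "\<And>i. i < n \<Longrightarrow> z i \<in> carrier N" and j: "j < n"
  shows "(\<Oplus>\<^bsub>N\<^esub>i\<in>{..<n}. unit_vec n j i \<odot>\<^bsub>N\<^esub> z i) = z j"
proof -
  interpret N: module R N by fact
  have "(\<Oplus>\<^bsub>N\<^esub>i\<in>{..<n}. unit_vec n j i \<odot>\<^bsub>N\<^esub> z i) = (\<Oplus>\<^bsub>N\<^esub>i\<in>{..<n}. if j = i then z i else \<zero>\<^bsub>N\<^esub>)"
    using z by (intro N.M.finsum_cong') (auto simp: unit_vec_def)
  also have "\<dots> = z j" using z j by (intro N.M.finsum_singleton) auto
  finally show ?thesis .
qed

context noetherian_cring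
begin

text \<open>Induction on the number of coordinates in use. The coordinates at \<open>k\<close> of
  elements of \<open>S\<close> form a finitely generated ideal; lifts \<open>G1\<close> of its
  generators, together with generators \<open>G0\<close> of the part with vanishing coordinate
  \<open>k\<close>, generate \<open>S\<close>. Generation is expressed by the minimality of
  \<open>S\<close> among submodules containing \<open>G\<close>.\<close>

lemma free_submodule_generated_aux:
  assumes S: "submodule S R (free_module R n)" and "\<forall>x\<in>S. \<forall>i<n. k \<le> i \<longrightarrow> x i = \<zero>"
  shows "\<exists>G. finite G \<and> G \<subseteq> S \<and> (\<forall>T. submodule T R (free_module R n) \<and> G \<subseteq> T \<longrightarrow> S \<subseteq> T)"
  using assms
proof (induction k arbitrary: S)
  let ?F = "free_module R n"
  interpret F: module R ?F by (rule free_module_module)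
  case 0
  have "x = \<zero>\<^bsub>?F\<^esub>" if x: "x \<in> S" for x
    using F.submoduleE(1)[OF 0(1)] 0(2) x by (intro free_eqI[of x n]) (auto simp: free_zero intro: free_restrict)
  then have "S \<subseteq> T" if "submodule T R ?F" for T
    using F.submodule_zero[OF that] by auto
  then show ?case by (intro exI[of _ "{}"]) auto
  next
  case (Suc k)
  let ?F = "free_module R n"
  interpret F: module R ?F by (rule free_module_module)
  show ?case
  proof (cases "k < n")
    case False
    then show ?thesis using Suc.prems by (intro Suc.IH) auto
  next
    case k: True
    have lin: "linear_on R ?F T (ring_module R) (\<lambda>x. x k)" if "submodule T R ?F" for T
      by (rule linear_on_subset[OF linear_coordinate[OF k] F.submoduleE(1)[OF that]])
    have img: "ideal ((\<lambda>x. x k) ` T) R" if T: "submodule T R ?F" for T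
      by (rule submodule_ideal[OF linear_on_image[OF free_module_module ring_module_module lin[OF T] T]])
    obtain B where B: "B \<subseteq> carrier R" "finite B" "(\<lambda>x. x k) ` S = Idl B"
      using finetely_gen[OF img[OF Suc.prems(1)]] by blast
    have "B \<subseteq> (\<lambda>x. x k) ` S" using genideal_self[OF B(1)] B(3) by simp
    then obtain G1 where G1: "G1 \<subseteq> S" "finite G1" "B = (\<lambda>x. x k) ` G1"
      using finite_subset_image[OF B(2)] by metis
    define S0 where "S0 = {x \<in> S. x k = \<zero>}"
    have S0: "submodule S0 R ?F"
      unfolding S0_def
      using linear_on_kernel[OF free_module_module ring_module_module lin[OF Suc.prems(1)] Suc.prems(1)] by simp
    have "\<forall>x\<in>S0. \<forall>i<n. k \<le> i \<longrightarrow> x i = \<zero>"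
      using Suc.prems(2) by (auto simp: S0_def Suc_le_eq dest: le_imp_less_or_eq)
    from Suc.IH[OF S0 this] obtain G0 where "finite G0 \<and> G0 \<subseteq> S0 \<and>
      (\<forall>T. submodule T R ?F \<and> G0 \<subseteq> T \<longrightarrow> S0 \<subseteq> T)" by (rule exE)
    then have G0: "finite G0" "G0 \<subseteq> S0"
      "\<And>T. submodule T R ?F \<Longrightarrow> G0 \<subseteq> T \<Longrightarrow> S0 \<subseteq> T" by simp_all
    have "S \<subseteq> T" if T: "submodule T R ?F" and G: "G0 \<union> G1 \<subseteq> T" for T
    proof
      fix x assume x: "x \<in> S"
      \<comment> \<open>Intersecting with \<open>S\<close> ensures that the element \<open>y\<close>
        of \<open>T\<close> with the same coordinate as \<open>x\<close> lies in \<open>S\<close>,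
        so that \<open>x - y\<close> falls under the induction hypothesis.\<close>
      have ST: "submodule (S \<inter> T) R ?F" by (rule F.submodule_Int[OF Suc.prems(1) T])
      have "B \<subseteq> (\<lambda>x. x k) ` (S \<inter> T)" using G1 G by auto
      then have "Idl B \<subseteq> (\<lambda>x. x k) ` (S \<inter> T)" by (rule genideal_minimal[OF img[OF ST]])
      then have "x k \<in> (\<lambda>x. x k) ` (S \<inter> T)" using B(3) x by blast
      then obtain y where y: "y \<in> S" "y \<in> T" "x k = y k" by blast
      define z where "z = x \<ominus>\<^bsub>?F\<^esub> y"
      have zS: "z \<in> S" unfolding z_def by (rule F.submodule_minus[OF Suc.prems(1) x y(1)])
      have xy: "x \<in> carrier ?F" "y \<in> carrier ?F" using F.submoduleE(1)[OF Suc.prems(1)] x y(1) by auto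
      have "z k = x k \<ominus> y k"
        using linear_on_minus[OF free_module_module ring_module_module lin[OF Suc.prems(1)] Suc.prems(1) x y(1)]
        by (simp add: z_def)
      then have "z \<in> S0" unfolding S0_def using zS y(3) free_closed[OF xy(2) k] by simp
      then have "z \<in> T" using G0(3)[OF T] G by blast
      then have "z \<oplus>\<^bsub>?F\<^esub> y \<in> T" using F.submoduleE(5)[OF T] y(2) by blast
      moreover have "z \<oplus>\<^bsub>?F\<^esub> y = x"
        unfolding z_def a_minus_def using xy by (simp add: F.M.a_assoc F.M.l_neg)
      ultimately show "x \<in> T" by simp
    qed
    then show ?thesis
      using G0(1,2) G1(1,2) by (intro exI[of _ "G0 \<union> G1"]) (auto simp: S0_def)
  qed
qed

lemma free_submodule_image:
  assumes S: "submodule S R (free_module R n)"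
  shows "\<exists>m. \<exists>\<phi>\<in>mod_hom R (free_module R m) (free_module R n). \<phi> ` carrier (free_module R m) = S"
proof -
  let ?F = "free_module R n"
  interpret F: module R ?F by (rule free_module_module)
  have "\<forall>x\<in>S. \<forall>i<n. n \<le> i \<longrightarrow> x i = \<zero>" by auto
  from free_submodule_generated_aux[OF S this] obtain G where "finite G \<and> G \<subseteq> S \<and>
    (\<forall>T. submodule T R ?F \<and> G \<subseteq> T \<longrightarrow> S \<subseteq> T)" by (rule exE)
  then have G: "finite G" "G \<subseteq> S"
    and gen: "\<And>T. submodule T R ?F \<Longrightarrow> G \<subseteq> T \<Longrightarrow> S \<subseteq> T" by simp_all
  obtain m and g :: "nat \<Rightarrow> nat \<Rightarrow> 'a" where g: "G = g ` {..<m}"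
    using G(1) by (metis finite_imp_nat_seg_image_inj_on lessThan_def)
  have gS: "g i \<in> S" if "i < m" for i using G(2) g that by auto
  have gc: "g i \<in> carrier ?F" if "i < m" for i using F.submoduleE(1)[OF S] gS[OF that] by auto
  interpret E: module R "free_module R m" by (rule free_module_module)
  define \<phi> where "\<phi> x = (\<Oplus>\<^bsub>?F\<^esub>i\<in>{..<m}. x i \<odot>\<^bsub>?F\<^esub> g i)" for x
  have lin: "linear R (free_module R m) ?F \<phi>"
    unfolding \<phi>_def[abs_def] by (rule linear_combination[OF free_module_module gc])
  have img: "submodule (\<phi> ` carrier (free_module R m)) R ?F"
    by (rule linear_on_image[OF free_module_module free_module_module lin E.carrier_is_submodule])
  have "G \<subseteq> \<phi> ` carrier (free_module R m)"
  proof
    fix x assume "x \<in> G"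
    then obtain j where j: "j < m" "x = g j" using g by auto
    have "\<phi> (unit_vec m j) = x"
      unfolding \<phi>_def j(2) by (rule linear_combination_unit[OF free_module_module gc j(1)])
    then show "x \<in> \<phi> ` carrier (free_module R m)" using unit_vec_closed by blast
  qed
  then have "S \<subseteq> \<phi> ` carrier (free_module R m)" by (rule gen[OF img])
  moreover have "\<phi> x \<in> S" if "x \<in> carrier (free_module R m)" for x
    unfolding \<phi>_def using gS free_closed[OF that] F.submoduleE(4)[OF S]
    by (intro F.submodule_finsum[OF S]) auto
  ultimately have "restrict \<phi> (carrier (free_module R m)) ` carrier (free_module R m) = S" by auto
  then show ?thesis using linear_mod_hom[OF free_module_module lin] by blast
qed

lemma kernel_submodule:
  assumes "module R M" "module R N" "f \<in> mod_hom R M N"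
  shows "submodule (a_kernel M N f) R M"
proof -
  interpret M: module R M by fact
  show ?thesis
    unfolding a_kernel_eq
    by (rule linear_on_kernel[OF assms(1,2) mod_hom_linear[OF assms(3)] M.carrier_is_submodule])
qed

lemma free_resolution_exists:
  assumes fg: "fin_gen_module R M"
  shows "\<exists>b d e. free_resolution R M b d e"
proof -
  have M: "module R M" using fg by (simp add: fin_gen_module_def)
  interpret M: module R M by fact
  obtain n g where g: "g \<in> {..<n::nat} \<rightarrow> carrier M"
    and gen: "\<And>x. x \<in> carrier M \<Longrightarrow> \<exists>c \<in> {..<n} \<rightarrow> carrier R. x = (\<Oplus>\<^bsub>M\<^esub>i\<in>{..<n}. c i \<odot>\<^bsub>M\<^esub> g i)"
    using fg unfolding fin_gen_module_def by blast
  let ?F = "\<lambda>n. free_module R n"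
  define e0 where "e0 x = (\<Oplus>\<^bsub>M\<^esub>i\<in>{..<n}. x i \<odot>\<^bsub>M\<^esub> g i)" for x
  define e where "e = restrict e0 (carrier (?F n))"
  have lin: "linear R (?F n) M e0"
    unfolding e0_def[abs_def] using g by (intro linear_combination[OF M]) auto
  have e: "e \<in> mod_hom R (?F n) M" unfolding e_def by (rule linear_mod_hom[OF free_module_module lin])
  have onto: "e ` carrier (?F n) = carrier M"
  proof
    show "e ` carrier (?F n) \<subseteq> carrier M" using linear_onD(1)[OF lin] by (auto simp: e_def)
    show "carrier M \<subseteq> e ` carrier (?F n)"
    proof
      fix x assume "x \<in> carrier M"
      then obtain c where c: "c \<in> {..<n} \<rightarrow> carrier R" "x = (\<Oplus>\<^bsub>M\<^esub>i\<in>{..<n}. c i \<odot>\<^bsub>M\<^esub> g i)"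
        using gen by blast
      have rc: "restrict c {..<n} \<in> carrier (?F n)" using c(1) by (intro free_restrict) auto
      have "e (restrict c {..<n}) = (\<Oplus>\<^bsub>M\<^esub>i\<in>{..<n}. restrict c {..<n} i \<odot>\<^bsub>M\<^esub> g i)"
        using rc by (simp add: e_def e0_def)
      also have "\<dots> = x"
        unfolding c(2) using c(1) g by (intro M.M.finsum_cong') auto
      finally have "e (restrict c {..<n}) = x" .
      then show "x \<in> e ` carrier (?F n)" using rc by blast
    qed
  qed
  obtain m \<phi>0 where \<phi>0: "\<phi>0 \<in> mod_hom R (?F m) (?F n)" "\<phi>0 ` carrier (?F m) = a_kernel (?F n) M e"
    using free_submodule_image[OF kernel_submodule[OF free_module_module M e]] by blast
  \<comment> \<open>A state \<open>(p, q, \<phi>)\<close> is a differential from \<open>R^q\<close>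
    to \<open>R^p\<close>. \<open>Q\<close> links it to the next one, whose target is
    \<open>R^q\<close> and whose image is the kernel of \<open>\<phi>\<close>; \<open>P\<close> also
    fixes the first state, which has to cover the kernel of the augmentation.\<close>
  define P where "P i x \<longleftrightarrow> snd (snd x) \<in> mod_hom R (?F (fst (snd x))) (?F (fst x)) \<and>
      (i = (0::nat) \<longrightarrow> x = (n, m, \<phi>0))" for i and x :: "nat \<times> nat \<times> ((nat \<Rightarrow> 'a) \<Rightarrow> (nat \<Rightarrow> 'a))"
  define Q where "Q (i::nat) x y \<longleftrightarrow> fst y = fst (snd x) \<and>
      snd (snd y) ` carrier (?F (fst (snd y))) = a_kernel (?F (fst (snd x))) (?F (fst x)) (snd (snd x))"
    for i and x y :: "nat \<times> nat \<times> ((nat \<Rightarrow> 'a) \<Rightarrow> (nat \<Rightarrow> 'a))"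
  have "\<exists>f. \<forall>i. P i (f i) \<and> Q i (f i) (f (Suc i))"
  proof (rule dependent_nat_choice)
    show "\<exists>x. P 0 x" using \<phi>0(1) by (auto simp: P_def)
    fix x i assume P: "P i x"
    obtain p q \<phi> where x: "x = (p, q, \<phi>)" by (cases x) auto
    have \<phi>: "\<phi> \<in> mod_hom R (?F q) (?F p)" using P by (simp add: P_def x)
    obtain m' \<phi>' where "\<phi>' \<in> mod_hom R (?F m') (?F q)" "\<phi>' ` carrier (?F m') = a_kernel (?F q) (?F p) \<phi>"
      using free_submodule_image[OF kernel_submodule[OF free_module_module free_module_module \<phi>]] by blast
    then show "\<exists>y. P (Suc i) y \<and> Q i x y"
      by (intro exI[of _ "(q, m', \<phi>')"]) (simp add: P_def Q_def x)
  qed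
  then obtain f where f: "\<And>i. P i (f i)" "\<And>i. Q i (f i) (f (Suc i))" by blast
  define b where "b i = fst (f i)" for i
  define d where "d i = snd (snd (f i))" for i
  have f0: "f 0 = (n, m, \<phi>0)" using f(1)[of 0] by (simp add: P_def)
  have bS: "fst (snd (f i)) = b (Suc i)" for i using f(2)[of i] by (simp add: Q_def b_def)
  have dh: "d i \<in> mod_hom R (?F (b (Suc i))) (?F (b i))" for i
    using f(1)[of i] by (simp add: P_def d_def bS[symmetric]) (simp add: b_def)
  have dk: "d (Suc i) ` carrier (?F (b (Suc (Suc i)))) = a_kernel (?F (b (Suc i))) (?F (b i)) (d i)" for i
    using f(2)[of i] by (simp add: Q_def bS) (simp add: b_def d_def)
  have b0: "b 0 = n" "b (Suc 0) = m" "d 0 = \<phi>0" using f0 bS[of 0] by (auto simp: b_def d_def)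
  have "free_resolution R M b d e"
    unfolding free_resolution_def Let_def using e onto \<phi>0 dh dk by (simp add: b0)
  then show ?thesis by blast
qed

lemma chosen_resolution_resolution:
  assumes "fin_gen_module R M"
  shows "\<exists>b d e. chosen_resolution R M = (b, d) \<and> free_resolution R M b d e"
proof -
  have "\<exists>x. (case x of (b, d) \<Rightarrow> \<exists>e. free_resolution R M b d e)"
    using free_resolution_exists[OF assms] by auto
  then have "case chosen_resolution R M of (b, d) \<Rightarrow> \<exists>e. free_resolution R M b d e"
    unfolding chosen_resolution_def by (rule someI_ex)
  then show ?thesis by (auto split: prod.splits)
qed

end

lemma mod_homD:
  assumes "f \<in> mod_hom R M N"
  shows "x \<in> carrier M \<Longrightarrow> f x \<in> carrier N" "f \<in> extensional (carrier M)"
    "x \<in> carrier M \<Longrightarrow> y \<in> carrier M \<Longrightarrow> f (x \<oplus>\<^bsub>M\<^esub> y) = f x \<oplus>\<^bsub>N\<^esub> f y"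
    "r \<in> carrier R \<Longrightarrow> x \<in> carrier M \<Longrightarrow> f (r \<odot>\<^bsub>M\<^esub> x) = r \<odot>\<^bsub>N\<^esub> f x"
  using assms by (auto simp: mod_hom_def PiE_def)

lemma hom_module_simps:
  "carrier (hom_module R M N) = mod_hom R M N"
  "\<zero>\<^bsub>hom_module R M N\<^esub> = (\<lambda>x\<in>carrier M. \<zero>\<^bsub>N\<^esub>)"
  "f \<oplus>\<^bsub>hom_module R M N\<^esub> g = (\<lambda>x\<in>carrier M. f x \<oplus>\<^bsub>N\<^esub> g x)"
  "r \<odot>\<^bsub>hom_module R M N\<^esub> f = (\<lambda>x\<in>carrier M. r \<odot>\<^bsub>N\<^esub> f x)"
  by (simp_all add: hom_module_def)

lemma hom_module_module:
  assumes M: "module R M" and N: "module R N" shows "module R (hom_module R M N)"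
proof -
  interpret M: module R M by fact
  interpret N: module R N by fact
  let ?H = "hom_module R M N"
  have mem: "restrict f (carrier M) \<in> mod_hom R M N" if "linear R M N f" for f
    by (rule linear_mod_hom[OF M that])
  note L = linear_onD[OF mod_hom_linear]
  have add: "(\<lambda>x\<in>carrier M. f x \<oplus>\<^bsub>N\<^esub> g x) \<in> mod_hom R M N" if "f \<in> mod_hom R M N" "g \<in> mod_hom R M N" for f g
    by (rule mem, rule linear_onI) (use L[OF that(1)] L[OF that(2)] in \<open>simp_all add: N.M.a_ac N.smult_r_distr\<close>)
  have zero: "(\<lambda>x\<in>carrier M. \<zero>\<^bsub>N\<^esub>) \<in> mod_hom R M N"
    by (rule mem, rule linear_onI) auto
  have smult: "(\<lambda>x\<in>carrier M. r \<odot>\<^bsub>N\<^esub> f x) \<in> mod_hom R M N" if "r \<in> carrier R" "f \<in> mod_hom R M N" for r f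
  proof (rule mem, rule linear_onI)
    show "r \<odot>\<^bsub>N\<^esub> f (s \<odot>\<^bsub>M\<^esub> x) = s \<odot>\<^bsub>N\<^esub> (r \<odot>\<^bsub>N\<^esub> f x)" if "s \<in> carrier R" "x \<in> carrier M" for s x
      using that L[OF \<open>f \<in> _\<close>] \<open>r \<in> _\<close> by (simp add: M.m_comm flip: N.smult_assoc1)
  qed (use that L[OF that(2)] in \<open>simp_all add: N.smult_r_distr\<close>)
  show ?thesis
  proof (rule moduleI)
    show "abelian_group ?H"
    proof (rule abelian_groupI)
      fix f assume f: "f \<in> carrier ?H"
      then have f': "f \<in> mod_hom R M N" by (simp add: hom_module_simps)
      show "\<zero>\<^bsub>?H\<^esub> \<oplus>\<^bsub>?H\<^esub> f = f"
        using L(1)[OF f'] mod_homD(2)[OF f'] by (auto simp: hom_module_simps intro!: extensionalityI[of _ "carrier M"])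
      show "\<exists>g\<in>carrier ?H. g \<oplus>\<^bsub>?H\<^esub> f = \<zero>\<^bsub>?H\<^esub>"
      proof (rule bexI[of _ "\<lambda>x\<in>carrier M. (\<ominus>\<^bsub>R\<^esub> \<one>\<^bsub>R\<^esub>) \<odot>\<^bsub>N\<^esub> f x"])
        show "(\<lambda>x\<in>carrier M. (\<ominus>\<^bsub>R\<^esub> \<one>\<^bsub>R\<^esub>) \<odot>\<^bsub>N\<^esub> f x) \<oplus>\<^bsub>?H\<^esub> f = \<zero>\<^bsub>?H\<^esub>"
          using L(1)[OF f'] by (auto simp: hom_module_simps N.smult_l_minus N.M.l_neg intro!: restrict_ext)
        show "(\<lambda>x\<in>carrier M. (\<ominus>\<^bsub>R\<^esub> \<one>\<^bsub>R\<^esub>) \<odot>\<^bsub>N\<^esub> f x) \<in> carrier ?H"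
          using smult[OF _ f'] by (simp add: hom_module_simps)
      qed
    next
      fix f g assume "f \<in> carrier ?H" "g \<in> carrier ?H"
      then have fg: "f \<in> mod_hom R M N" "g \<in> mod_hom R M N" by (auto simp: hom_module_simps)
      show "f \<oplus>\<^bsub>?H\<^esub> g \<in> carrier ?H" using add[OF fg] by (simp add: hom_module_simps)
      show "f \<oplus>\<^bsub>?H\<^esub> g = g \<oplus>\<^bsub>?H\<^esub> f"
        using L(1)[OF fg(1)] L(1)[OF fg(2)] by (auto simp: hom_module_simps N.M.a_comm intro!: restrict_ext)
    next
      fix f g h assume "f \<in> carrier ?H" "g \<in> carrier ?H" "h \<in> carrier ?H"
      then have fg: "f \<in> mod_hom R M N" "g \<in> mod_hom R M N" "h \<in> mod_hom R M N" by (auto simp: hom_module_simps)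
      show "(f \<oplus>\<^bsub>?H\<^esub> g) \<oplus>\<^bsub>?H\<^esub> h = f \<oplus>\<^bsub>?H\<^esub> (g \<oplus>\<^bsub>?H\<^esub> h)"
        using L(1)[OF fg(1)] L(1)[OF fg(2)] L(1)[OF fg(3)]
        by (auto simp: hom_module_simps N.M.a_assoc intro!: restrict_ext)
    qed (use zero in \<open>simp add: hom_module_simps\<close>)
  next
    fix a b f assume a: "a \<in> carrier R" and b: "b \<in> carrier R" and "f \<in> carrier ?H"
    then have f: "f \<in> mod_hom R M N" by (simp add: hom_module_simps)
    show "(a \<oplus>\<^bsub>R\<^esub> b) \<odot>\<^bsub>?H\<^esub> f = a \<odot>\<^bsub>?H\<^esub> f \<oplus>\<^bsub>?H\<^esub> b \<odot>\<^bsub>?H\<^esub> f"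
      using a b L(1)[OF f] by (auto simp: hom_module_simps N.smult_l_distr intro!: restrict_ext)
    show "(a \<otimes>\<^bsub>R\<^esub> b) \<odot>\<^bsub>?H\<^esub> f = a \<odot>\<^bsub>?H\<^esub> (b \<odot>\<^bsub>?H\<^esub> f)"
      using a b L(1)[OF f] by (auto simp: hom_module_simps N.smult_assoc1 intro!: restrict_ext)
  next
    fix a f g assume a: "a \<in> carrier R" and "f \<in> carrier ?H" "g \<in> carrier ?H"
    then have fg: "f \<in> mod_hom R M N" "g \<in> mod_hom R M N" by (auto simp: hom_module_simps)
    show "a \<odot>\<^bsub>?H\<^esub> (f \<oplus>\<^bsub>?H\<^esub> g) = a \<odot>\<^bsub>?H\<^esub> f \<oplus>\<^bsub>?H\<^esub> a \<odot>\<^bsub>?H\<^esub> g"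
      using a L(1)[OF fg(1)] L(1)[OF fg(2)] by (auto simp: hom_module_simps N.smult_r_distr intro!: restrict_ext)
  next
    fix f assume "f \<in> carrier ?H"
    then have f: "f \<in> mod_hom R M N" by (simp add: hom_module_simps)
    show "\<one>\<^bsub>R\<^esub> \<odot>\<^bsub>?H\<^esub> f = f"
      using L(1)[OF f] mod_homD(2)[OF f] by (auto simp: hom_module_simps intro!: extensionalityI[of _ "carrier M"])
  qed (use smult in \<open>auto simp: hom_module_simps M.cring_axioms\<close>)
qed

text \<open>This reads off when the scalar action of \<open>quotient_module\<close>, a union over a
  coset, gives the zero class.\<close>

lemma (in module) scaled_coset_eq_iff:
  assumes S: "submodule S R M" and x: "x \<in> carrier M" and r: "r \<in> carrier R"
  shows "(\<Union>y \<in> S +>\<^bsub>M\<^esub> x. S +>\<^bsub>M\<^esub> (r \<odot>\<^bsub>M\<^esub> y)) = S \<longleftrightarrow> r \<odot>\<^bsub>M\<^esub> x \<in> S"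
proof -
  have mem: "z \<in> (\<Union>y \<in> S +>\<^bsub>M\<^esub> x. S +>\<^bsub>M\<^esub> (r \<odot>\<^bsub>M\<^esub> y)) \<longleftrightarrow>
    (\<exists>h\<in>S. \<exists>k\<in>S. z = k \<oplus>\<^bsub>M\<^esub> r \<odot>\<^bsub>M\<^esub> (h \<oplus>\<^bsub>M\<^esub> x))" for z
    by (auto simp: a_r_coset_def')
  have Sc: "s \<in> carrier M" if "s \<in> S" for s using submoduleE(1)[OF S] that by blast
  have rx: "r \<odot>\<^bsub>M\<^esub> x \<in> carrier M" using r x by simp
  show ?thesis
  proof
    assume eq: "(\<Union>y \<in> S +>\<^bsub>M\<^esub> x. S +>\<^bsub>M\<^esub> (r \<odot>\<^bsub>M\<^esub> y)) = S"
    have "r \<odot>\<^bsub>M\<^esub> x = \<zero>\<^bsub>M\<^esub> \<oplus>\<^bsub>M\<^esub> r \<odot>\<^bsub>M\<^esub> (\<zero>\<^bsub>M\<^esub> \<oplus>\<^bsub>M\<^esub> x)" using r x by simp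
    then show "r \<odot>\<^bsub>M\<^esub> x \<in> S" using mem submodule_zero[OF S] eq by blast
  next
    assume rS: "r \<odot>\<^bsub>M\<^esub> x \<in> S"
    show "(\<Union>y \<in> S +>\<^bsub>M\<^esub> x. S +>\<^bsub>M\<^esub> (r \<odot>\<^bsub>M\<^esub> y)) = S"
    proof
      show "(\<Union>y \<in> S +>\<^bsub>M\<^esub> x. S +>\<^bsub>M\<^esub> (r \<odot>\<^bsub>M\<^esub> y)) \<subseteq> S"
      proof
        fix z assume "z \<in> (\<Union>y \<in> S +>\<^bsub>M\<^esub> x. S +>\<^bsub>M\<^esub> (r \<odot>\<^bsub>M\<^esub> y))"
        then obtain h k where hk: "h \<in> S" "k \<in> S" "z = k \<oplus>\<^bsub>M\<^esub> r \<odot>\<^bsub>M\<^esub> (h \<oplus>\<^bsub>M\<^esub> x)" using mem by blast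
        have "z = k \<oplus>\<^bsub>M\<^esub> (r \<odot>\<^bsub>M\<^esub> h \<oplus>\<^bsub>M\<^esub> r \<odot>\<^bsub>M\<^esub> x)"
          using hk Sc r x by (simp add: smult_r_distr)
        then show "z \<in> S" using hk submoduleE(4,5)[OF S] r rS by simp
      qed
      show "S \<subseteq> (\<Union>y \<in> S +>\<^bsub>M\<^esub> x. S +>\<^bsub>M\<^esub> (r \<odot>\<^bsub>M\<^esub> y))"
      proof
        fix z assume z: "z \<in> S"
        have "z = (z \<ominus>\<^bsub>M\<^esub> r \<odot>\<^bsub>M\<^esub> x) \<oplus>\<^bsub>M\<^esub> r \<odot>\<^bsub>M\<^esub> (\<zero>\<^bsub>M\<^esub> \<oplus>\<^bsub>M\<^esub> x)"
          using Sc[OF z] rx x by (simp add: a_minus_def M.a_assoc M.l_neg)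
        then show "z \<in> (\<Union>y \<in> S +>\<^bsub>M\<^esub> x. S +>\<^bsub>M\<^esub> (r \<odot>\<^bsub>M\<^esub> y))"
          using mem submodule_minus[OF S z rS] submodule_zero[OF S] by blast
      qed
    qed
  qed
qed

context cring
begin

lemma coboundaries_submodule:
  assumes N: "module R N" and d_all: "\<forall>i. d i \<in> mod_hom R (free_module R (b (Suc i))) (free_module R (b i))"
  shows "submodule (coboundaries R b d N n) R (hom_module R (free_module R (b n)) N)"
proof -
  note d = d_all[rule_format]
  let ?H = "\<lambda>n. hom_module R (free_module R (b n)) N"
  interpret N: module R N by fact
  have H: "module R (?H j)" for j by (rule hom_module_module[OF free_module_module N])
  show ?thesis
  proof (cases n)
    case 0
    interpret H: module R "?H 0" by (rule H)
    have "submodule {\<zero>\<^bsub>?H 0\<^esub>} R (?H 0)" by (rule H.submodule_intro) auto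
    then show ?thesis using \<open>n = 0\<close> by simp
  next
    case (Suc k)
    define \<psi> where "\<psi> f = (\<lambda>x\<in>carrier (free_module R (b (Suc k))). f (d k x))" for f :: "(nat \<Rightarrow> 'a) \<Rightarrow> 'c"
    interpret H: module R "?H k" by (rule H)
    have dc: "d k x \<in> carrier (free_module R (b k))" if "x \<in> carrier (free_module R (b (Suc k)))" for x
      using mod_homD(1)[OF d that] .
    have "linear R (?H k) (?H (Suc k)) \<psi>"
    proof (rule linear_onI)
      fix f assume "f \<in> carrier (?H k)"
      then have f: "f \<in> mod_hom R (free_module R (b k)) N" by (simp add: hom_module_simps)
      have "linear R (free_module R (b (Suc k))) N (\<lambda>x. f (d k x))"
        by (rule linear_compose[OF mod_hom_linear[OF d] mod_hom_linear[OF f] dc])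
      then show "\<psi> f \<in> carrier (?H (Suc k))"
        unfolding \<psi>_def hom_module_simps by (rule linear_mod_hom[OF free_module_module])
    qed (auto simp: \<psi>_def hom_module_simps dc intro!: restrict_ext)
    from linear_on_image[OF H H this H.carrier_is_submodule]
    show ?thesis using \<open>n = Suc k\<close> by (simp add: \<psi>_def hom_module_simps)
  qed
qed

text \<open>The concrete form in which annihilation of Ext is both proved and used: on the chosen
  resolution, multiplication by \<open>r\<close> turns cocycles into coboundaries.\<close>

lemma ext_annihilated_iff:
  assumes N: "module R N" and r: "r \<in> carrier R"
    and chosen: "chosen_resolution R M = (b, d)" and res: "free_resolution R M b d e"
  shows "r \<in> mod_ann R (ext_module R n M N) \<longleftrightarrow>
    (\<forall>f \<in> cocycles R b d N n. (\<lambda>x\<in>carrier (free_module R (b n)). r \<odot>\<^bsub>N\<^esub> f x) \<in> coboundaries R b d N n)"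
proof -
  let ?H = "hom_module R (free_module R (b n)) N"
  let ?S = "coboundaries R b d N n"
  let ?C = "?H \<lparr>carrier := cocycles R b d N n\<rparr>"
  interpret H: module R ?H by (rule hom_module_module[OF free_module_module N])
  have d: "\<forall>i. d i \<in> mod_hom R (free_module R (b (Suc i))) (free_module R (b i))"
    using res by (simp add: free_resolution_def Let_def)
  have S: "submodule ?S R ?H" by (rule coboundaries_submodule[OF N d])
  have coset: "K +>\<^bsub>?C\<^esub> f = K +>\<^bsub>?H\<^esub> f" for K f by (simp add: a_r_coset_def')
  have ext: "carrier (ext_module R n M N) = {?S +>\<^bsub>?H\<^esub> f | f. f \<in> cocycles R b d N n}"
    "\<zero>\<^bsub>ext_module R n M N\<^esub> = ?S"
    "r \<odot>\<^bsub>ext_module R n M N\<^esub> U = (\<Union>x\<in>U. ?S +>\<^bsub>?H\<^esub> (r \<odot>\<^bsub>?H\<^esub> x))" for U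
    by (auto simp: ext_module_def chosen quotient_module_def A_RCOSETS_def' coset)
  have "r \<in> mod_ann R (ext_module R n M N) \<longleftrightarrow> (\<forall>U\<in>carrier (ext_module R n M N).
      r \<odot>\<^bsub>ext_module R n M N\<^esub> U = \<zero>\<^bsub>ext_module R n M N\<^esub>)"
    using r by (simp add: mod_ann_def)
  also have "\<dots> \<longleftrightarrow>
    (\<forall>f \<in> cocycles R b d N n. (\<Union>x\<in>?S +>\<^bsub>?H\<^esub> f. ?S +>\<^bsub>?H\<^esub> (r \<odot>\<^bsub>?H\<^esub> x)) = ?S)"
    unfolding ext by blast
  also have "\<dots> \<longleftrightarrow> (\<forall>f \<in> cocycles R b d N n. r \<odot>\<^bsub>?H\<^esub> f \<in> ?S)"
  proof (rule ball_cong[OF refl])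
    fix f assume "f \<in> cocycles R b d N n"
    then have "f \<in> carrier ?H" by (simp add: cocycles_def hom_module_simps)
    then show "(\<Union>x\<in>?S +>\<^bsub>?H\<^esub> f. ?S +>\<^bsub>?H\<^esub> (r \<odot>\<^bsub>?H\<^esub> x)) = ?S \<longleftrightarrow> r \<odot>\<^bsub>?H\<^esub> f \<in> ?S"
      by (rule H.scaled_coset_eq_iff[OF S _ r])
  qed
  finally show ?thesis by (simp add: hom_module_simps)
qed

end

text \<open>A map that kills the kernel of \<open>D\<close> is constant on the fibres of
  \<open>D\<close>, so any choice of preimages defines the induced map. This is the homomorphism
  theorem without a quotient module.\<close>

lemma factor_through_image:
  assumes M: "module R M" and P: "module R P" and N: "module R N" and S: "submodule S R M"
    and D: "linear_on R M S P D" and w: "linear_on R M S N w"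
    and ker: "\<And>x. x \<in> S \<Longrightarrow> D x = \<zero>\<^bsub>P\<^esub> \<Longrightarrow> w x = \<zero>\<^bsub>N\<^esub>"
  shows "\<exists>v. linear_on R P (D ` S) N v \<and> (\<forall>x\<in>S. v (D x) = w x)"
proof -
  interpret M: module R M by fact
  interpret P: module R P by fact
  interpret N: module R N by fact
  have well: "w x = w y" if x: "x \<in> S" and y: "y \<in> S" and eq: "D x = D y" for x y
  proof -
    have "D (x \<ominus>\<^bsub>M\<^esub> y) = \<zero>\<^bsub>P\<^esub>"
      using linear_on_minus[OF M P D S x y] eq linear_onD(1)[OF D] x y by simp
    then have "w (x \<ominus>\<^bsub>M\<^esub> y) = \<zero>\<^bsub>N\<^esub>" by (rule ker[OF M.submodule_minus[OF S x y]])
    then show ?thesis using linear_on_minus[OF M N w S x y] linear_onD(1)[OF w] x y by simp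
  qed
  define v where "v t = w (SOME x. x \<in> S \<and> D x = t)" for t
  have vD: "v (D x) = w x" if x: "x \<in> S" for x
  proof -
    have "\<exists>y. y \<in> S \<and> D y = D x" using x by blast
    then have "(SOME y. y \<in> S \<and> D y = D x) \<in> S \<and> D (SOME y. y \<in> S \<and> D y = D x) = D x" by (rule someI_ex)
    then show ?thesis unfolding v_def using well x by blast
  qed
  have "linear_on R P (D ` S) N v"
  proof (rule linear_onI)
    show "v t \<in> carrier N" if "t \<in> D ` S" for t using that vD linear_onD(1)[OF w] by auto
  next
    fix s t assume "s \<in> D ` S" "t \<in> D ` S"
    then obtain x y where xy: "x \<in> S" "s = D x" "y \<in> S" "t = D y" by auto
    show "v (s \<oplus>\<^bsub>P\<^esub> t) = v s \<oplus>\<^bsub>N\<^esub> v t"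
      using vD[OF M.submoduleE(5)[OF S xy(1,3)]] vD[OF xy(1)] vD[OF xy(3)]
        linear_onD(2)[OF D xy(1,3)] linear_onD(2)[OF w xy(1,3)] xy(2,4) by simp
  next
    fix r t assume r: "r \<in> carrier R" and "t \<in> D ` S"
    then obtain x where x: "x \<in> S" "t = D x" by auto
    show "v (r \<odot>\<^bsub>P\<^esub> t) = r \<odot>\<^bsub>N\<^esub> v t"
      using vD[OF M.submoduleE(4)[OF S r x(1)]] vD[OF x(1)] linear_onD(3)[OF D r x(1)]
        linear_onD(3)[OF w r x(1)] x(2) by simp
  qed
  then show ?thesis using vD by blast
qed

section \<open>The conductor annihilates the second Ext\<close>

context curve_ring
begin

text \<open>A 2-cocycle \<open>f\<close> kills the kernel of \<open>d 1\<close>, so it is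
  \<open>f'\<close> after \<open>d 1\<close> for a map \<open>f'\<close> on the image of
  \<open>d 1\<close>, which is the kernel of \<open>d 0\<close>. With \<open>h\<close> from
  \<open>conductor_homotopy\<close> for \<open>d 0\<close>, the map \<open>u = r - h\<close> sends
  \<open>F 1\<close> into that kernel and is multiplication by \<open>r\<close> on it. Hence
  \<open>r f\<close> is the coboundary of \<open>f'\<close> after \<open>u\<close>.\<close>

lemma conductor_subset_coh_ann_2: "conductor R \<subseteq> coh_ann_n R 2"
proof
  fix r assume r: "r \<in> conductor R"
  interpret T: curve_quotient "total_quotient_ring R" R "tq_embed R"
    by (intro curve_quotient.intro total_quotient_ring_total_quotient curve_ring_axioms)
  have rc: "r \<in> carrier R" and cond: "\<And>q. q \<in> T.Rbar \<Longrightarrow>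
      tq_embed R r \<otimes>\<^bsub>total_quotient_ring R\<^esub> q \<in> tq_embed R ` carrier R"
    using r unfolding conductor_eq by auto
  have "r \<in> mod_ann R (ext_module R (Suc (Suc 0)) M N)"
    if M: "fin_gen_module R M" and "fin_gen_module R N" for M :: "('a, 'a univ) module" and N :: "('a, 'a univ) module"
  proof -
    have N: "module R N" using \<open>fin_gen_module R N\<close> by (simp add: fin_gen_module_def)
    interpret N: module R N by fact
    obtain b d e where chosen: "chosen_resolution R M = (b, d)" and res: "free_resolution R M b d e"
      using chosen_resolution_resolution[OF M] by blast
    let ?F = "\<lambda>i. free_module R (b i)"
    have d: "d i \<in> mod_hom R (?F (Suc i)) (?F i)" for i
      using res by (simp add: free_resolution_def Let_def)
    have exact: "d (Suc i) ` carrier (?F (Suc (Suc i))) = a_kernel (?F (Suc i)) (?F i) (d i)" for i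
      using res by (simp add: free_resolution_def Let_def)
    let ?F0 = "?F 0" and ?F1 = "?F (Suc 0)" and ?F2 = "?F (Suc (Suc 0))" and ?F3 = "?F (Suc (Suc (Suc 0)))"
    let ?d0 = "d 0" and ?d1 = "d (Suc 0)" and ?d2 = "d (Suc (Suc 0))"
    interpret F1: module R ?F1 by (rule free_module_module)
    interpret F2: module R ?F2 by (rule free_module_module)
        have d0: "linear R ?F1 ?F0 ?d0" using mod_hom_linear[OF d[of 0]] .
    have d1: "linear R ?F2 ?F1 ?d1" using mod_hom_linear[OF d[of "Suc 0"]] .
    have ex0: "?d1 ` carrier ?F2 = {x \<in> carrier ?F1. ?d0 x = \<zero>\<^bsub>?F0\<^esub>}"
      using exact[of 0] by (simp add: a_kernel_eq)
    have ex1: "?d2 ` carrier ?F3 = {x \<in> carrier ?F2. ?d1 x = \<zero>\<^bsub>?F1\<^esub>}"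
      using exact[of "Suc 0"] by (simp add: a_kernel_eq)
    obtain h where h: "linear R ?F1 ?F1 h"
      and dh: "\<And>x. x \<in> carrier ?F1 \<Longrightarrow> ?d0 (h x) = r \<odot>\<^bsub>?F0\<^esub> ?d0 x"
      and h0: "\<And>x. x \<in> carrier ?F1 \<Longrightarrow> ?d0 x = \<zero>\<^bsub>?F0\<^esub> \<Longrightarrow> h x = \<zero>\<^bsub>?F1\<^esub>"
      using T.conductor_homotopy[OF rc cond d0] by metis
    note hc = linear_onD(1)[OF h]
    have "(\<lambda>x\<in>carrier ?F2. r \<odot>\<^bsub>N\<^esub> f x) \<in> coboundaries R b d N (Suc (Suc 0))"
      if f: "f \<in> cocycles R b d N (Suc (Suc 0))" for f
    proof -
      have fh: "f \<in> mod_hom R ?F2 N" and f0: "\<And>x. x \<in> carrier ?F3 \<Longrightarrow> f (?d2 x) = \<zero>\<^bsub>N\<^esub>"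
        using f by (auto simp: cocycles_def)
      note fl = mod_hom_linear[OF fh]
      have "f x = \<zero>\<^bsub>N\<^esub>" if "x \<in> carrier ?F2" "?d1 x = \<zero>\<^bsub>?F1\<^esub>" for x
      proof -
        have "x \<in> ?d2 ` carrier ?F3" unfolding ex1 using that by simp
        then show ?thesis using f0 by auto
      qed
      from factor_through_image[OF free_module_module free_module_module N F2.carrier_is_submodule d1 fl this]
      obtain f' where f': "linear_on R ?F1 (?d1 ` carrier ?F2) N f'"
        and f'd: "\<And>x. x \<in> carrier ?F2 \<Longrightarrow> f' (?d1 x) = f x" by blast
      define u where "u y = r \<odot>\<^bsub>?F1\<^esub> y \<ominus>\<^bsub>?F1\<^esub> h y" for y
      have u: "u y \<in> ?d1 ` carrier ?F2" if y: "y \<in> carrier ?F1" for y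
      proof -
        have ry: "r \<odot>\<^bsub>?F1\<^esub> y \<in> carrier ?F1" using rc y by simp
        interpret F0: module R ?F0 by (rule free_module_module)
        have "?d0 (u y) = ?d0 (r \<odot>\<^bsub>?F1\<^esub> y) \<ominus>\<^bsub>?F0\<^esub> ?d0 (h y)"
          unfolding u_def
          by (rule linear_on_minus[OF free_module_module free_module_module d0 F1.carrier_is_submodule ry hc[OF y]])
        also have "\<dots> = \<zero>\<^bsub>?F0\<^esub>"
          using dh[OF y] linear_onD(3)[OF d0 rc y] linear_onD(1)[OF d0 y] rc
          by (simp add: a_minus_def F0.M.r_neg)
        finally have "?d0 (u y) = \<zero>\<^bsub>?F0\<^esub>" .
        moreover have "u y \<in> carrier ?F1"
          unfolding u_def using ry hc[OF y] by (rule F1.M.minus_closed)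
        ultimately show ?thesis unfolding ex0 by simp
      qed
      have u_add: "u (x \<oplus>\<^bsub>?F1\<^esub> y) = u x \<oplus>\<^bsub>?F1\<^esub> u y" if x: "x \<in> carrier ?F1" and y: "y \<in> carrier ?F1" for x y
        using rc x y hc[OF x] hc[OF y] linear_onD(2)[OF h x y]
        by (simp add: u_def F1.smult_r_distr a_minus_def F1.M.minus_add F1.M.a_ac)
      have u_smult: "u (s \<odot>\<^bsub>?F1\<^esub> y) = s \<odot>\<^bsub>?F1\<^esub> u y" if s: "s \<in> carrier R" and y: "y \<in> carrier ?F1" for s y
        using rc s y hc[OF y] linear_onD(3)[OF h s y]
        by (simp add: u_def F1.smult_r_distr F1.smult_r_minus a_minus_def m_comm flip: F1.smult_assoc1)
      have ulin: "linear R ?F1 ?F1 u"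
      proof (rule linear_onI)
        show "u y \<in> carrier ?F1" if "y \<in> carrier ?F1" for y
          using u[OF that] unfolding ex0 by simp
      qed (rule u_add u_smult; assumption)+
      define g where "g y = f' (u y)" for y
      have "linear R ?F1 N g"
        unfolding g_def[abs_def] by (rule linear_compose[OF ulin f' u])
      then have gh: "restrict g (carrier ?F1) \<in> mod_hom R ?F1 N"
        by (rule linear_mod_hom[OF free_module_module])
      have gd: "g (?d1 x) = r \<odot>\<^bsub>N\<^esub> f x" if x: "x \<in> carrier ?F2" for x
      proof -
        have dx: "?d1 x \<in> carrier ?F1" by (rule linear_onD(1)[OF d1 x])
        have "?d0 (?d1 x) = \<zero>\<^bsub>?F0\<^esub>" using ex0 x by blast
        then have "h (?d1 x) = \<zero>\<^bsub>?F1\<^esub>" by (rule h0[OF dx])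
        then have "u (?d1 x) = ?d1 (r \<odot>\<^bsub>?F2\<^esub> x)"
          unfolding u_def using linear_onD(3)[OF d1 rc x] dx rc by (simp add: a_minus_def)
        then have "g (?d1 x) = f (r \<odot>\<^bsub>?F2\<^esub> x)"
          using f'd[OF F2.smult_closed[OF rc x]] by (simp add: g_def)
        then show ?thesis using linear_onD(3)[OF fl rc x] by simp
      qed
      have "(\<lambda>x\<in>carrier ?F2. r \<odot>\<^bsub>N\<^esub> f x) =
          (\<lambda>x\<in>carrier ?F2. restrict g (carrier ?F1) (?d1 x))"
        using gd linear_onD(1)[OF d1] by (auto intro!: restrict_ext)
      also have "\<dots> \<in> coboundaries R b d N (Suc (Suc 0))"
        unfolding coboundaries.simps using gh by (rule imageI)
      finally show ?thesis .
    qed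
    then show ?thesis
      unfolding ext_annihilated_iff[OF N rc chosen res] by blast
  qed
  then show "r \<in> coh_ann_n R 2" using rc by (simp add: coh_ann_n_def numeral_2_eq_2)
qed

end

text \<open>Baer's criterion taken as the notion of injectivity: it quantifies over ideals only, so
  no universe of test modules is involved. The element \<open>z\<close> is the value at
  \<open>1\<close> of an extension of \<open>\<phi>\<close> to \<open>R\<close>.\<close>

definition baer :: "('a, 'm) ring_scheme \<Rightarrow> ('a, 'b) module \<Rightarrow> bool" where
  "baer R Z \<longleftrightarrow> (\<forall>J \<phi>. ideal J R \<longrightarrow> linear_on R (ring_module R) J Z \<phi> \<longrightarrow>
     (\<exists>z\<in>carrier Z. \<forall>x\<in>J. \<phi> x = x \<odot>\<^bsub>Z\<^esub> z))"

section \<open>Extension of linear maps and vanishing of Ext\<close>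

context cring
begin

text \<open>Injectivity for submodules of free modules, one coordinate at a time. The induction
  hypothesis extends \<open>\<phi>\<close> from the elements with vanishing coordinate
  \<open>k\<close>. The difference of \<open>\<phi>\<close> and that extension depends on the
  coordinate \<open>k\<close> alone, so it is a map on the ideal of these coordinates, and the
  criterion supplies the last coefficient.\<close>

lemma baer_extends_aux:
  assumes Z: "module R Z" and B: "baer R Z"
    and S: "submodule S R (free_module R n)" and "k \<le> n" and "\<forall>x\<in>S. \<forall>i<n. k \<le> i \<longrightarrow> x i = \<zero>"
    and \<phi>: "linear_on R (free_module R n) S Z \<phi>"
  shows "\<exists>z. (\<forall>i<k. z i \<in> carrier Z) \<and> (\<forall>x\<in>S. \<phi> x = (\<Oplus>\<^bsub>Z\<^esub>i\<in>{..<k}. x i \<odot>\<^bsub>Z\<^esub> z i))"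
  using assms(3-)
proof (induction k arbitrary: S)
  case 0
  interpret Z: module R Z by fact
  have "x = \<zero>\<^bsub>free_module R n\<^esub>" if x: "x \<in> S" for x
    using module.submoduleE(1)[OF free_module_module 0(1)] 0(3) x
    by (intro free_eqI[of x n]) (auto simp: free_zero intro: free_restrict)
  then have "\<phi> x = \<zero>\<^bsub>Z\<^esub>" if x: "x \<in> S" for x
    using linear_on_zero[OF free_module_module Z 0(4) 0(1)] x by simp
  then show ?case by simp
next
  case (Suc k)
  interpret Z: module R Z by fact
  interpret F: module R "free_module R n" by (rule free_module_module)
  let ?F = "free_module R n"
  have k: "k < n" using Suc.prems(2) by simp
  note S = Suc.prems(1) and \<phi> = Suc.prems(4)
  have Sc: "x \<in> carrier ?F" if "x \<in> S" for x using F.submoduleE(1)[OF S] that by blast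
  have coord: "linear_on R ?F S (ring_module R) (\<lambda>x. x k)"
    by (rule linear_on_subset[OF linear_coordinate[OF k] F.submoduleE(1)[OF S]])
  define S0 where "S0 = {x \<in> S. x k = \<zero>}"
  have S0: "submodule S0 R ?F"
    unfolding S0_def using linear_on_kernel[OF free_module_module ring_module_module coord S] by simp
  have 1: "\<forall>x\<in>S0. \<forall>i<n. k \<le> i \<longrightarrow> x i = \<zero>"
    using Suc.prems(3) by (auto simp: S0_def Suc_le_eq dest: le_imp_less_or_eq)
  have 2: "linear_on R ?F S0 Z \<phi>" by (rule linear_on_subset[OF \<phi>]) (auto simp: S0_def)
  have kn: "k \<le> n" using k by simp
  obtain z where z: "\<forall>i<k. z i \<in> carrier Z"
    and zS0: "\<forall>x\<in>S0. \<phi> x = (\<Oplus>\<^bsub>Z\<^esub>i\<in>{..<k}. x i \<odot>\<^bsub>Z\<^esub> z i)"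
    using Suc.IH[OF S0 kn 1 2] by blast
  \<comment> \<open>Padding with zeros makes \<open>L\<close> a linear map on the whole free module
    of rank \<open>n\<close>.\<close>
  define L where "L x = (\<Oplus>\<^bsub>Z\<^esub>i\<in>{..<n}. x i \<odot>\<^bsub>Z\<^esub> (if i < k then z i else \<zero>\<^bsub>Z\<^esub>))" for x
  have L: "linear R ?F Z L"
    unfolding L_def[abs_def] using z by (intro linear_combination[OF Z]) auto
  have L_eq: "L x = (\<Oplus>\<^bsub>Z\<^esub>i\<in>{..<k}. x i \<odot>\<^bsub>Z\<^esub> z i)" if x: "x \<in> carrier ?F" for x
    unfolding L_def using free_closed[OF x] z k
    by (intro Z.M.add.finprod_mono_neutral_cong_right) auto
  have LS: "linear_on R ?F S Z L" by (rule linear_on_subset[OF L F.submoduleE(1)[OF S]])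
  define \<psi> where "\<psi> x = \<phi> x \<ominus>\<^bsub>Z\<^esub> L x" for x
  have c: "\<phi> x \<in> carrier Z" "L x \<in> carrier Z" if "x \<in> S" for x
    using linear_onD(1)[OF \<phi> that] linear_onD(1)[OF LS that] by auto
  have \<psi>: "linear_on R ?F S Z \<psi>"
  proof (rule linear_onI)
    show "\<psi> x \<in> carrier Z" if "x \<in> S" for x using c[OF that] by (simp add: \<psi>_def)
    show "\<psi> (x \<oplus>\<^bsub>?F\<^esub> y) = \<psi> x \<oplus>\<^bsub>Z\<^esub> \<psi> y" if "x \<in> S" "y \<in> S" for x y
      using c[OF that(1)] c[OF that(2)] linear_onD(2)[OF \<phi> that] linear_onD(2)[OF LS that]
      by (simp add: \<psi>_def a_minus_def Z.M.minus_add Z.M.a_ac)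
    show "\<psi> (r \<odot>\<^bsub>?F\<^esub> x) = r \<odot>\<^bsub>Z\<^esub> \<psi> x" if "r \<in> carrier R" "x \<in> S" for r x
      using c[OF that(2)] linear_onD(3)[OF \<phi> that] linear_onD(3)[OF LS that] that(1)
      by (simp add: \<psi>_def a_minus_def Z.smult_r_distr Z.smult_r_minus)
  qed
  have \<psi>0: "\<psi> x = \<zero>\<^bsub>Z\<^esub>" if x: "x \<in> S" "x k = \<zero>" for x
  proof -
    have "x \<in> S0" using x by (simp add: S0_def)
    then have "\<phi> x = L x" using zS0 L_eq[OF Sc[OF x(1)]] by simp
    then show ?thesis using c[OF x(1)] by (simp add: \<psi>_def a_minus_def Z.M.r_neg)
  qed
  define J where "J = (\<lambda>x. x k) ` S"
  have J: "ideal J R"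
    unfolding J_def by (rule submodule_ideal[OF linear_on_image[OF free_module_module ring_module_module coord S]])
  from factor_through_image[OF free_module_module ring_module_module Z S coord \<psi>]
  obtain \<chi> where \<chi>lin: "linear_on R (ring_module R) J Z \<chi>" and \<chi>: "\<And>x. x \<in> S \<Longrightarrow> \<chi> (x k) = \<psi> x"
    using \<psi>0 unfolding J_def by auto
  obtain w where w: "w \<in> carrier Z" "\<forall>a\<in>J. \<chi> a = a \<odot>\<^bsub>Z\<^esub> w"
    using B J \<chi>lin unfolding baer_def by blast
  define z' where "z' i = (if i < k then z i else w)" for i
  have "\<phi> x = (\<Oplus>\<^bsub>Z\<^esub>i\<in>{..<Suc k}. x i \<odot>\<^bsub>Z\<^esub> z' i)" if x: "x \<in> S" for x
  proof -
    have xc: "x i \<in> carrier R" if "i < n" for i using free_closed[OF Sc[OF x] that] .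
    have "x k \<odot>\<^bsub>Z\<^esub> w = \<phi> x \<ominus>\<^bsub>Z\<^esub> L x" using w(2) \<chi>[OF x] x by (auto simp: J_def \<psi>_def)
    then have "\<phi> x = x k \<odot>\<^bsub>Z\<^esub> w \<oplus>\<^bsub>Z\<^esub> L x" using c[OF x] by (simp add: a_minus_def Z.M.a_assoc Z.M.l_neg)
    also have "L x = (\<Oplus>\<^bsub>Z\<^esub>i\<in>{..<k}. x i \<odot>\<^bsub>Z\<^esub> z' i)"
      unfolding L_eq[OF Sc[OF x]] using xc z k by (intro Z.M.finsum_cong') (auto simp: z'_def)
    also have "x k \<odot>\<^bsub>Z\<^esub> w \<oplus>\<^bsub>Z\<^esub> (\<Oplus>\<^bsub>Z\<^esub>i\<in>{..<k}. x i \<odot>\<^bsub>Z\<^esub> z' i) = (\<Oplus>\<^bsub>Z\<^esub>i\<in>{..<Suc k}. x i \<odot>\<^bsub>Z\<^esub> z' i)"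
    proof -
      have "(\<Oplus>\<^bsub>Z\<^esub>i\<in>insert k {..<k}. x i \<odot>\<^bsub>Z\<^esub> z' i) = x k \<odot>\<^bsub>Z\<^esub> z' k \<oplus>\<^bsub>Z\<^esub> (\<Oplus>\<^bsub>Z\<^esub>i\<in>{..<k}. x i \<odot>\<^bsub>Z\<^esub> z' i)"
        using xc z w(1) k by (intro Z.M.finsum_insert) (auto simp: z'_def)
      then show ?thesis by (simp add: lessThan_Suc z'_def)
    qed
    finally show ?thesis .
  qed
  then show ?case using z w(1) by (intro exI[of _ z']) (auto simp: z'_def)
qed

lemma baer_extends:
  assumes "module R Z" "baer R Z" "submodule S R (free_module R n)" "linear_on R (free_module R n) S Z \<phi>"
  shows "\<exists>z. (\<forall>i<n. z i \<in> carrier Z) \<and> (\<forall>x\<in>S. \<phi> x = (\<Oplus>\<^bsub>Z\<^esub>i\<in>{..<n}. x i \<odot>\<^bsub>Z\<^esub> z i))"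
  by (rule baer_extends_aux[OF assms(1-3) order_refl _ assms(4)]) auto

text \<open>A form of the vanishing of \<open>Ext\<^sup>1(T, Z)\<close> for \<open>T\<close> a submodule of a free module: here \<open>T\<close> is the
  image of \<open>A\<close>.\<close>

definition ext_vanishes :: "('a, 'z) module \<Rightarrow> bool" where
  "ext_vanishes Z \<longleftrightarrow> (\<forall>p m A u. linear R (free_module R p) (free_module R m) A \<longrightarrow>
     linear_on R (free_module R p) {x \<in> carrier (free_module R p). A x = \<zero>\<^bsub>free_module R m\<^esub>} Z u \<longrightarrow>
     (\<exists>z. (\<forall>i<p. z i \<in> carrier Z) \<and> (\<forall>x\<in>carrier (free_module R p). A x = \<zero>\<^bsub>free_module R m\<^esub> \<longrightarrow>
        u x = (\<Oplus>\<^bsub>Z\<^esub>i\<in>{..<p}. x i \<odot>\<^bsub>Z\<^esub> z i))))"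

text \<open>A diagram chase with \<open>T\<close> the image of \<open>A\<close>. Injectivity of
  \<open>I\<close> extends \<open>j u\<close> to \<open>w\<close> on the free module
  \<open>P\<close>. As \<open>\<pi> w\<close> kills the kernel of \<open>A\<close>, it induces
  \<open>v\<close> on \<open>T\<close>, which injectivity of \<open>Z'\<close> extends to the free
  module containing \<open>T\<close>; there it lifts along \<open>\<pi>\<close> to
  \<open>v'\<close>. The difference of \<open>w\<close> and \<open>v'\<close> after \<open>A\<close>
  takes values in \<open>j Z\<close> and yields the extension of \<open>u\<close>.\<close>

lemma ext_vanishesI_short_exact:
  fixes Z :: "('a, 'z) module" and I :: "('a, 'c) module" and Z' :: "('a, 'd) module"
  assumes Z: "module R Z" and I: "module R I" and Z': "module R Z'"
    and j: "linear R Z I j" "inj_on j (carrier Z)"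
    and \<pi>: "linear R I Z' \<pi>" "\<pi> ` carrier I = carrier Z'"
    and exact: "j ` carrier Z = {x \<in> carrier I. \<pi> x = \<zero>\<^bsub>Z'\<^esub>}"
    and BI: "baer R I" and BZ': "baer R Z'"
  shows "ext_vanishes Z"
  unfolding ext_vanishes_def
proof (intro allI impI)
  fix p m A u
  let ?P = "free_module R p" and ?M = "free_module R m"
  let ?K = "{x \<in> carrier ?P. A x = \<zero>\<^bsub>?M\<^esub>}"
  assume A: "linear R ?P ?M A" and u: "linear_on R ?P ?K Z u"
  interpret Z: module R Z by fact
  interpret I: module R I by fact
  interpret Z': module R Z' by fact
  interpret P: module R ?P by (rule free_module_module)
  interpret M: module R ?M by (rule free_module_module)
  note fm = free_module_module
  have K: "submodule ?K R ?P" by (rule linear_on_kernel[OF fm fm A P.carrier_is_submodule])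
  have ju: "linear_on R ?P ?K I (\<lambda>x. j (u x))"
    by (rule linear_compose[OF u j(1)]) (rule linear_onD(1)[OF u])
  obtain w0 where w0: "\<forall>i<p. w0 i \<in> carrier I"
    and w0K: "\<forall>x\<in>?K. j (u x) = (\<Oplus>\<^bsub>I\<^esub>i\<in>{..<p}. x i \<odot>\<^bsub>I\<^esub> w0 i)"
    using baer_extends[OF I BI K ju] by blast
  define w where "w x = (\<Oplus>\<^bsub>I\<^esub>i\<in>{..<p}. x i \<odot>\<^bsub>I\<^esub> w0 i)" for x
  have w: "linear R ?P I w" unfolding w_def[abs_def] using w0 by (intro linear_combination[OF I]) auto
  have wK: "w x = j (u x)" if "x \<in> ?K" for x using w0K that by (simp add: w_def)
  define T where "T = A ` carrier ?P"
  have T: "submodule T R ?M" unfolding T_def by (rule linear_on_image[OF fm fm A P.carrier_is_submodule])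
  have \<pi>w: "linear R ?P Z' (\<lambda>x. \<pi> (w x))"
    by (rule linear_compose[OF w \<pi>(1)]) (rule linear_onD(1)[OF w])
  have \<pi>w0: "\<pi> (w x) = \<zero>\<^bsub>Z'\<^esub>" if x: "x \<in> ?K" for x
  proof -
    have "j (u x) \<in> j ` carrier Z" using linear_onD(1)[OF u x] by blast
    then show ?thesis unfolding exact wK[OF x] by simp
  qed
  from factor_through_image[OF fm fm Z' P.carrier_is_submodule A \<pi>w]
  obtain v where v: "linear_on R ?M T Z' v" and vA: "\<And>x. x \<in> carrier ?P \<Longrightarrow> v (A x) = \<pi> (w x)"
    using \<pi>w0 unfolding T_def by auto
  obtain y where y: "\<forall>i<m. y i \<in> carrier Z'"
    and yT: "\<forall>t\<in>T. v t = (\<Oplus>\<^bsub>Z'\<^esub>i\<in>{..<m}. t i \<odot>\<^bsub>Z'\<^esub> y i)"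
    using baer_extends[OF Z' BZ' T v] by blast
  have "\<forall>i\<in>{..<m}. \<exists>y'. y' \<in> carrier I \<and> \<pi> y' = y i"
  proof
    fix i assume "i \<in> {..<m}"
    then have "y i \<in> \<pi> ` carrier I" using y \<pi>(2) by simp
    then show "\<exists>y'. y' \<in> carrier I \<and> \<pi> y' = y i" by auto
  qed
  then obtain y' where y': "\<forall>i\<in>{..<m}. y' i \<in> carrier I \<and> \<pi> (y' i) = y i"
    by (rule bchoice[THEN exE])
  define v' where "v' t = (\<Oplus>\<^bsub>I\<^esub>i\<in>{..<m}. t i \<odot>\<^bsub>I\<^esub> y' i)" for t
  have v': "linear R ?M I v'" unfolding v'_def[abs_def] using y' by (intro linear_combination[OF I]) auto
  have \<pi>v': "\<pi> (v' t) = v t" if t: "t \<in> T" for t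
  proof -
    have tc: "t \<in> carrier ?M" using M.submoduleE(1)[OF T] t by blast
    have comp: "linear R ?M Z' (\<lambda>t. \<pi> (v' t))"
      by (rule linear_compose[OF v' \<pi>(1)]) (rule linear_onD(1)[OF v'])
    have "\<pi> (v' (unit_vec m i)) = y i" if i: "i < m" for i
      using linear_combination_unit[OF I, of m y' i] y' i by (simp add: v'_def)
    then have "\<pi> (v' t) = (\<Oplus>\<^bsub>Z'\<^esub>i\<in>{..<m}. t i \<odot>\<^bsub>Z'\<^esub> y i)"
      unfolding linear_expand[OF Z' comp tc] using free_closed[OF tc] y
      by (intro Z'.M.finsum_cong') auto
    then show ?thesis using yT t by simp
  qed
  define q where "q x = w x \<ominus>\<^bsub>I\<^esub> v' (A x)" for x
  have v'A: "linear R ?P I (\<lambda>x. v' (A x))"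
    by (rule linear_compose[OF A v']) (rule linear_onD(1)[OF A])
  have c: "w x \<in> carrier I" "v' (A x) \<in> carrier I" if "x \<in> carrier ?P" for x
    using linear_onD(1)[OF w that] linear_onD(1)[OF v'A that] by auto
  have q_add: "q (x \<oplus>\<^bsub>?P\<^esub> y) = q x \<oplus>\<^bsub>I\<^esub> q y" if "x \<in> carrier ?P" "y \<in> carrier ?P" for x y
    using c[OF that(1)] c[OF that(2)] linear_onD(2)[OF w that] linear_onD(2)[OF v'A that]
    by (simp add: q_def a_minus_def I.M.minus_add I.M.a_ac)
  have q_smult: "q (r \<odot>\<^bsub>?P\<^esub> x) = r \<odot>\<^bsub>I\<^esub> q x" if "r \<in> carrier R" "x \<in> carrier ?P" for r x
    using c[OF that(2)] linear_onD(3)[OF w that] linear_onD(3)[OF v'A that] that(1)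
    by (simp add: q_def a_minus_def I.smult_r_distr I.smult_r_minus)
  have q: "q x \<in> j ` carrier Z" if x: "x \<in> carrier ?P" for x
  proof -
    have Ax: "A x \<in> T" using x by (auto simp: T_def)
    have "\<pi> (q x) = \<pi> (w x) \<ominus>\<^bsub>Z'\<^esub> \<pi> (v' (A x))"
      unfolding q_def by (rule linear_on_minus[OF I Z' \<pi>(1) I.carrier_is_submodule c[OF x]])
    also have "\<dots> = \<zero>\<^bsub>Z'\<^esub>"
      using \<pi>v'[OF Ax] vA[OF x] linear_onD(1)[OF \<pi>w x] by (simp add: a_minus_def Z'.M.r_neg)
    finally show ?thesis unfolding exact using c[OF x] by (simp add: q_def)
  qed
  define k where "k x = inv_into (carrier Z) j (q x)" for x
  have k: "k x \<in> carrier Z" "j (k x) = q x" if "x \<in> carrier ?P" for x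
    using inv_into_into[OF q[OF that]] f_inv_into_f[OF q[OF that]] by (auto simp: k_def)
  have jinj: "a = b" if "a \<in> carrier Z" "b \<in> carrier Z" "j a = j b" for a b
    using j(2) that by (auto simp: inj_on_def)
  have klin: "linear R ?P Z k"
  proof (rule linear_onI)
    show "k (x \<oplus>\<^bsub>?P\<^esub> y) = k x \<oplus>\<^bsub>Z\<^esub> k y" if xy: "x \<in> carrier ?P" "y \<in> carrier ?P" for x y
    proof (rule jinj)
      show "j (k (x \<oplus>\<^bsub>?P\<^esub> y)) = j (k x \<oplus>\<^bsub>Z\<^esub> k y)"
        using k[OF xy(1)] k[OF xy(2)] k[of "x \<oplus>\<^bsub>?P\<^esub> y"] q_add[OF xy] xy
          linear_onD(2)[OF j(1) k(1)[OF xy(1)] k(1)[OF xy(2)]] by simp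
    qed (use k xy in simp_all)
    show "k (r \<odot>\<^bsub>?P\<^esub> x) = r \<odot>\<^bsub>Z\<^esub> k x" if rx: "r \<in> carrier R" "x \<in> carrier ?P" for r x
    proof (rule jinj)
      show "j (k (r \<odot>\<^bsub>?P\<^esub> x)) = j (r \<odot>\<^bsub>Z\<^esub> k x)"
        using k[OF rx(2)] k[of "r \<odot>\<^bsub>?P\<^esub> x"] q_smult[OF rx] rx
          linear_onD(3)[OF j(1) rx(1) k(1)[OF rx(2)]] by simp
    qed (use k rx in simp_all)
  qed (rule k)
  have "u x = (\<Oplus>\<^bsub>Z\<^esub>i\<in>{..<p}. x i \<odot>\<^bsub>Z\<^esub> k (unit_vec p i))" if x: "x \<in> carrier ?P" "A x = \<zero>\<^bsub>?M\<^esub>" for x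
  proof -
    have xK: "x \<in> ?K" using x by simp
    have "v' (A x) = \<zero>\<^bsub>I\<^esub>" unfolding x(2) by (rule linear_on_zero[OF fm I v' M.carrier_is_submodule])
    then have "j (k x) = j (u x)"
      using k(2)[OF x(1)] wK[OF xK] c[OF x(1)] by (simp add: q_def a_minus_def)
    then have "k x = u x" using jinj k(1)[OF x(1)] linear_onD(1)[OF u xK] by blast
    then show ?thesis using linear_expand[OF Z klin x(1)] by simp
  qed
  then show "\<exists>z. (\<forall>i<p. z i \<in> carrier Z) \<and> (\<forall>x\<in>carrier ?P. A x = \<zero>\<^bsub>?M\<^esub> \<longrightarrow>
      u x = (\<Oplus>\<^bsub>Z\<^esub>i\<in>{..<p}. x i \<odot>\<^bsub>Z\<^esub> z i))"
    using k(1)[OF unit_vec_closed] by (intro exI[of _ "\<lambda>i. k (unit_vec p i)"]) blast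
qed

end

section \<open>Injectivity of the first cosyzygy\<close>

context noetherian_cring
begin

text \<open>An associated prime of \<open>R/I\<close>: a maximal element among the proper ideals
  \<open>(I : y)\<close> is prime, because \<open>(I : b y)\<close> contains \<open>(I : y)\<close>
  and must equal it unless \<open>b y\<close> is in \<open>I\<close>.\<close>

lemma maximal_colon_prime:
  assumes I: "ideal I R" and ne: "I \<noteq> carrier R"
  shows "\<exists>y\<in>carrier R. y \<notin> I \<and> primeideal {r \<in> carrier R. r \<otimes> y \<in> I} R"
proof -
  let ?Q = "\<lambda>y. {r \<in> carrier R. r \<otimes> y \<in> I}"
  let ?F = "?Q ` (carrier R - I)"
  have "?F \<noteq> {}" using ne ideal_carrier[OF I] by auto
  moreover have "ideal J R" if "J \<in> ?F" for J using that ideal_quotient_ideal[OF I] by auto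
  ultimately have "\<exists>P\<in>?F. \<forall>J\<in>?F. P \<subseteq> J \<longrightarrow> J = P" by (rule exists_maximal_ideal_in_family)
  then obtain P where "P \<in> ?F" and max: "\<forall>J\<in>?F. P \<subseteq> J \<longrightarrow> J = P" by (rule bexE)
  then obtain y where y: "y \<in> carrier R" "y \<notin> I" "P = ?Q y" by auto
  have P: "ideal P R" unfolding y(3) by (rule ideal_quotient_ideal[OF I y(1)])
  have "a \<in> P \<or> b \<in> P" if a: "a \<in> carrier R" and b: "b \<in> carrier R" and ab: "a \<otimes> b \<in> P" for a b
  proof (rule disjCI)
    assume "b \<notin> P"
    then have by_mem: "b \<otimes> y \<in> carrier R - I" using b y by auto
    have "P \<subseteq> ?Q (b \<otimes> y)"
    proof
      fix r assume r: "r \<in> P"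
      then have rc: "r \<in> carrier R" and ry: "r \<otimes> y \<in> I" using y(3) by auto
      have "r \<otimes> (b \<otimes> y) = b \<otimes> (r \<otimes> y)" using rc b y(1) by (simp add: m_ac)
      then show "r \<in> ?Q (b \<otimes> y)" using ideal_mult_closed[OF I b ry] rc by simp
    qed
    then have "?Q (b \<otimes> y) = P" using max by_mem by blast
    moreover have "a \<in> ?Q (b \<otimes> y)" using ab a b y(1) unfolding y(3) by (simp add: m_assoc)
    ultimately show "a \<in> P" by blast
  qed
  moreover have "carrier R \<noteq> P"
  proof -
    have "\<one> \<notin> P" using y by simp
    then show ?thesis by auto
  qed
  ultimately have "primeideal P R" using P by (intro primeidealI) (auto intro: cring_axioms)
  then show ?thesis using y by blast
qed

text \<open>Extend \<open>\<phi>\<close> to \<open>\<psi>\<close> on an ideal \<open>I\<close> that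
  is as large as possible. If \<open>I\<close> is proper, take an associated prime
  \<open>P = (I : y)\<close>. On \<open>P\<close> the map sending \<open>r\<close> to
  \<open>\<psi> (r y)\<close> is multiplication by some \<open>z\<close>, and this is exactly what
  makes the extension of \<open>\<psi>\<close> to \<open>I + y R\<close> with value \<open>z\<close>
  at \<open>y\<close> well defined, against the maximality of \<open>I\<close>.\<close>

lemma baer_from_primes:
  fixes Z :: "('a, 'z) module"
  assumes Z: "module R Z"
    and primes: "\<And>P \<phi>. primeideal P R \<Longrightarrow> linear_on R (ring_module R) P Z \<phi> \<Longrightarrow>
      \<exists>z\<in>carrier Z. \<forall>x\<in>P. \<phi> x = x \<odot>\<^bsub>Z\<^esub> z"
  shows "baer R Z"
  unfolding baer_def
proof (intro allI impI)
  fix J and \<phi> :: "'a \<Rightarrow> 'z"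
  assume J: "ideal J R" and \<phi>: "linear_on R (ring_module R) J Z \<phi>"
  interpret Z: module R Z by fact
  let ?F = "{I. ideal I R \<and> J \<subseteq> I \<and> (\<exists>\<psi>. linear_on R (ring_module R) I Z \<psi> \<and> (\<forall>x\<in>J. \<psi> x = \<phi> x))}"
  have "J \<in> ?F" using J \<phi> by blast
  then have "\<exists>I\<in>?F. \<forall>I'\<in>?F. I \<subseteq> I' \<longrightarrow> I' = I" by (intro exists_maximal_ideal_in_family) auto
  then obtain I where "I \<in> ?F" and max: "\<forall>I'\<in>?F. I \<subseteq> I' \<longrightarrow> I' = I" by (rule bexE)
  then obtain \<psi> where I: "ideal I R" "J \<subseteq> I" and \<psi>: "linear_on R (ring_module R) I Z \<psi>"
    and \<psi>J: "\<forall>x\<in>J. \<psi> x = \<phi> x" by blast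
  note Ic = ideal_carrier[OF I(1)]
  note \<psi>c = linear_onD(1)[OF \<psi>]
  have "I = carrier R"
  proof (rule ccontr)
    assume "I \<noteq> carrier R"
    then obtain y where y: "y \<in> carrier R" "y \<notin> I" and P: "primeideal {r \<in> carrier R. r \<otimes> y \<in> I} R"
      using maximal_colon_prime[OF I(1)] by blast
    let ?P = "{r \<in> carrier R. r \<otimes> y \<in> I}"
    have "linear_on R (ring_module R) ?P Z (\<lambda>r. \<psi> (r \<otimes> y))"
    proof (rule linear_onI)
      fix r s assume "r \<in> ?P" "s \<in> ?P"
      then show "\<psi> ((r \<oplus>\<^bsub>ring_module R\<^esub> s) \<otimes> y) = \<psi> (r \<otimes> y) \<oplus>\<^bsub>Z\<^esub> \<psi> (s \<otimes> y)"
        using linear_onD(2)[OF \<psi>, of "r \<otimes> y" "s \<otimes> y"] y(1) by (simp add: l_distr)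
    next
      fix s r assume "s \<in> carrier R" "r \<in> ?P"
      then show "\<psi> ((s \<odot>\<^bsub>ring_module R\<^esub> r) \<otimes> y) = s \<odot>\<^bsub>Z\<^esub> \<psi> (r \<otimes> y)"
        using linear_onD(3)[OF \<psi>, of s "r \<otimes> y"] y(1) by (simp add: m_assoc)
    qed (use \<psi>c in auto)
    then obtain z where z: "z \<in> carrier Z" "\<forall>r\<in>?P. \<psi> (r \<otimes> y) = r \<odot>\<^bsub>Z\<^esub> z"
      using primes[OF P] by blast
    let ?I = "{w \<oplus> y \<otimes> r | w r. w \<in> I \<and> r \<in> carrier R}"
    have I': "ideal ?I R" "I \<subseteq> ?I" "y \<in> ?I"
      using ideal_add_principal[OF I(1) y(1)] by blast+
    have well: "\<psi> w \<oplus>\<^bsub>Z\<^esub> r \<odot>\<^bsub>Z\<^esub> z = \<psi> w' \<oplus>\<^bsub>Z\<^esub> r' \<odot>\<^bsub>Z\<^esub> z"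
      if w: "w \<in> I" "w' \<in> I" and r: "r \<in> carrier R" "r' \<in> carrier R" and eq: "w \<oplus> y \<otimes> r = w' \<oplus> y \<otimes> r'"
      for w w' r r'
    proof -
      have wc: "w \<in> carrier R" "w' \<in> carrier R" using Ic w by auto
      have "(r \<ominus> r') \<otimes> y = (w \<oplus> y \<otimes> r) \<ominus> (w' \<oplus> y \<otimes> r') \<oplus> (w' \<ominus> w)"
        using wc r y(1) by (simp add: ring_arith)
      then have ry: "(r \<ominus> r') \<otimes> y = w' \<ominus> w" unfolding eq using wc r y(1) by simp
      then have "r \<ominus> r' \<in> ?P" using ideal_minus_closed[OF I(1) w(2,1)] r by simp
      then have "\<psi> (w' \<ominus> w) = (r \<ominus> r') \<odot>\<^bsub>Z\<^esub> z" using z(2) ry by metis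
      moreover have "\<psi> (w' \<ominus> w) = \<psi> w' \<ominus>\<^bsub>Z\<^esub> \<psi> w"
        using linear_on_minus[OF ring_module_module Z \<psi> ideal_submodule[OF I(1)] w(2,1)] by simp
      moreover have "(r \<ominus> r') \<odot>\<^bsub>Z\<^esub> z = r \<odot>\<^bsub>Z\<^esub> z \<ominus>\<^bsub>Z\<^esub> r' \<odot>\<^bsub>Z\<^esub> z"
        using r z(1) by (simp add: a_minus_def Z.smult_l_distr Z.smult_l_minus)
      ultimately have eqz: "\<psi> w' \<ominus>\<^bsub>Z\<^esub> \<psi> w = r \<odot>\<^bsub>Z\<^esub> z \<ominus>\<^bsub>Z\<^esub> r' \<odot>\<^bsub>Z\<^esub> z" by simp
      note cc = \<psi>c[OF w(1)] \<psi>c[OF w(2)] Z.smult_closed[OF r(1) z(1)] Z.smult_closed[OF r(2) z(1)]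
      have "\<psi> w \<oplus>\<^bsub>Z\<^esub> r \<odot>\<^bsub>Z\<^esub> z = (\<psi> w \<oplus>\<^bsub>Z\<^esub> (r \<odot>\<^bsub>Z\<^esub> z \<ominus>\<^bsub>Z\<^esub> r' \<odot>\<^bsub>Z\<^esub> z)) \<oplus>\<^bsub>Z\<^esub> r' \<odot>\<^bsub>Z\<^esub> z"
        using cc by (simp add: a_minus_def Z.M.a_assoc Z.M.l_neg)
      also have "\<dots> = \<psi> w' \<oplus>\<^bsub>Z\<^esub> r' \<odot>\<^bsub>Z\<^esub> z"
        unfolding eqz[symmetric] using cc
        by (simp add: a_minus_def Z.M.a_lcomm[of "\<psi> w" "\<psi> w'"] Z.M.r_neg)
      finally show ?thesis .
    qed
    define \<chi> where "\<chi> t = (SOME v. \<exists>w r. w \<in> I \<and> r \<in> carrier R \<and> t = w \<oplus> y \<otimes> r \<and>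
        v = \<psi> w \<oplus>\<^bsub>Z\<^esub> r \<odot>\<^bsub>Z\<^esub> z)" for t
    have \<chi>: "\<chi> (w \<oplus> y \<otimes> r) = \<psi> w \<oplus>\<^bsub>Z\<^esub> r \<odot>\<^bsub>Z\<^esub> z" if w: "w \<in> I" and r: "r \<in> carrier R" for w r
      unfolding \<chi>_def
    proof (rule some_equality)
      show "\<exists>w' r'. w' \<in> I \<and> r' \<in> carrier R \<and> w \<oplus> y \<otimes> r = w' \<oplus> y \<otimes> r' \<and>
          \<psi> w \<oplus>\<^bsub>Z\<^esub> r \<odot>\<^bsub>Z\<^esub> z = \<psi> w' \<oplus>\<^bsub>Z\<^esub> r' \<odot>\<^bsub>Z\<^esub> z" using w r by blast
    next
      fix v assume "\<exists>w' r'. w' \<in> I \<and> r' \<in> carrier R \<and> w \<oplus> y \<otimes> r = w' \<oplus> y \<otimes> r' \<and>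
          v = \<psi> w' \<oplus>\<^bsub>Z\<^esub> r' \<odot>\<^bsub>Z\<^esub> z"
      then obtain w' r' where "w' \<in> I" "r' \<in> carrier R" "w \<oplus> y \<otimes> r = w' \<oplus> y \<otimes> r'"
          "v = \<psi> w' \<oplus>\<^bsub>Z\<^esub> r' \<odot>\<^bsub>Z\<^esub> z" by (elim exE conjE)
      then show "v = \<psi> w \<oplus>\<^bsub>Z\<^esub> r \<odot>\<^bsub>Z\<^esub> z" using well[OF w _ r] by simp
    qed
    have "linear_on R (ring_module R) ?I Z \<chi>"
    proof (rule linear_onI)
      fix t assume "t \<in> ?I"
      then show "\<chi> t \<in> carrier Z" using \<chi> \<psi>c z(1) by auto
    next
      fix t t' assume "t \<in> ?I" "t' \<in> ?I"
      then obtain w r w' r' where t: "t = w \<oplus> y \<otimes> r" "w \<in> I" "r \<in> carrier R"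
        "t' = w' \<oplus> y \<otimes> r'" "w' \<in> I" "r' \<in> carrier R" by blast
      note c = Ic[OF t(2)] Ic[OF t(5)] t(3,6)
      have "t \<oplus> t' = (w \<oplus> w') \<oplus> y \<otimes> (r \<oplus> r')" unfolding t(1,4) using c y(1) by (simp add: r_distr a_ac)
      then have "\<chi> (t \<oplus> t') = \<psi> (w \<oplus> w') \<oplus>\<^bsub>Z\<^esub> (r \<oplus> r') \<odot>\<^bsub>Z\<^esub> z"
        using \<chi>[OF ideal_add_closed[OF I(1) t(2,5)], of "r \<oplus> r'"] t(3,6) by simp
      also have "\<dots> = (\<psi> w \<oplus>\<^bsub>Z\<^esub> r \<odot>\<^bsub>Z\<^esub> z) \<oplus>\<^bsub>Z\<^esub> (\<psi> w' \<oplus>\<^bsub>Z\<^esub> r' \<odot>\<^bsub>Z\<^esub> z)"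
        using linear_onD(2)[OF \<psi> t(2,5)] \<psi>c[OF t(2)] \<psi>c[OF t(5)] t(3,6) z(1)
        by (simp add: Z.smult_l_distr Z.M.a_ac)
      finally show "\<chi> (t \<oplus>\<^bsub>ring_module R\<^esub> t') = \<chi> t \<oplus>\<^bsub>Z\<^esub> \<chi> t'"
        unfolding t(1,4) using \<chi>[OF t(2,3)] \<chi>[OF t(5,6)] by simp
    next
      fix s t assume s: "s \<in> carrier R" and "t \<in> ?I"
      then obtain w r where t: "t = w \<oplus> y \<otimes> r" "w \<in> I" "r \<in> carrier R" by blast
      have "s \<otimes> t = s \<otimes> w \<oplus> y \<otimes> (s \<otimes> r)" unfolding t(1) using Ic[OF t(2)] s t(3) y(1) by (simp add: r_distr m_ac)
      then have "\<chi> (s \<otimes> t) = \<psi> (s \<otimes> w) \<oplus>\<^bsub>Z\<^esub> (s \<otimes> r) \<odot>\<^bsub>Z\<^esub> z"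
        using \<chi>[OF ideal_mult_closed[OF I(1) s t(2)], of "s \<otimes> r"] t(3) s by simp
      also have "\<dots> = s \<odot>\<^bsub>Z\<^esub> (\<psi> w \<oplus>\<^bsub>Z\<^esub> r \<odot>\<^bsub>Z\<^esub> z)"
        using linear_onD(3)[OF \<psi> s t(2)] \<psi>c[OF t(2)] t(3) z(1) s
        by (simp add: Z.smult_r_distr Z.smult_assoc1)
      finally show "\<chi> (s \<odot>\<^bsub>ring_module R\<^esub> t) = s \<odot>\<^bsub>Z\<^esub> \<chi> t"
        unfolding t(1) using \<chi>[OF t(2,3)] by simp
    qed
    moreover have "\<chi> x = \<phi> x" if x: "x \<in> J" for x
    proof -
      have xI: "x \<in> I" using I(2) x by blast
      then show ?thesis using \<chi>[OF xI zero_closed] \<psi>J x y(1) z(1) Ic[OF xI] \<psi>c[OF xI] by simp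
    qed
    ultimately have "?I \<in> ?F" using I' I(2) by blast
    then have "?I = I" using max I'(2) by blast
    then show False using I'(3) y(2) by blast
  qed
  then have one: "\<one> \<in> I" by simp
  have "\<phi> x = x \<odot>\<^bsub>Z\<^esub> \<psi> \<one>" if x: "x \<in> J" for x
  proof -
    have "x \<in> carrier R" using ideal_carrier[OF J x] .
    then show ?thesis using linear_onD(3)[OF \<psi> _ one, of x] \<psi>J x by simp
  qed
  then show "\<exists>z\<in>carrier Z. \<forall>x\<in>J. \<phi> x = x \<odot>\<^bsub>Z\<^esub> z" using \<psi>c[OF one] by blast
qed

end

context cring
begin

lemma ext_vanishesD:
  assumes "ext_vanishes Z" "linear R (free_module R p) (free_module R m) A"
    "linear_on R (free_module R p) {x \<in> carrier (free_module R p). A x = \<zero>\<^bsub>free_module R m\<^esub>} Z u"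
  shows "\<exists>z. (\<forall>i<p. z i \<in> carrier Z) \<and> (\<forall>x\<in>carrier (free_module R p). A x = \<zero>\<^bsub>free_module R m\<^esub> \<longrightarrow>
        u x = (\<Oplus>\<^bsub>Z\<^esub>i\<in>{..<p}. x i \<odot>\<^bsub>Z\<^esub> z i))"
  using assms unfolding ext_vanishes_def by blast

text \<open>Since \<open>x\<close> is regular, sending \<open>r x\<close> to \<open>r z\<close> is
  well defined on the ideal \<open>x R\<close>.\<close>

lemma baer_divisible:
  assumes Z: "module R Z" and B: "baer R Z" and x: "x \<in> nonzerodivisors R" and z: "z \<in> carrier Z"
  shows "\<exists>w\<in>carrier Z. z = x \<odot>\<^bsub>Z\<^esub> w"
proof -
  interpret Z: module R Z by fact
  interpret M: module R "ring_module R" by (rule ring_module_module)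
  note xc = nonzerodivisor_closed[OF x]
  have mul: "linear R (ring_module R) (ring_module R) (\<lambda>r. r \<otimes> x)"
    by (rule linear_onI) (use xc in \<open>auto simp: l_distr m_assoc\<close>)
  have rz: "linear R (ring_module R) Z (\<lambda>r. r \<odot>\<^bsub>Z\<^esub> z)"
    by (rule linear_onI) (use z in \<open>auto simp: Z.smult_l_distr Z.smult_assoc1\<close>)
  have "r \<odot>\<^bsub>Z\<^esub> z = \<zero>\<^bsub>Z\<^esub>" if "r \<in> carrier (ring_module R)" "r \<otimes> x = \<zero>\<^bsub>ring_module R\<^esub>" for r
  proof -
    have "r = \<zero>" using nonzerodivisorD[OF x] that by simp
    then show ?thesis using z by simp
  qed
  from factor_through_image[OF ring_module_module ring_module_module Z M.carrier_is_submodule mul rz this]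
  obtain \<phi> where \<phi>: "linear_on R (ring_module R) ((\<lambda>r. r \<otimes> x) ` carrier R) Z \<phi>"
    and \<phi>x: "\<And>r. r \<in> carrier R \<Longrightarrow> \<phi> (r \<otimes> x) = r \<odot>\<^bsub>Z\<^esub> z" by auto
  have "ideal ((\<lambda>r. r \<otimes> x) ` carrier R) R"
    using submodule_ideal[OF linear_on_image[OF ring_module_module ring_module_module mul M.carrier_is_submodule]] by simp
  then obtain w where w: "w \<in> carrier Z" "\<forall>t\<in>(\<lambda>r. r \<otimes> x) ` carrier R. \<phi> t = t \<odot>\<^bsub>Z\<^esub> w"
    using B \<phi> unfolding baer_def by blast
  have "z = \<phi> (\<one> \<otimes> x)" using \<phi>x[OF one_closed] z by simp
  also have "\<dots> = (\<one> \<otimes> x) \<odot>\<^bsub>Z\<^esub> w" using w(2) by blast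
  also have "\<dots> = x \<odot>\<^bsub>Z\<^esub> w" using xc by simp
  finally show ?thesis using w(1) by blast
qed

lemma inverse_linear:
  assumes M: "module R M" and f: "linear R M N f" and bij: "bij_betw f (carrier M) (carrier N)"
  shows "linear R N M (inv_into (carrier M) f)"
proof -
  interpret M: module R M by fact
  let ?g = "inv_into (carrier M) f"
  have g: "?g y \<in> carrier M" "f (?g y) = y" if "y \<in> carrier N" for y
    using that bij by (auto simp: bij_betw_def inv_into_into f_inv_into_f)
  have gf: "?g (f x) = x" if "x \<in> carrier M" for x
    using that bij by (simp add: bij_betw_def)
  show ?thesis
  proof (rule linear_onI)
    fix x y assume xy: "x \<in> carrier N" "y \<in> carrier N"
    have "?g (f (?g x \<oplus>\<^bsub>M\<^esub> ?g y)) = ?g x \<oplus>\<^bsub>M\<^esub> ?g y" using g xy by (intro gf) auto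
    then show "?g (x \<oplus>\<^bsub>N\<^esub> y) = ?g x \<oplus>\<^bsub>M\<^esub> ?g y"
      using linear_onD(2)[OF f g(1)[OF xy(1)] g(1)[OF xy(2)]] g xy by simp
  next
    fix r x assume rx: "r \<in> carrier R" "x \<in> carrier N"
    have "?g (f (r \<odot>\<^bsub>M\<^esub> ?g x)) = r \<odot>\<^bsub>M\<^esub> ?g x" using g rx by (intro gf) auto
    then show "?g (r \<odot>\<^bsub>N\<^esub> x) = r \<odot>\<^bsub>M\<^esub> ?g x"
      using linear_onD(3)[OF f rx(1) g(1)[OF rx(2)]] g rx by simp
  qed (rule g)
qed

text \<open>The test modules of the definition of injectivity have carriers of type \<open>univ\<close>, so \<open>J\<close> and
  \<open>R\<close> are transported there along the injection of \<open>x\<close> to the singleton of the constant sequence.\<close>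

lemma injective_baer:
  fixes I :: "('a, 'c) module"
  assumes inj: "injective_module R I"
  shows "baer R I"
  unfolding baer_def
proof (intro allI impI)
  fix J \<phi> assume J: "ideal J R" and \<phi>: "linear_on R (ring_module R) J I \<phi>"
  have I: "module R I" using inj by (simp add: injective_module_def)
  interpret M: module R "ring_module R" by (rule ring_module_module)
  let ?J = "ring_module R \<lparr>carrier := J\<rparr>"
  have Jm: "module R ?J" by (rule submodule.submodule_is_module[OF ideal_submodule[OF J] ring_module_module])
  define s where "s x = {\<lambda>_::nat. x}" for x :: 'a
  have sinj: "inj_on s C" for C by (rule inj_onI) (auto simp: s_def fun_eq_iff)
  obtain A :: "('a, 'a univ) module" and \<alpha> where A: "module R A" and \<alpha>: "\<alpha> \<in> mod_hom R ?J A"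
    and \<alpha>b: "bij_betw \<alpha> (carrier ?J) (carrier A)" using transport_module[OF Jm sinj] by blast
  obtain B :: "('a, 'a univ) module" and \<beta> where B: "module R B" and \<beta>: "\<beta> \<in> mod_hom R (ring_module R) B"
    and \<beta>b: "bij_betw \<beta> (carrier (ring_module R)) (carrier B)"
    using transport_module[OF ring_module_module sinj] by blast
  define \<gamma> where "\<gamma> = inv_into (carrier ?J) \<alpha>"
  have \<gamma>: "linear R A ?J \<gamma>" unfolding \<gamma>_def by (rule inverse_linear[OF Jm mod_hom_linear[OF \<alpha>] \<alpha>b])
  have \<gamma>J: "\<gamma> y \<in> J" if "y \<in> carrier A" for y using linear_onD(1)[OF \<gamma> that] by simp
  have \<gamma>\<alpha>: "\<gamma> (\<alpha> x) = x" if "x \<in> J" for x using that \<alpha>b by (simp add: \<gamma>_def bij_betw_def)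
  have \<alpha>A: "\<alpha> x \<in> carrier A" if "x \<in> J" for x using mod_homD(1)[OF \<alpha>] that by simp
  have \<gamma>': "linear R A (ring_module R) \<gamma>"
    using \<gamma> \<gamma>J ideal_carrier[OF J] by (auto simp: linear_on_def)
  have "linear R A B (\<lambda>y. \<beta> (\<gamma> y))"
    by (rule linear_compose[OF \<gamma>' mod_hom_linear[OF \<beta>] linear_onD(1)[OF \<gamma>']])
  then have f: "restrict (\<lambda>y. \<beta> (\<gamma> y)) (carrier A) \<in> mod_hom R A B" by (rule linear_mod_hom[OF A])
  have "linear R A I (\<lambda>y. \<phi> (\<gamma> y))" by (rule linear_compose[OF \<gamma>' \<phi> \<gamma>J])
  then have g: "restrict (\<lambda>y. \<phi> (\<gamma> y)) (carrier A) \<in> mod_hom R A I" by (rule linear_mod_hom[OF A])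
  have "inj_on (restrict (\<lambda>y. \<beta> (\<gamma> y)) (carrier A)) (carrier A)"
  proof (rule inj_onI)
    fix x y assume xy: "x \<in> carrier A" "y \<in> carrier A"
      and eq: "restrict (\<lambda>y. \<beta> (\<gamma> y)) (carrier A) x = restrict (\<lambda>y. \<beta> (\<gamma> y)) (carrier A) y"
    have "\<gamma> x \<in> carrier (ring_module R)" "\<gamma> y \<in> carrier (ring_module R)"
      using linear_onD(1)[OF \<gamma>'] xy by blast+
    then have "\<gamma> x = \<gamma> y" using eq xy \<beta>b by (auto simp: bij_betw_def inj_on_def)
    moreover have "\<alpha> (\<gamma> x) = x" "\<alpha> (\<gamma> y) = y"
      using xy \<alpha>b by (auto simp: \<gamma>_def bij_betw_def f_inv_into_f)
    ultimately show "x = y" by metis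
  qed
  then obtain h where h: "h \<in> mod_hom R B I"
    and hf: "\<forall>x\<in>carrier A. h (restrict (\<lambda>y. \<beta> (\<gamma> y)) (carrier A) x) = restrict (\<lambda>y. \<phi> (\<gamma> y)) (carrier A) x"
    using inj f g A B unfolding injective_module_def by blast
  have \<beta>1: "\<beta> \<one> \<in> carrier B" using mod_homD(1)[OF \<beta>, of \<one>] by simp
  have "\<phi> x = x \<odot>\<^bsub>I\<^esub> h (\<beta> \<one>)" if x: "x \<in> J" for x
  proof -
    have xc: "x \<in> carrier R" using ideal_carrier[OF J x] .
    have "\<phi> x = h (\<beta> x)" using bspec[OF hf \<alpha>A[OF x]] \<alpha>A[OF x] \<gamma>\<alpha>[OF x] by simp
    also have "\<beta> x = x \<odot>\<^bsub>B\<^esub> \<beta> \<one>" using mod_homD(4)[OF \<beta> xc, of \<one>] xc by simp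
    also have "h (x \<odot>\<^bsub>B\<^esub> \<beta> \<one>) = x \<odot>\<^bsub>I\<^esub> h (\<beta> \<one>)" by (rule mod_homD(4)[OF h xc \<beta>1])
    finally show ?thesis .
  qed
  then show "\<exists>z\<in>carrier I. \<forall>x\<in>J. \<phi> x = x \<odot>\<^bsub>I\<^esub> z" using mod_homD(1)[OF h \<beta>1] by blast
qed

end

context curve_ring
begin

text \<open>A prime \<open>P\<close> is an annihilator, so that \<open>R/P\<close> embeds into \<open>R\<close>, or else it is
  \<open>(x R : y)\<close> for a nonzerodivisor \<open>x\<close>, so that \<open>R/P\<close> embeds into \<open>R/xR\<close>.\<close>

lemma baer_if_ext_vanishes_divisible:
  assumes Z: "module R Z" and E: "ext_vanishes Z"
    and div: "\<And>x z. x \<in> nonzerodivisors R \<Longrightarrow> z \<in> carrier Z \<Longrightarrow> \<exists>w\<in>carrier Z. z = x \<odot>\<^bsub>Z\<^esub> w"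
  shows "baer R Z"
proof (rule baer_from_primes[OF Z])
  fix P \<phi> assume P: "primeideal P R" and \<phi>: "linear_on R (ring_module R) P Z \<phi>"
  interpret Z: module R Z by fact
  have PI: "ideal P R" using P by (rule primeideal.axioms)
  note Pc = ideal_carrier[OF PI]
  have coord: "linear_on R (free_module R n) {v \<in> carrier (free_module R n). Q v} Z (\<lambda>v. \<phi> (v 0))"
    if "0 < n" "\<And>v. v \<in> carrier (free_module R n) \<Longrightarrow> Q v \<Longrightarrow> v 0 \<in> P" for n Q
    by (rule linear_compose[OF linear_on_subset[OF linear_coordinate[OF that(1)]] \<phi>]) (use that(2) in auto)
  let ?F1 = "free_module R 1" and ?F2 = "free_module R 2"
  consider a where "a \<in> carrier R" "P = annihilator R {a}"
    | x where "x \<in> P" "x \<in> nonzerodivisors R" using prime_is_annihilator_or_regular[OF P] by blast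
  then show "\<exists>z\<in>carrier Z. \<forall>x\<in>P. \<phi> x = x \<odot>\<^bsub>Z\<^esub> z"
  proof cases
    case 1
    define A where "A v = (\<lambda>i\<in>{..<1::nat}. v 0 \<otimes> a)" for v :: "nat \<Rightarrow> 'a"
    have A: "linear R ?F1 ?F1 A"
    proof (rule linear_onI)
      show "A v \<in> carrier ?F1" if "v \<in> carrier ?F1" for v
        unfolding A_def using free_closed[OF that] 1(1) by (intro free_restrict) auto
      show "A (v \<oplus>\<^bsub>?F1\<^esub> w) = A v \<oplus>\<^bsub>?F1\<^esub> A w"
        if "v \<in> carrier ?F1" "w \<in> carrier ?F1" for v w
        using free_closed[OF that(1)] free_closed[OF that(2)] 1(1)
        by (auto simp: A_def free_add l_distr intro!: restrict_ext)
      show "A (r \<odot>\<^bsub>?F1\<^esub> v) = r \<odot>\<^bsub>?F1\<^esub> A v"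
        if "r \<in> carrier R" "v \<in> carrier ?F1" for r v
        using free_closed[OF that(2)] that(1) 1(1)
        by (auto simp: A_def free_smult m_assoc intro!: restrict_ext)
    qed
    have A0: "A v = \<zero>\<^bsub>?F1\<^esub> \<longleftrightarrow> v 0 \<in> P" if "v \<in> carrier ?F1" for v
    proof -
      have "A v = \<zero>\<^bsub>?F1\<^esub> \<longleftrightarrow> v 0 \<otimes> a = \<zero>"
        by (auto simp: A_def free_zero fun_eq_iff restrict_def)
      then show ?thesis using free_closed[OF that, of 0] unfolding 1(2) annihilator_def by simp
    qed
    have "linear_on R ?F1 {v \<in> carrier ?F1. A v = \<zero>\<^bsub>?F1\<^esub>} Z (\<lambda>v. \<phi> (v 0))"
      by (rule coord) (use A0 in auto)
    then obtain z where z: "\<forall>i<1. z i \<in> carrier Z"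
      and \<phi>z: "\<forall>v\<in>carrier ?F1. A v = \<zero>\<^bsub>?F1\<^esub> \<longrightarrow>
        \<phi> (v 0) = (\<Oplus>\<^bsub>Z\<^esub>i\<in>{..<1}. v i \<odot>\<^bsub>Z\<^esub> z i)"
      using ext_vanishesD[OF E A] by blast
    have "\<phi> r = r \<odot>\<^bsub>Z\<^esub> z 0" if r: "r \<in> P" for r
    proof -
      define v where "v = (\<lambda>i\<in>{..<1::nat}. r)"
      have v: "v \<in> carrier ?F1" "v 0 = r" using Pc[OF r] by (auto simp: v_def free_carrier)
      have "\<phi> (v 0) = (\<Oplus>\<^bsub>Z\<^esub>i\<in>{..<1}. v i \<odot>\<^bsub>Z\<^esub> z i)"
        using \<phi>z v A0[OF v(1)] r by blast
      then show ?thesis using v z Pc[OF r] by (simp add: lessThan_Suc)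
    qed
    then show ?thesis using z by auto
  next
    case (2 x)
    note xc = nonzerodivisor_closed[OF 2(2)]
    have xR: "ideal (PIdl x) R" by (rule cgenideal_ideal[OF xc])
    have xRP: "PIdl x \<subseteq> P" by (rule cgenideal_minimal[OF PI 2(1)])
    have "\<one> \<notin> P" using primeideal.I_notcarr[OF P] ideal.one_imp_carrier[OF PI] by auto
    then have "PIdl x \<noteq> carrier R" using xRP by auto
    then obtain y where y: "y \<in> carrier R" "y \<notin> PIdl x"
      and Q: "primeideal {r \<in> carrier R. r \<otimes> y \<in> PIdl x} R" using maximal_colon_prime[OF xR] by blast
    have "x \<otimes> y \<in> PIdl x" using ideal.I_r_closed[OF xR cgenideal_self[OF xc] y(1)] .
    \<comment> \<open>Both sides are primes containing the nonzerodivisor \<open>x\<close>, so both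
      are the maximal ideal.\<close>
    then have "{r \<in> carrier R. r \<otimes> y \<in> PIdl x} = P"
      using prime_with_regular_is_M0[OF Q _ 2(2)] prime_with_regular_is_M0[OF P 2] xc by simp
    then have Py: "r \<in> P \<longleftrightarrow> r \<in> carrier R \<and> (\<exists>s\<in>carrier R. r \<otimes> y = s \<otimes> x)" for r
      by (auto simp: cgenideal_def)
    \<comment> \<open>The kernel consists of the pairs \<open>(r, s)\<close> with
      \<open>r y = s x\<close>, and its first components are exactly the elements of
      \<open>P\<close>. The image is the ideal generated by \<open>x\<close> and
      \<open>y\<close>.\<close>
    define A where "A v = (\<lambda>i\<in>{..<1::nat}. v 0 \<otimes> y \<ominus> v 1 \<otimes> x)" for v :: "nat \<Rightarrow> 'a"
    have A: "linear R ?F2 ?F1 A"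
    proof (rule linear_onI)
      show "A v \<in> carrier ?F1" if "v \<in> carrier ?F2" for v
        unfolding A_def using free_closed[OF that] xc y(1) by (intro free_restrict) auto
      have "(p \<oplus> p') \<otimes> y \<ominus> (q \<oplus> q') \<otimes> x = (p \<otimes> y \<ominus> q \<otimes> x) \<oplus> (p' \<otimes> y \<ominus> q' \<otimes> x)"
        if "p \<in> carrier R" "p' \<in> carrier R" "q \<in> carrier R" "q' \<in> carrier R" for p p' q q'
        using that xc y(1) by (simp add: ring_arith)
      then show "A (v \<oplus>\<^bsub>?F2\<^esub> w) = A v \<oplus>\<^bsub>?F1\<^esub> A w"
        if "v \<in> carrier ?F2" "w \<in> carrier ?F2" for v w
        using free_closed[OF that(1)] free_closed[OF that(2)]
        by (auto simp: A_def free_add intro!: restrict_ext)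
      have "(r \<otimes> p) \<otimes> y \<ominus> (r \<otimes> q) \<otimes> x = r \<otimes> (p \<otimes> y \<ominus> q \<otimes> x)"
        if "p \<in> carrier R" "q \<in> carrier R" "r \<in> carrier R" for p q r
        using that xc y(1) by (simp add: ring_arith)
      then show "A (r \<odot>\<^bsub>?F2\<^esub> v) = r \<odot>\<^bsub>?F1\<^esub> A v"
        if "r \<in> carrier R" "v \<in> carrier ?F2" for r v
        using free_closed[OF that(2)] that(1)
        by (auto simp: A_def free_smult intro!: restrict_ext)
    qed
    have A0: "A v = \<zero>\<^bsub>?F1\<^esub> \<longleftrightarrow> v 0 \<otimes> y = v 1 \<otimes> x" if "v \<in> carrier ?F2" for v
    proof -
      have "A v = \<zero>\<^bsub>?F1\<^esub> \<longleftrightarrow> v 0 \<otimes> y \<ominus> v 1 \<otimes> x = \<zero>"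
        by (auto simp: A_def free_zero fun_eq_iff restrict_def)
      then show ?thesis using free_closed[OF that, of 0] free_closed[OF that, of 1] xc y(1) by simp
    qed
    have "v 0 \<in> P" if v: "v \<in> carrier ?F2" and Av: "A v = \<zero>\<^bsub>?F1\<^esub>" for v
      using A0[OF v] Av Py free_closed[OF v, of 0] free_closed[OF v, of 1] by auto
    then have "linear_on R ?F2 {v \<in> carrier ?F2. A v = \<zero>\<^bsub>?F1\<^esub>} Z (\<lambda>v. \<phi> (v 0))"
      by (intro coord) auto
    then obtain z where z: "\<forall>i<2. z i \<in> carrier Z"
      and \<phi>z: "\<forall>v\<in>carrier ?F2. A v = \<zero>\<^bsub>?F1\<^esub> \<longrightarrow>
        \<phi> (v 0) = (\<Oplus>\<^bsub>Z\<^esub>i\<in>{..<2}. v i \<odot>\<^bsub>Z\<^esub> z i)"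
      using ext_vanishesD[OF E A] by blast
    have z0: "z 0 \<in> carrier Z" and z1: "z 1 \<in> carrier Z" using z by auto
    \<comment> \<open>Divisibility removes the second component:
      \<open>s z 1 = s x w = r y w\<close>, so the value at \<open>r\<close> becomes a multiple of
      \<open>r\<close> alone.\<close>
    obtain w where w: "w \<in> carrier Z" "z 1 = x \<odot>\<^bsub>Z\<^esub> w" using div[OF 2(2) z1] by blast
    have "\<phi> r = r \<odot>\<^bsub>Z\<^esub> (z 0 \<oplus>\<^bsub>Z\<^esub> y \<odot>\<^bsub>Z\<^esub> w)" if r: "r \<in> P" for r
    proof -
      obtain s where s: "s \<in> carrier R" "r \<otimes> y = s \<otimes> x" using Py r by blast
      define v where "v = (\<lambda>i\<in>{..<2::nat}. if i = 0 then r else s)"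
      have v: "v \<in> carrier ?F2" "v 0 = r" "v 1 = s"
        using Pc[OF r] s(1) by (auto simp: v_def free_carrier)
      have "A v = \<zero>\<^bsub>?F1\<^esub>" using A0[OF v(1)] v(2,3) s(2) by simp
      then have "\<phi> (v 0) = (\<Oplus>\<^bsub>Z\<^esub>i\<in>{..<2}. v i \<odot>\<^bsub>Z\<^esub> z i)" using \<phi>z v(1) by blast
      also have "\<dots> = r \<odot>\<^bsub>Z\<^esub> z 0 \<oplus>\<^bsub>Z\<^esub> s \<odot>\<^bsub>Z\<^esub> z 1"
      proof -
        have "{..<2::nat} = {0, 1}" by auto
        then show ?thesis using v z0 z1 Pc[OF r] s(1) by simp
      qed
      also have "\<dots> = r \<odot>\<^bsub>Z\<^esub> (z 0 \<oplus>\<^bsub>Z\<^esub> y \<odot>\<^bsub>Z\<^esub> w)"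
        using Pc[OF r] s z0 w y(1) xc by (simp add: Z.smult_r_distr flip: Z.smult_assoc1)
      finally show ?thesis using v(2) by simp
    qed
    then show ?thesis using z0 w(1) y(1) by blast
  qed
qed

lemma baer_descends:
  fixes Z :: "('a, 'z) module" and I :: "('a, 'c) module" and Z' :: "('a, 'd) module"
  assumes Z: "module R Z" and I: "module R I" and Z': "module R Z'"
    and j: "linear R Z I j" "inj_on j (carrier Z)"
    and \<pi>: "linear R I Z' \<pi>" "\<pi> ` carrier I = carrier Z'"
    and exact: "j ` carrier Z = {x \<in> carrier I. \<pi> x = \<zero>\<^bsub>Z'\<^esub>}"
    and BI: "baer R I" and BZ': "baer R Z'"
    and div: "\<And>x z. x \<in> nonzerodivisors R \<Longrightarrow> z \<in> carrier Z \<Longrightarrow> \<exists>w\<in>carrier Z. z = x \<odot>\<^bsub>Z\<^esub> w"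
  shows "baer R Z"
  using baer_if_ext_vanishes_divisible[OF Z ext_vanishesI_short_exact[OF Z I Z' j \<pi> exact BI BZ'] div] .

text \<open>Let \<open>Z i\<close> be the image of \<open>d i\<close>, the cosyzygy following
  \<open>I i\<close>. As an image of an injective module it is divisible by nonzerodivisors; beyond
  the length of the resolution it is zero. In the sequence from \<open>Z i\<close> through
  \<open>I (Suc i)\<close> to \<open>Z (Suc i)\<close>, injectivity passes from right to left by
  \<open>baer_descends\<close>, until \<open>Z 0\<close> is reached. The sequence from
  \<open>R\<close> through \<open>I 0\<close> to \<open>Z 0\<close> then gives the claim. The
  descent stops there because \<open>R\<close> itself need not be divisible.\<close>

lemma gorenstein_ext_vanishes:
  assumes "gorenstein_ring R" shows "ext_vanishes (ring_module R)"
proof -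
  obtain I :: "nat \<Rightarrow> ('a, 'a univ) module" and e d n where
    res: "injective_resolution R (ring_module R) I e d" and top: "\<forall>i>n. carrier (I i) = {\<zero>\<^bsub>I i\<^esub>}"
    using assms unfolding gorenstein_ring_def finite_injective_dimension_def by blast
  have inj: "injective_module R (I i)" for i using res by (simp add: injective_resolution_def)
  have I: "module R (I i)" for i using inj by (simp add: injective_module_def)
  have B: "baer R (I i)" for i by (rule injective_baer[OF inj])
  have dh: "d i \<in> mod_hom R (I i) (I (Suc i))" for i using res by (simp add: injective_resolution_def)
  note dl = mod_hom_linear[OF dh]
  have exact: "d i ` carrier (I i) = {x \<in> carrier (I (Suc i)). d (Suc i) x = \<zero>\<^bsub>I (Suc (Suc i))\<^esub>}" for i
    using res by (simp add: injective_resolution_def a_kernel_eq)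
  define Z where "Z i = I (Suc i) \<lparr>carrier := d i ` carrier (I i)\<rparr>" for i
  have Zsub: "submodule (d i ` carrier (I i)) R (I (Suc i))" for i
    by (rule linear_on_image[OF I I dl module.carrier_is_submodule[OF I]])
  have Z: "module R (Z i)" for i
    unfolding Z_def by (rule submodule.submodule_is_module[OF Zsub I])
  have Zc: "carrier (Z i) = d i ` carrier (I i)" "\<zero>\<^bsub>Z i\<^esub> = \<zero>\<^bsub>I (Suc i)\<^esub>" for i by (simp_all add: Z_def)
  have onto: "linear R (I i) (Z i) (d i)" for i
    using dl[of i] by (auto simp: linear_on_def Z_def)
  have incl: "linear R (Z i) (I (Suc i)) (\<lambda>x. x)" for i
    using linear_onD(1)[OF dl[of i]] by (auto simp: linear_on_def Z_def)
  have div: "\<exists>w\<in>carrier (Z i). z = x \<odot>\<^bsub>Z i\<^esub> w" if x: "x \<in> nonzerodivisors R" and z: "z \<in> carrier (Z i)" for i x z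
  proof -
    obtain y where y: "y \<in> carrier (I i)" "z = d i y" using z unfolding Zc by blast
    obtain w where w: "w \<in> carrier (I i)" "y = x \<odot>\<^bsub>I i\<^esub> w" using baer_divisible[OF I B x y(1)] by blast
    have "z = x \<odot>\<^bsub>Z i\<^esub> d i w"
      unfolding y(2) w(2) using linear_onD(3)[OF dl nonzerodivisor_closed[OF x] w(1)] by (simp add: Z_def)
    then show ?thesis using w(1) unfolding Zc by blast
  qed
  \<comment> \<open>\<open>Z i\<close> lies in \<open>I (Suc i)\<close>, so it is zero already for
    \<open>i = n\<close>.\<close>
  have BZtop: "baer R (Z i)" if i: "i \<ge> n" for i
    unfolding baer_def
  proof (intro allI impI)
    fix J \<phi> assume J: "ideal J R" and \<phi>: "linear_on R (ring_module R) J (Z i) \<phi>"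
    interpret Z: module R "Z i" by (rule Z)
    have "carrier (Z i) \<subseteq> carrier (I (Suc i))" unfolding Zc using linear_onD(1)[OF dl[of i]] by blast
    then have triv: "x = \<zero>\<^bsub>Z i\<^esub>" if "x \<in> carrier (Z i)" for x using that top i by (auto simp: Zc(2))
    have "\<phi> x = x \<odot>\<^bsub>Z i\<^esub> \<zero>\<^bsub>Z i\<^esub>" if "x \<in> J" for x
      using triv[OF linear_onD(1)[OF \<phi> that]] ideal_carrier[OF J that] by simp
    then show "\<exists>z\<in>carrier (Z i). \<forall>x\<in>J. \<phi> x = x \<odot>\<^bsub>Z i\<^esub> z" by blast
  qed
  have step: "baer R (Z i)" if B': "baer R (Z (Suc i))" for i
  proof (rule baer_descends[OF Z I Z incl _ onto _ _ B B' div])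
    show "inj_on (\<lambda>x. x) (carrier (Z i))" by (rule inj_onI)
    show "d (Suc i) ` carrier (I (Suc i)) = carrier (Z (Suc i))" by (simp add: Zc)
    show "(\<lambda>x. x) ` carrier (Z i) = {x \<in> carrier (I (Suc i)). d (Suc i) x = \<zero>\<^bsub>Z (Suc i)\<^esub>}"
      unfolding Zc exact by simp
  qed
  have "baer R (Z (n - i))" for i
  proof (induction i)
    case (Suc i)
    show ?case
    proof (cases "i < n")
      case True
      then have "Suc (n - Suc i) = n - i" by simp
      then show ?thesis using step[of "n - Suc i"] Suc by simp
    qed (use Suc in simp)
  qed (simp add: BZtop)
  from this[of n] have B0: "baer R (Z 0)" by simp
  show ?thesis
  proof (rule ext_vanishesI_short_exact[OF ring_module_module I Z _ _ onto _ _ B B0])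
    show "linear R (ring_module R) (I 0) e"
      by (rule mod_hom_linear) (use res in \<open>simp add: injective_resolution_def\<close>)
    show "inj_on e (carrier (ring_module R))"
      using res by (simp add: injective_resolution_def)
    show "d 0 ` carrier (I 0) = carrier (Z 0)" by (simp add: Zc)
    show "e ` carrier (ring_module R) = {x \<in> carrier (I 0). d 0 x = \<zero>\<^bsub>Z 0\<^esub>}"
      using res by (simp add: injective_resolution_def a_kernel_eq Zc)
  qed
qed

end

section \<open>Factoring multiplications through free modules\<close>

context cring
begin

lemma fin_gen_if_image_of_free:
  assumes M: "module R M" and f: "linear R (free_module R m) M f"
    and onto: "f ` carrier (free_module R m) = carrier M"
  shows "fin_gen_module R M"
  unfolding fin_gen_module_def
proof (intro conjI M exI[of _ m] bexI[of _ "\<lambda>i. f (unit_vec m i)"] ballI)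
  show "(\<lambda>i. f (unit_vec m i)) \<in> {..<m} \<rightarrow> carrier M"
    using linear_onD(1)[OF f unit_vec_closed] by blast
  fix x assume "x \<in> carrier M"
  then obtain y where y: "y \<in> carrier (free_module R m)" "x = f y" using onto by blast
  have "y \<in> {..<m} \<rightarrow> carrier R" using y(1) by (auto simp: free_carrier)
  then show "\<exists>c\<in>{..<m} \<rightarrow> carrier R. x = (\<Oplus>\<^bsub>M\<^esub>i\<in>{..<m}. c i \<odot>\<^bsub>M\<^esub> f (unit_vec m i))"
    using linear_expand[OF M f y(1)] y(2) by blast
qed

text \<open>\<open>coh_ann_n\<close> tests modules with carriers in \<open>univ\<close> only. This
  moves ideals and syzygies there; \<open>\<theta>'\<close> goes back into the ambient module
  \<open>M\<close>, where the remaining computation takes place.\<close>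

lemma transport_submodule:
  fixes M :: "('a, 'z) module" and s :: "'z \<Rightarrow> 'w"
  assumes M: "module R M" and S: "submodule S R M" and s: "inj s"
  shows "\<exists>(N :: ('a, 'w) module) \<theta> \<theta>'. module R N \<and> linear_on R M S N \<theta> \<and> \<theta> ` S = carrier N \<and>
    linear R N M \<theta>' \<and> (\<forall>x\<in>S. \<theta>' (\<theta> x) = x)"
proof -
  let ?S = "M \<lparr>carrier := S\<rparr>"
  have Sm: "module R ?S" by (rule submodule.submodule_is_module[OF S M])
  have "inj_on s (carrier ?S)" using s by (rule inj_on_subset) simp
  from transport_module[OF Sm this] obtain N :: "('a, 'w) module" and \<theta>
    where N: "module R N" and \<theta>: "\<theta> \<in> mod_hom R ?S N" and bij: "bij_betw \<theta> (carrier ?S) (carrier N)"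
    by blast
  have lin: "linear R ?S N \<theta>" by (rule mod_hom_linear[OF \<theta>])
  define \<theta>' where "\<theta>' = inv_into S \<theta>"
  have "linear R N ?S \<theta>'" using inverse_linear[OF Sm lin bij] by (simp add: \<theta>'_def)
  then have "linear R N M \<theta>'"
    using module.submoduleE(1)[OF M S] by (auto simp: linear_on_def)
  moreover have "linear_on R M S N \<theta>" using lin by (simp add: linear_on_def)
  moreover have "\<theta> ` S = carrier N" "\<forall>x\<in>S. \<theta>' (\<theta> x) = x"
    using bij by (auto simp: bij_betw_def \<theta>'_def)
  ultimately show ?thesis using N by blast
qed

lemma linear_difference:
  assumes M: "module R M" and r: "r \<in> carrier R" and G: "linear R M M G"
  shows "linear R M M (\<lambda>y. r \<odot>\<^bsub>M\<^esub> y \<ominus>\<^bsub>M\<^esub> G y)"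
proof -
  interpret M: module R M by fact
  note Gc = linear_onD(1)[OF G]
  show ?thesis
  proof (rule linear_onI)
    show "r \<odot>\<^bsub>M\<^esub> y \<ominus>\<^bsub>M\<^esub> G y \<in> carrier M" if "y \<in> carrier M" for y using that r Gc by simp
    show "r \<odot>\<^bsub>M\<^esub> (x \<oplus>\<^bsub>M\<^esub> y) \<ominus>\<^bsub>M\<^esub> G (x \<oplus>\<^bsub>M\<^esub> y) = (r \<odot>\<^bsub>M\<^esub> x \<ominus>\<^bsub>M\<^esub> G x) \<oplus>\<^bsub>M\<^esub> (r \<odot>\<^bsub>M\<^esub> y \<ominus>\<^bsub>M\<^esub> G y)"
      if "x \<in> carrier M" "y \<in> carrier M" for x y
      using that r Gc linear_onD(2)[OF G that]
      by (simp add: M.smult_r_distr a_minus_def M.M.minus_add M.M.a_ac)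
    show "r \<odot>\<^bsub>M\<^esub> (s \<odot>\<^bsub>M\<^esub> y) \<ominus>\<^bsub>M\<^esub> G (s \<odot>\<^bsub>M\<^esub> y) = s \<odot>\<^bsub>M\<^esub> (r \<odot>\<^bsub>M\<^esub> y \<ominus>\<^bsub>M\<^esub> G y)"
      if "s \<in> carrier R" "y \<in> carrier M" for s y
      using that r Gc linear_onD(3)[OF G that]
      by (simp add: M.smult_r_distr M.smult_r_minus a_minus_def m_comm flip: M.smult_assoc1)
  qed
qed

text \<open>Coordinate by coordinate: each component of \<open>u\<close> extends separately, and the
  extensions are reassembled as images of the unit vectors.\<close>

lemma ext_vanishes_free:
  assumes E: "ext_vanishes (ring_module R)"
    and A: "linear R (free_module R p) (free_module R m) A"
    and u: "linear_on R (free_module R p) {x \<in> carrier (free_module R p). A x = \<zero>\<^bsub>free_module R m\<^esub>}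
      (free_module R q) u"
  shows "\<exists>v. linear R (free_module R p) (free_module R q) v \<and>
    (\<forall>x\<in>carrier (free_module R p). A x = \<zero>\<^bsub>free_module R m\<^esub> \<longrightarrow> v x = u x)"
proof -
  let ?K = "{x \<in> carrier (free_module R p). A x = \<zero>\<^bsub>free_module R m\<^esub>}"
  have "\<forall>l\<in>{..<q}. \<exists>z. (\<forall>i<p. z i \<in> carrier R) \<and> (\<forall>x\<in>carrier (free_module R p).
      A x = \<zero>\<^bsub>free_module R m\<^esub> \<longrightarrow> u x l = (\<Oplus>i\<in>{..<p}. x i \<otimes> z i))"
  proof
    fix l assume "l \<in> {..<q}"
    then have "linear R (free_module R q) (ring_module R) (\<lambda>x. x l)" by (intro linear_coordinate) simp
    then have "linear_on R (free_module R p) ?K (ring_module R) (\<lambda>x. u x l)"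
      by (rule linear_compose[OF u _ linear_onD(1)[OF u]])
    from ext_vanishesD[OF E A this]
    show "\<exists>z. (\<forall>i<p. z i \<in> carrier R) \<and> (\<forall>x\<in>carrier (free_module R p).
      A x = \<zero>\<^bsub>free_module R m\<^esub> \<longrightarrow> u x l = (\<Oplus>i\<in>{..<p}. x i \<otimes> z i))" by simp
  qed
  then obtain z where z: "\<forall>l\<in>{..<q}. (\<forall>i<p. z l i \<in> carrier R) \<and>
      (\<forall>x\<in>carrier (free_module R p).
      A x = \<zero>\<^bsub>free_module R m\<^esub> \<longrightarrow> u x l = (\<Oplus>i\<in>{..<p}. x i \<otimes> z l i))" by (rule bchoice[THEN exE])
  define c where "c i = (\<lambda>l\<in>{..<q}. z l i)" for i
  have c: "c i \<in> carrier (free_module R q)" if "i < p" for i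
    unfolding c_def using z that by (intro free_restrict) auto
  define v where "v x = (\<Oplus>\<^bsub>free_module R q\<^esub>i\<in>{..<p}. x i \<odot>\<^bsub>free_module R q\<^esub> c i)" for x
  have v: "linear R (free_module R p) (free_module R q) v"
    unfolding v_def[abs_def] by (rule linear_combination[OF free_module_module c])
  have "v x = u x" if x: "x \<in> ?K" for x
  proof (rule free_eqI)
    have xc: "x \<in> carrier (free_module R p)" using x by simp
    show "v x \<in> carrier (free_module R q)" by (rule linear_onD(1)[OF v xc])
    show "u x \<in> carrier (free_module R q)" by (rule linear_onD(1)[OF u x])
    fix l assume l: "l < q"
    have vl: "linear R (free_module R p) (ring_module R) (\<lambda>x. v x l)"
      by (rule linear_compose[OF v linear_coordinate[OF l] linear_onD(1)[OF v]])
    have "v (unit_vec p i) = c i" if "i < p" for i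
      unfolding v_def by (rule linear_combination_unit[OF free_module_module c that])
    then have "v (unit_vec p i) l = z l i" if "i < p" for i using that l by (simp add: c_def)
    then have "v x l = (\<Oplus>i\<in>{..<p}. x i \<otimes> z l i)"
      unfolding linear_expand[OF ring_module_module vl xc] ring_module_finsum ring_module_simps
      using free_closed[OF xc] z l by (intro finsum_cong') auto
    then show "v x l = u x l" using z l x by simp
  qed
  then show ?thesis using v by blast
qed

end

context noetherian_cring
begin

text \<open>If \<open>r\<close> annihilates all \<open>Ext\<^sup>n(J, _)\<close>, multiplication by \<open>r\<close> on the \<open>n\<close>-th syzygy of \<open>J\<close>
  extends to the free module containing it. By the vanishing of \<open>Ext\<close> into \<open>R\<close>, this descends to the
  lower syzygies, and finally multiplication by \<open>r\<close> on \<open>J\<close> factors through a free module.\<close>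

lemma coh_ann_factors_through_free:
  assumes E: "ext_vanishes (ring_module R)" and r: "r \<in> coh_ann_n R n" and J: "ideal J R"
  shows "\<exists>p u c. (\<forall>k<p::nat. linear_on R (ring_module R) J (ring_module R) (u k) \<and> c k \<in> J) \<and>
    (\<forall>z\<in>J. r \<otimes> z = (\<Oplus>k\<in>{..<p}. u k z \<otimes> c k))"
proof -
  note fm = free_module_module and rm = ring_module_module
  have rc: "r \<in> carrier R" using r by (simp add: coh_ann_n_def)
  interpret RM: module R "ring_module R" by (rule rm)
  have Jsub: "submodule J R (ring_module R)" by (rule ideal_submodule[OF J])
  have "inj (\<lambda>x::'a. {\<lambda>_::nat. x})" by (rule injI) (simp add: fun_eq_iff)
  from transport_submodule[OF rm Jsub this] obtain M :: "('a, 'a univ) module" and \<theta> \<theta>' where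
    M: "module R M" and \<theta>: "linear_on R (ring_module R) J M \<theta>" and \<theta>J: "\<theta> ` J = carrier M"
    and \<theta>': "linear R M (ring_module R) \<theta>'" and \<theta>'\<theta>: "\<forall>x\<in>J. \<theta>' (\<theta> x) = x"
    by (elim exE conjE)
  interpret M: module R M by fact
  have \<theta>'J: "\<theta>' y \<in> J" "\<theta> (\<theta>' y) = y" if "y \<in> carrier M" for y
  proof -
    have "y \<in> \<theta> ` J" using \<theta>J that by simp
    then obtain x where "y = \<theta> x" "x \<in> J" by (rule imageE)
    then show "\<theta>' y \<in> J" "\<theta> (\<theta>' y) = y" using \<theta>'\<theta> by simp_all
  qed
  have fgM: "fin_gen_module R M"
  proof -
    interpret F1: module R "free_module R (Suc 0)" by (rule fm)
    have c0: "linear R (free_module R (Suc 0)) (ring_module R) (\<lambda>v. v 0)" by (rule linear_coordinate) simp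
    \<comment> \<open>\<open>J\<close> as a submodule of the free module of rank one, which is where
      finite generation is available in the form of a surjection from a free module.\<close>
    let ?J = "{v \<in> carrier (free_module R (Suc 0)). v 0 \<in> J}"
    have "submodule ?J R (free_module R (Suc 0))"
    proof (rule F1.submodule_intro)
      show "\<zero>\<^bsub>free_module R (Suc 0)\<^esub> \<in> ?J"
        using linear_on_zero[OF fm rm c0 F1.carrier_is_submodule] ideal_zero[OF J] by simp
    qed (use linear_onD[OF c0] ideal_add_closed[OF J] ideal_mult_closed[OF J] in auto)
    then obtain m \<phi> where \<phi>: "\<phi> \<in> mod_hom R (free_module R m) (free_module R (Suc 0))"
      and img: "\<phi> ` carrier (free_module R m) = ?J" using free_submodule_image by blast
    have "linear R (free_module R m) (ring_module R) (\<lambda>x. \<phi> x 0)"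
      by (rule linear_compose[OF mod_hom_linear[OF \<phi>] c0 mod_homD(1)[OF \<phi>]])
    then have lin: "linear R (free_module R m) M (\<lambda>x. \<theta> (\<phi> x 0))"
      by (rule linear_compose[OF _ \<theta>]) (use img in blast)
    have "(\<lambda>x. \<phi> x 0) ` carrier (free_module R m) = (\<lambda>v. v 0) ` ?J" unfolding img[symmetric] by blast
    also have "\<dots> = J"
    proof
      show "J \<subseteq> (\<lambda>v. v 0) ` ?J"
      proof
        fix x assume x: "x \<in> J"
        have "(\<lambda>i\<in>{..<Suc 0}. x) \<in> ?J" using x ideal_carrier[OF J x] by (auto simp: free_carrier)
        moreover have "x = (\<lambda>i\<in>{..<Suc 0}. x) 0" by simp
        ultimately show "x \<in> (\<lambda>v. v 0) ` ?J" by blast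
      qed
    qed auto
    finally have "(\<lambda>x. \<phi> x 0) ` carrier (free_module R m) = J" .
    then have "(\<lambda>x. \<theta> (\<phi> x 0)) ` carrier (free_module R m) = carrier M"
      unfolding \<theta>J[symmetric] by (metis image_image)
    then show ?thesis by (rule fin_gen_if_image_of_free[OF M lin])
  qed
  obtain b d e where chosen: "chosen_resolution R M = (b, d)" and res: "free_resolution R M b d e"
    using chosen_resolution_resolution[OF fgM] by blast
  let ?F = "\<lambda>i. free_module R (b i)"
  have e: "e \<in> mod_hom R (?F 0) M" and eonto: "e ` carrier (?F 0) = carrier M"
    and dh: "d i \<in> mod_hom R (?F (Suc i)) (?F i)"
    and ex0: "d 0 ` carrier (?F (Suc 0)) = {x \<in> carrier (?F 0). e x = \<zero>\<^bsub>M\<^esub>}"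
    and exS: "d (Suc i) ` carrier (?F (Suc (Suc i))) = {x \<in> carrier (?F (Suc i)). d i x = \<zero>\<^bsub>?F i\<^esub>}" for i
    using res by (simp_all add: free_resolution_def Let_def a_kernel_eq)
  note dl = mod_hom_linear[OF dh] and el = mod_hom_linear[OF e]
  have Fsub: "submodule (carrier (?F i)) R (?F i)" for i by (rule module.carrier_is_submodule[OF fm])
  define K where "K i = d i ` carrier (?F (Suc i))" for i
  have Ksub: "submodule (K i) R (?F i)" for i
    unfolding K_def by (rule linear_on_image[OF fm fm dl Fsub])
  have killed: "(\<lambda>x\<in>carrier (?F n). r \<odot>\<^bsub>N\<^esub> f x) \<in> coboundaries R b d N n"
    if N: "fin_gen_module R N" and f: "f \<in> cocycles R b d N n" for N :: "('a, 'a univ) module" and f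
  proof -
    have "r \<in> mod_ann R (ext_module R n M N)" using r fgM N by (simp add: coh_ann_n_def)
    then show ?thesis
      using ext_annihilated_iff[OF _ rc chosen res, of N n] N f by (simp add: fin_gen_module_def)
  qed
  show ?thesis
  proof (cases n)
    case 0
    \<comment> \<open>In degree zero Ext is Hom, and \<open>e\<close> represents the identity of
      \<open>M\<close>. So \<open>r\<close> kills \<open>J\<close>, and the empty sum
      serves.\<close>
    have "e \<in> cocycles R b d M 0"
      unfolding cocycles_def using e ex0 by auto
    then have "(\<lambda>x\<in>carrier (?F 0). r \<odot>\<^bsub>M\<^esub> e x) \<in> coboundaries R b d M 0"
      using killed[OF fgM] 0 by simp
    then have re: "(\<lambda>x\<in>carrier (?F 0). r \<odot>\<^bsub>M\<^esub> e x) = (\<lambda>x\<in>carrier (?F 0). \<zero>\<^bsub>M\<^esub>)"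
      by (simp add: hom_module_simps)
    have "r \<otimes> z = \<zero>" if z: "z \<in> J" for z
    proof -
      have "\<theta> z \<in> e ` carrier (?F 0)" unfolding eonto using linear_onD(1)[OF \<theta> z] .
      then obtain x where x: "x \<in> carrier (?F 0)" "\<theta> z = e x" by auto
      have "r \<odot>\<^bsub>M\<^esub> \<theta> z = \<zero>\<^bsub>M\<^esub>" using fun_cong[OF re, of x] x by simp
      then have "\<theta>' (\<theta> (r \<otimes> z)) = \<theta>' \<zero>\<^bsub>M\<^esub>" using linear_onD(3)[OF \<theta> rc z] by simp
      then show ?thesis
        using \<theta>'\<theta> ideal_mult_closed[OF J rc z] linear_on_zero[OF M rm \<theta>' M.carrier_is_submodule] by simp
    qed
    then show ?thesis by (intro exI[of _ 0]) simp
  next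
    case (Suc m)
    \<comment> \<open>\<open>K i\<close> is the image of \<open>d i\<close> in \<open>F i\<close>.
      The statement \<open>P i\<close> says that multiplication by \<open>r\<close> on this syzygy
      extends to a map from all of \<open>F i\<close> into \<open>K i\<close>.\<close>
    define P where "P i \<longleftrightarrow> (\<exists>G. linear R (?F i) (?F i) G \<and> (\<forall>y\<in>carrier (?F i). G y \<in> K i) \<and>
        (\<forall>y\<in>K i. G y = r \<odot>\<^bsub>?F i\<^esub> y))" for i
    have "P m"
    proof -
      interpret F: module R "?F m" by (rule fm)
      have "inj (\<lambda>x::nat \<Rightarrow> 'a. {x})" by (rule injI) simp
      from transport_submodule[OF fm Ksub[of m] this] obtain N :: "('a, 'a univ) module" and \<eta> \<eta>' where
        N: "module R N" and \<eta>: "linear_on R (?F m) (K m) N \<eta>" and \<eta>K: "\<eta> ` K m = carrier N"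
        and \<eta>': "linear R N (?F m) \<eta>'" and \<eta>'\<eta>: "\<forall>x\<in>K m. \<eta>' (\<eta> x) = x"
        by (elim exE conjE)
      have \<eta>d: "linear R (?F (Suc m)) N (\<lambda>x. \<eta> (d m x))"
        by (rule linear_compose[OF dl \<eta>]) (simp add: K_def)
      have "(\<lambda>x. \<eta> (d m x)) ` carrier (?F (Suc m)) = carrier N"
        unfolding \<eta>K[symmetric] K_def by (simp add: image_image)
      then have fgN: "fin_gen_module R N" by (rule fin_gen_if_image_of_free[OF N \<eta>d])
      \<comment> \<open>The universal cocycle: \<open>d m\<close> itself, with values in the copy
        \<open>N\<close> of its image. That \<open>r f\<close> is a coboundary means that
        \<open>r\<close> on \<open>K m\<close> extends to \<open>F m\<close>.\<close>
      define f where "f = restrict (\<lambda>x. \<eta> (d m x)) (carrier (?F (Suc m)))"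
      have f: "f \<in> mod_hom R (?F (Suc m)) N" unfolding f_def by (rule linear_mod_hom[OF fm \<eta>d])
      have "f (d (Suc m) x) = \<zero>\<^bsub>N\<^esub>" if x: "x \<in> carrier (?F (Suc (Suc m)))" for x
      proof -
        have "d (Suc m) x \<in> carrier (?F (Suc m))" "d m (d (Suc m) x) = \<zero>\<^bsub>?F m\<^esub>" using exS[of m] x by blast+
        then show ?thesis using linear_on_zero[OF fm N \<eta> Ksub] by (simp add: f_def)
      qed
      then have "f \<in> cocycles R b d N n" unfolding Suc cocycles_def using f by simp
      from killed[OF fgN this] obtain g where g: "g \<in> mod_hom R (?F m) N"
        and eq: "(\<lambda>x\<in>carrier (?F (Suc m)). r \<odot>\<^bsub>N\<^esub> f x) = (\<lambda>x\<in>carrier (?F (Suc m)). g (d m x))"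
        unfolding Suc coboundaries.simps by (rule imageE)
      have "linear R (?F m) (?F m) (\<lambda>y. \<eta>' (g y))"
        by (rule linear_compose[OF mod_hom_linear[OF g] \<eta>' mod_homD(1)[OF g]])
      moreover have "\<eta>' (g y) \<in> K m" if y: "y \<in> carrier (?F m)" for y
      proof -
        have "g y \<in> \<eta> ` K m" unfolding \<eta>K using mod_homD(1)[OF g y] .
        then obtain x where "x \<in> K m" "g y = \<eta> x" by auto
        then show ?thesis using \<eta>'\<eta> by simp
      qed
      moreover have "\<eta>' (g y) = r \<odot>\<^bsub>?F m\<^esub> y" if y: "y \<in> K m" for y
      proof -
        obtain x where x: "x \<in> carrier (?F (Suc m))" "y = d m x" using y by (auto simp: K_def)
        have "g y = r \<odot>\<^bsub>N\<^esub> f x" using fun_cong[OF eq, of x] x by simp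
        also have "\<dots> = \<eta> (r \<odot>\<^bsub>?F m\<^esub> y)" using x linear_onD(3)[OF \<eta> rc y] by (simp add: f_def)
        finally show ?thesis using \<eta>'\<eta> F.submoduleE(4)[OF Ksub rc y] by simp
      qed
      ultimately show ?thesis unfolding P_def by blast
    qed
    moreover have "P i" if Pi: "P (Suc i)" for i
    proof -
      interpret F: module R "?F i" by (rule fm)
      interpret FS: module R "?F (Suc i)" by (rule fm)
      obtain G where G: "linear R (?F (Suc i)) (?F (Suc i)) G"
        and GK: "\<forall>y\<in>carrier (?F (Suc i)). G y \<in> K (Suc i)"
        and Gr: "\<forall>y\<in>K (Suc i). G y = r \<odot>\<^bsub>?F (Suc i)\<^esub> y" using Pi unfolding P_def by blast
      \<comment> \<open>\<open>r - G\<close> kills \<open>K (Suc i)\<close>, the kernel of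
        \<open>d i\<close>, so it induces a map \<open>v\<close> from \<open>K i\<close> to
        \<open>F (Suc i)\<close> for which \<open>d i\<close> after \<open>v\<close> is
        multiplication by \<open>r\<close>. Extending \<open>v\<close> to \<open>F i\<close> gives
        the next \<open>G\<close>, namely \<open>d i\<close> after \<open>v'\<close>.\<close>
      let ?w = "\<lambda>y. r \<odot>\<^bsub>?F (Suc i)\<^esub> y \<ominus>\<^bsub>?F (Suc i)\<^esub> G y"
      have w: "linear R (?F (Suc i)) (?F (Suc i)) ?w" by (rule linear_difference[OF fm rc G])
      have "?w y = \<zero>\<^bsub>?F (Suc i)\<^esub>" if "y \<in> carrier (?F (Suc i))" "d i y = \<zero>\<^bsub>?F i\<^esub>" for y
      proof -
        have "y \<in> K (Suc i)" unfolding K_def exS using that by simp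
        then show ?thesis using Gr that(1) rc by simp
      qed
      from factor_through_image[OF fm fm fm Fsub dl w this]
      obtain v where v: "linear_on R (?F i) (K i) (?F (Suc i)) v"
        and vd: "\<forall>y\<in>carrier (?F (Suc i)). v (d i y) = ?w y" unfolding K_def by blast
      \<comment> \<open>Vanishing of Ext extends maps from kernels of maps between free modules. For
        \<open>i > 0\<close> exactness presents \<open>K i\<close> in this way; for
        \<open>i = 0\<close> it is the kernel of the composite of \<open>e\<close> with the
        inclusion of \<open>J\<close> into \<open>R\<close>.\<close>
      have "\<exists>q A. linear R (?F i) (free_module R q) A \<and> K i = {x \<in> carrier (?F i). A x = \<zero>\<^bsub>free_module R q\<^esub>}"
      proof (cases i)
        case 0
        define A where "A x = (\<lambda>j\<in>{..<Suc 0}. \<theta>' (e x))" for x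
        have \<theta>'e: "linear R (?F 0) (ring_module R) (\<lambda>x. \<theta>' (e x))"
          by (rule linear_compose[OF el \<theta>' linear_onD(1)[OF el]])
        note L = linear_onD[OF \<theta>'e, simplified]
        have "linear R (?F 0) (free_module R (Suc 0)) A"
        proof (rule linear_onI)
          show "A x \<in> carrier (free_module R (Suc 0))" if "x \<in> carrier (?F 0)" for x
            unfolding A_def using L(1)[OF that] by (intro free_restrict)
          show "A (x \<oplus>\<^bsub>?F 0\<^esub> y) = A x \<oplus>\<^bsub>free_module R (Suc 0)\<^esub> A y"
            if "x \<in> carrier (?F 0)" "y \<in> carrier (?F 0)" for x y
            using L(2)[OF that] by (auto simp: A_def free_add[where n = "Suc 0"] intro!: restrict_ext)
          show "A (s \<odot>\<^bsub>?F 0\<^esub> x) = s \<odot>\<^bsub>free_module R (Suc 0)\<^esub> A x"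
            if "s \<in> carrier R" "x \<in> carrier (?F 0)" for s x
            using L(3)[OF that] by (auto simp: A_def free_smult[where n = "Suc 0"] intro!: restrict_ext)
        qed
        moreover have "K 0 = {x \<in> carrier (?F 0). A x = \<zero>\<^bsub>free_module R (Suc 0)\<^esub>}"
        proof -
          have "e x = \<zero>\<^bsub>M\<^esub> \<longleftrightarrow> A x = \<zero>\<^bsub>free_module R (Suc 0)\<^esub>" if x: "x \<in> carrier (?F 0)" for x
          proof -
            have "A x = \<zero>\<^bsub>free_module R (Suc 0)\<^esub> \<longleftrightarrow> \<theta>' (e x) = \<zero>"
              by (auto simp: A_def free_zero fun_eq_iff restrict_def)
            also have "\<dots> \<longleftrightarrow> e x = \<zero>\<^bsub>M\<^esub>"
              using \<theta>'J(2)[OF linear_onD(1)[OF el x]] linear_on_zero[OF rm M \<theta> Jsub]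
                linear_on_zero[OF M rm \<theta>' M.carrier_is_submodule] by auto
            finally show ?thesis ..
          qed
          then show ?thesis unfolding K_def ex0 by blast
        qed
        ultimately show ?thesis unfolding 0 by blast
      next
        case (Suc j)
        then show ?thesis using dl[of j] exS[of j] unfolding K_def by blast
      qed
      then obtain q A where A: "linear R (?F i) (free_module R q) A"
        and KA: "K i = {x \<in> carrier (?F i). A x = \<zero>\<^bsub>free_module R q\<^esub>}" by blast
      obtain v' where v': "linear R (?F i) (?F (Suc i)) v'"
        and v'v: "\<forall>x\<in>carrier (?F i). A x = \<zero>\<^bsub>free_module R q\<^esub> \<longrightarrow> v' x = v x"
        using ext_vanishes_free[OF E A v[unfolded KA]] by blast
      have "linear R (?F i) (?F i) (\<lambda>y. d i (v' y))"
        by (rule linear_compose[OF v' dl linear_onD(1)[OF v']])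
      moreover have "d i (v' y) \<in> K i" if "y \<in> carrier (?F i)" for y
        unfolding K_def using linear_onD(1)[OF v' that] by blast
      moreover have "d i (v' y) = r \<odot>\<^bsub>?F i\<^esub> y" if y: "y \<in> K i" for y
      proof -
        obtain x where x: "x \<in> carrier (?F (Suc i))" "y = d i x" using y by (auto simp: K_def)
        have Gx: "G x \<in> carrier (?F (Suc i))" "d i (G x) = \<zero>\<^bsub>?F i\<^esub>"
          using GK x(1) exS[of i] by (auto simp: K_def)
        have rx: "r \<odot>\<^bsub>?F (Suc i)\<^esub> x \<in> carrier (?F (Suc i))" using rc x(1) by simp
        have "v' y = ?w x" using v'v vd y x KA by auto
        then have "d i (v' y) = d i (r \<odot>\<^bsub>?F (Suc i)\<^esub> x) \<ominus>\<^bsub>?F i\<^esub> d i (G x)"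
          using linear_on_minus[OF fm fm dl Fsub rx Gx(1)] by simp
        also have "\<dots> = r \<odot>\<^bsub>?F i\<^esub> y"
          unfolding Gx(2) x(2) using linear_onD(3)[OF dl rc x(1)] linear_onD(1)[OF dl x(1)] rc
          by (simp add: a_minus_def)
        finally show ?thesis .
      qed
      ultimately show ?thesis unfolding P_def by blast
    qed
    ultimately have "P 0" by (induction m) auto
    then obtain G where G: "linear R (?F 0) (?F 0) G" and GK: "\<forall>y\<in>carrier (?F 0). G y \<in> K 0"
      and Gr: "\<forall>y\<in>K 0. G y = r \<odot>\<^bsub>?F 0\<^esub> y" unfolding P_def by blast
    interpret F: module R "?F 0" by (rule fm)
    \<comment> \<open>The same argument once more with \<open>e\<close> in place of a differential:
      \<open>v\<close> maps \<open>M\<close> to \<open>F 0\<close>, and \<open>e\<close> after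
      \<open>v\<close> is multiplication by \<open>r\<close>.\<close>
    let ?w = "\<lambda>y. r \<odot>\<^bsub>?F 0\<^esub> y \<ominus>\<^bsub>?F 0\<^esub> G y"
    have w: "linear R (?F 0) (?F 0) ?w" by (rule linear_difference[OF fm rc G])
    have "?w y = \<zero>\<^bsub>?F 0\<^esub>" if "y \<in> carrier (?F 0)" "e y = \<zero>\<^bsub>M\<^esub>" for y
    proof -
      have "y \<in> K 0" unfolding K_def ex0 using that by simp
      then show ?thesis using Gr that(1) rc by simp
    qed
    from factor_through_image[OF fm M fm Fsub el w this]
    obtain v where v: "linear R M (?F 0) v" and ve: "\<forall>y\<in>carrier (?F 0). v (e y) = ?w y"
      unfolding eonto by blast
    have ev: "e (v z) = r \<odot>\<^bsub>M\<^esub> z" if z: "z \<in> carrier M" for z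
    proof -
      have "z \<in> e ` carrier (?F 0)" unfolding eonto by (rule z)
      then obtain y where y: "y \<in> carrier (?F 0)" "z = e y" by auto
      have Gy: "G y \<in> carrier (?F 0)" "e (G y) = \<zero>\<^bsub>M\<^esub>" using GK y(1) ex0 by (auto simp: K_def)
      have ry: "r \<odot>\<^bsub>?F 0\<^esub> y \<in> carrier (?F 0)" using rc y(1) by simp
      have "e (v z) = e (r \<odot>\<^bsub>?F 0\<^esub> y) \<ominus>\<^bsub>M\<^esub> e (G y)"
        using ve y linear_on_minus[OF fm M el Fsub ry Gy(1)] by simp
      then show ?thesis
        unfolding Gy(2) y(2) using linear_onD(3)[OF el rc y(1)] linear_onD(1)[OF el y(1)] rc
        by (simp add: a_minus_def)
    qed
    have \<theta>'e: "linear R (?F 0) (ring_module R) (\<lambda>x. \<theta>' (e x))"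
      by (rule linear_compose[OF el \<theta>' linear_onD(1)[OF el]])
    have vc: "v (\<theta> z) \<in> carrier (?F 0)" if "z \<in> J" for z
      using linear_onD(1)[OF v] linear_onD(1)[OF \<theta> that] by blast
    have "linear_on R (ring_module R) J (ring_module R) (\<lambda>z. v (\<theta> z) k)" if k: "k < b 0" for k
    proof -
      have "linear_on R (ring_module R) J (?F 0) (\<lambda>z. v (\<theta> z))"
        by (rule linear_compose[OF \<theta> v linear_onD(1)[OF \<theta>]])
      then show ?thesis by (rule linear_compose[OF _ linear_coordinate[OF k] vc])
    qed
    moreover have "\<theta>' (e (unit_vec (b 0) k)) \<in> J" for k
      by (rule \<theta>'J(1)[OF linear_onD(1)[OF el unit_vec_closed]])
    \<comment> \<open>The factorization through \<open>F 0\<close> written in coordinates: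
      \<open>u k\<close> are the components of the map from \<open>J\<close> to \<open>F 0\<close>,
      and \<open>c k\<close> are the images of the unit vectors in \<open>J\<close>.\<close>
    moreover have "r \<otimes> z = (\<Oplus>k\<in>{..<b 0}. v (\<theta> z) k \<otimes> \<theta>' (e (unit_vec (b 0) k)))" if z: "z \<in> J" for z
    proof -
      have "r \<otimes> z = \<theta>' (\<theta> (r \<otimes> z))" using \<theta>'\<theta> ideal_mult_closed[OF J rc z] by simp
      also have "\<theta> (r \<otimes> z) = e (v (\<theta> z))"
        using linear_onD(3)[OF \<theta> rc z] ev[OF linear_onD(1)[OF \<theta> z]] by simp
      also have "\<theta>' (e (v (\<theta> z))) = (\<Oplus>k\<in>{..<b 0}. v (\<theta> z) k \<otimes> \<theta>' (e (unit_vec (b 0) k)))"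
        using linear_expand[OF rm \<theta>'e vc[OF z]] by simp
      finally show ?thesis .
    qed
    ultimately show ?thesis
      by (intro exI[of _ "b 0"] exI[of _ "\<lambda>k z. v (\<theta> z) k"] exI[of _ "\<lambda>k. \<theta>' (e (unit_vec (b 0) k))"]) blast
  qed
qed

text \<open>Evaluate the factorization at an element \<open>\<delta>\<close> of \<open>J\<close>
  that is a unit of \<open>Q\<close>: \<open>r \<delta>\<close> is the sum of
  \<open>u k \<delta> c k\<close>. Multiplication by \<open>q\<close> replaces \<open>c k\<close> by
  \<open>c' k\<close> in \<open>J\<close>, and linearity of \<open>u k\<close> turns
  \<open>u k \<delta> c' k\<close> into \<open>\<delta> u k (c' k)\<close>. Cancelling
  \<open>\<delta>\<close> leaves \<open>r q\<close> as the sum of the \<open>u k (c' k)\<close>, an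
  element of \<open>R\<close>.\<close>

lemma coh_ann_subset_conductor:
  assumes E: "ext_vanishes (ring_module R)" shows "coh_ann R \<subseteq> conductor R"
proof
  fix r assume "r \<in> coh_ann R"
  then obtain n where r: "r \<in> coh_ann_n R n" by (auto simp: coh_ann_def)
  then have rc: "r \<in> carrier R" by (simp add: coh_ann_n_def)
  let ?Q = "total_quotient_ring R" and ?\<iota> = "tq_embed R"
  interpret T: total_quotient ?Q R ?\<iota> by (rule total_quotient_ring_total_quotient)
  have "?\<iota> r \<otimes>\<^bsub>?Q\<^esub> q \<in> ?\<iota> ` carrier R" if q: "q \<in> T.Rbar" for q
  proof -
    have qc: "q \<in> carrier ?Q" using q by (rule T.Rbar_carrier)
    obtain S s d where S: "T.asub S" "s \<in> S" "s \<in> Units ?Q" "d \<in> Units ?Q"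
      and SA: "\<And>x. x \<in> S \<Longrightarrow> d \<otimes>\<^bsub>?Q\<^esub> x \<in> ?\<iota> ` carrier R"
      and Sq: "\<And>x. x \<in> S \<Longrightarrow> q \<otimes>\<^bsub>?Q\<^esub> x \<in> S" using q unfolding T.Rbar_def by blast
    have dc: "d \<in> carrier ?Q" using S(4) by (rule T.Q.Units_closed)
    note Sc = T.asubD(1)[OF S(1)]
    \<comment> \<open>As \<open>d S\<close> lies in \<open>R\<close>, this is a copy of
      \<open>d S\<close> inside \<open>R\<close>; it inherits stability under \<open>q\<close> from
      \<open>S\<close> and contains the unit \<open>d s\<close> of \<open>Q\<close>.\<close>
    define J where "J = {x \<in> carrier R. ?\<iota> x \<in> (\<lambda>x. d \<otimes>\<^bsub>?Q\<^esub> x) ` S}"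
    have J: "ideal J R" unfolding J_def by (intro T.asub_preimage_ideal T.asub_scale S(1) dc)
    note Jc = ideal_carrier[OF J]
    obtain \<delta> where \<delta>: "\<delta> \<in> carrier R" "?\<iota> \<delta> = d \<otimes>\<^bsub>?Q\<^esub> s" using SA[OF S(2)] by auto
    have \<delta>J: "\<delta> \<in> J" unfolding J_def using \<delta> S(2) by auto
    have \<delta>u: "?\<iota> \<delta> \<in> Units ?Q" unfolding \<delta>(2) using S by simp
    have stable: "\<exists>w'\<in>J. q \<otimes>\<^bsub>?Q\<^esub> ?\<iota> w = ?\<iota> w'" if w: "w \<in> J" for w
    proof -
      obtain x where x: "x \<in> S" "?\<iota> w = d \<otimes>\<^bsub>?Q\<^esub> x" using w unfolding J_def by auto
      have eq: "q \<otimes>\<^bsub>?Q\<^esub> ?\<iota> w = d \<otimes>\<^bsub>?Q\<^esub> (q \<otimes>\<^bsub>?Q\<^esub> x)"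
        unfolding x(2) using qc dc Sc[OF x(1)] by (simp add: T.Q.m_lcomm)
      obtain w' where w': "w' \<in> carrier R" "d \<otimes>\<^bsub>?Q\<^esub> (q \<otimes>\<^bsub>?Q\<^esub> x) = ?\<iota> w'" using SA[OF Sq[OF x(1)]] by auto
      then have "w' \<in> J" unfolding J_def using Sq[OF x(1)] w'(2)[symmetric] by blast
      then show ?thesis using eq w'(2) by auto
    qed
    obtain p u c where uc: "\<forall>k<p::nat. linear_on R (ring_module R) J (ring_module R) (u k) \<and> c k \<in> J"
      and rz: "\<forall>z\<in>J. r \<otimes> z = (\<Oplus>k\<in>{..<p}. u k z \<otimes> c k)"
      using coh_ann_factors_through_free[OF E r J] by blast
    have u: "linear_on R (ring_module R) J (ring_module R) (u k)" and cJ: "c k \<in> J" if "k < p" for k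
      using uc that by auto
    have "\<forall>k\<in>{..<p}. \<exists>c'. c' \<in> J \<and> q \<otimes>\<^bsub>?Q\<^esub> ?\<iota> (c k) = ?\<iota> c'" using stable cJ by blast
    then obtain c' where c': "\<forall>k\<in>{..<p}. c' k \<in> J \<and> q \<otimes>\<^bsub>?Q\<^esub> ?\<iota> (c k) = ?\<iota> (c' k)"
      by (rule bchoice[THEN exE])
    have ucl: "u k z \<in> carrier R" if "k < p" "z \<in> J" for k z
      using linear_onD(1)[OF u[OF that(1)] that(2)] by simp
    \<comment> \<open>Both sides equal \<open>u k (\<delta> c' k)\<close>: in \<open>Q\<close>, the
      map \<open>u k\<close> is multiplication by the single fraction
      \<open>u k \<delta> / \<delta>\<close>.\<close>
    have swap: "u k \<delta> \<otimes> c' k = \<delta> \<otimes> u k (c' k)" if k: "k < p" for k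
    proof -
      have c'J: "c' k \<in> J" using c' k by simp
      have "u k (\<delta> \<otimes> c' k) = \<delta> \<otimes> u k (c' k)" using linear_onD(3)[OF u[OF k] \<delta>(1) c'J] by simp
      moreover have "u k (c' k \<otimes> \<delta>) = c' k \<otimes> u k \<delta>"
        using linear_onD(3)[OF u[OF k] Jc[OF c'J] \<delta>J] by simp
      ultimately show ?thesis
        using m_comm[OF \<delta>(1) Jc[OF c'J]] m_comm[OF ucl[OF k \<delta>J] Jc[OF c'J]] by simp
    qed
    define a where "a = (\<Oplus>k\<in>{..<p}. u k (c' k))"
    have a: "a \<in> carrier R" unfolding a_def using ucl c' by (intro finsum_closed) auto
    have "?\<iota> \<delta> \<otimes>\<^bsub>?Q\<^esub> (?\<iota> r \<otimes>\<^bsub>?Q\<^esub> q) = ?\<iota> (r \<otimes> \<delta>) \<otimes>\<^bsub>?Q\<^esub> q"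
      using rc \<delta>(1) qc by (simp add: T.Q.m_ac)
    also have "\<dots> = (\<Oplus>\<^bsub>?Q\<^esub>k\<in>{..<p}. ?\<iota> (u k \<delta> \<otimes> c k)) \<otimes>\<^bsub>?Q\<^esub> q"
      using bspec[OF rz \<delta>J] ucl[OF _ \<delta>J] Jc[OF cJ] by (simp add: T.\<iota>.hom_finsum Pi_iff o_def)
    also have "\<dots> = (\<Oplus>\<^bsub>?Q\<^esub>k\<in>{..<p}. ?\<iota> (u k \<delta> \<otimes> c k) \<otimes>\<^bsub>?Q\<^esub> q)"
      using ucl[OF _ \<delta>J] Jc[OF cJ] qc by (intro T.Q.finsum_ldistr) auto
    also have "\<dots> = (\<Oplus>\<^bsub>?Q\<^esub>k\<in>{..<p}. ?\<iota> (\<delta> \<otimes> u k (c' k)))"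
    proof (rule T.Q.finsum_cong')
      fix k assume k: "k \<in> {..<p}"
      then have c'k: "c' k \<in> J" "q \<otimes>\<^bsub>?Q\<^esub> ?\<iota> (c k) = ?\<iota> (c' k)" and kp: "k < p" using c' by auto
      have "?\<iota> (u k \<delta> \<otimes> c k) \<otimes>\<^bsub>?Q\<^esub> q = ?\<iota> (u k \<delta>) \<otimes>\<^bsub>?Q\<^esub> (q \<otimes>\<^bsub>?Q\<^esub> ?\<iota> (c k))"
        using ucl[OF kp \<delta>J] Jc[OF cJ[OF kp]] qc by (simp add: T.Q.m_ac)
      also have "\<dots> = ?\<iota> (u k \<delta> \<otimes> c' k)" unfolding c'k(2) using ucl[OF kp \<delta>J] Jc[OF c'k(1)] by simp
      finally show "?\<iota> (u k \<delta> \<otimes> c k) \<otimes>\<^bsub>?Q\<^esub> q = ?\<iota> (\<delta> \<otimes> u k (c' k))" using swap[OF kp] by simp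
    qed (use ucl c' \<delta>(1) in auto)
    also have "\<dots> = ?\<iota> (\<delta> \<otimes> a)"
    proof -
      have "\<delta> \<otimes> a = (\<Oplus>k\<in>{..<p}. \<delta> \<otimes> u k (c' k))"
        unfolding a_def using ucl c' \<delta>(1) by (intro finsum_rdistr) auto
      then show ?thesis using ucl c' \<delta>(1) by (simp add: T.\<iota>.hom_finsum Pi_iff o_def)
    qed
    finally have "?\<iota> \<delta> \<otimes>\<^bsub>?Q\<^esub> (?\<iota> r \<otimes>\<^bsub>?Q\<^esub> q) = ?\<iota> \<delta> \<otimes>\<^bsub>?Q\<^esub> ?\<iota> a" using \<delta>(1) a by simp
    then have "?\<iota> r \<otimes>\<^bsub>?Q\<^esub> q = ?\<iota> a"
      by (rule T.unit_cancel[OF \<delta>u, rotated 2]) (use rc qc a in auto)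
    then show ?thesis using a by blast
  qed
  then show "r \<in> conductor R" unfolding conductor_eq using rc by simp
qed

end

theorem theorem4p3:
  fixes R :: "('a, 'm) ring_scheme"
  assumes "noetherian_ring R"
    and "complete_local_ring R"
    and "krull_dim R = 1"
    and "reduced_ring R"
    and "gorenstein_ring R"
  shows "coh_ann R = conductor R"
proof
  have "local_ring R" using assms(2) by (simp add: complete_local_ring_def)
  then interpret curve_ring R
    using assms by (intro curve_ring.intro reduced_noetherian_cring.intro noetherian_cring.intro
      reduced_noetherian_cring_axioms.intro curve_ring_axioms.intro) (auto simp: local_ring_def)
  show "coh_ann R \<subseteq> conductor R"
    by (rule coh_ann_subset_conductor[OF gorenstein_ext_vanishes[OF assms(5)]])
  show "conductor R \<subseteq> coh_ann R"
    using conductor_subset_coh_ann_2 by (auto simp: coh_ann_def)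
qed

end
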